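(* Let $(K,v)$ be any valued field, $\Gamma_0$ an ordered abelian group extension of $vK$ such that $\Gamma_0/vK$ is a torsion group, and $k_0$ an algebraic extension of $Kv$. Further, let $\Gamma$ be the abelian group $\Gamma_0\oplus\mathbb{Z}$ endowed with any extension of the ordering of $\Gamma_0$. (1) Assume that $\Gamma_0/vK$ and $k_0|Kv$ are finite. If $v$ is trivial on $K$, then assume in addition that $k_0|Kv$ is simple. Then there is an extension of $v$ from $K$ to the rational function field $K(x)$ in one variable which has value group $\Gamma$ and residue field $k_0$. If $v$ is non-trivial on $K$, then there is also an extension of $v$ to $K(x)$ which has value group $\Gamma_0$ and as residue field a rational function field in one variable over $k_0$. (2) Assume that $v$ is non-trivial on $K$ and that $\Gamma_0/vK$ and $k_0|Kv$ are countably generated. Suppose that at least one of them is infinite or that $(K,v)$ admits an immediate transcendental extension. Then there is an extension of $v$ from $K$ to $K(x)$ which has value group $\Gamma_0$ and residue field $k_0$.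
   Context: For a valued field $(L,v)$, $vL$ denotes the value group and $Lv$ the residue field. An extension $(L|K,v)$ of valued fields is immediate if $vL=vK$ and $Lv=Kv$. Having a prescribed value group (residue field) is understood up to isomorphism over $vK$ (over $Kv$). "Infinite" means that the group $\Gamma_0/vK$ is infinite, respectively that the field extension $k_0|Kv$ has infinite degree. *)

theory Defs
  imports
    "HOL-Algebra.Algebra"
    "HOL-Algebra.Algebraic_Closure_Type"
    "HOL-Computational_Algebra.Fraction_Field"
    "HOL-Library.Countable_Set"
begin

section \<open>Ordered abelian groups and their quotients\<close>

definition additive_group :: "'g::ab_group_add monoid" where
  "additive_group = \<lparr>carrier = UNIV, monoid.mult = (+), one = 0\<rparr>"

definition torsion_group :: "('a, 'b) monoid_scheme \<Rightarrow> bool" where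
  "torsion_group G \<longleftrightarrow>
     (\<forall>x \<in> carrier G. \<exists>n::nat. 0 < n \<and> x [^]\<^bsub>G\<^esub> n = \<one>\<^bsub>G\<^esub>)"

definition countably_generated_group :: "('a, 'b) monoid_scheme \<Rightarrow> bool" where
  "countably_generated_group G \<longleftrightarrow>
     (\<exists>S. S \<subseteq> carrier G \<and> countable S \<and> generate G S = carrier G)"

text \<open>
  An ordered abelian group is a type of class \<open>linordered_ab_group_add\<close>.
  \<open>sum_with_int_order \<theta>\<close> says that, along the group isomorphism \<open>\<theta>\<close>, the ordered group
  \<open>'d\<close> is the group \<open>'g \<oplus> \<int>\<close> with an ordering that restricts to the one of \<open>'g\<close>.
  Transporting the order of \<open>'d\<close> along \<open>\<theta>\<close> gives an arbitrary such ordering.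
\<close>

definition sum_with_int_order ::
    "('g::linordered_ab_group_add \<times> int \<Rightarrow> 'd::linordered_ab_group_add) \<Rightarrow> bool" where
  "sum_with_int_order \<theta> \<longleftrightarrow>
     \<theta> \<in> iso (additive_group \<times>\<times> additive_group) additive_group \<and>
     (\<forall>a b. a \<le> b \<longleftrightarrow> \<theta> (a, 0) \<le> \<theta> (b, 0))"


section \<open>Field extensions\<close>

text \<open>
  Each predicate is about the field \<open>'f\<close> as an extension of its subfield \<open>F\<close>.
\<close>

definition algebraic_field_ext :: "'f::field set \<Rightarrow> bool" where
  "algebraic_field_ext F \<longleftrightarrow> (\<forall>y. \<not> ring.transcendental ring_of_type_algebra F y)"

definition finite_field_ext :: "'f::field set \<Rightarrow> bool" where
  "finite_field_ext F \<longleftrightarrow> ring.finite_dimension ring_of_type_algebra F UNIV"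

definition simple_field_ext :: "'f::field set \<Rightarrow> bool" where
  "simple_field_ext F \<longleftrightarrow> (\<exists>y. generate_field ring_of_type_algebra (insert y F) = UNIV)"

definition countably_generated_field_ext :: "'f::field set \<Rightarrow> bool" where
  "countably_generated_field_ext F \<longleftrightarrow>
     (\<exists>S. countable S \<and> generate_field ring_of_type_algebra (F \<union> S) = UNIV)"

text \<open>
  The rational function field over \<open>'k\<close> in one variable is the type \<open>'k poly fract\<close>.
\<close>

definition ratfun_const :: "'k::field \<Rightarrow> 'k poly fract" where
  "ratfun_const a = Fract [:a:] 1"


section \<open>Valued fields\<close>

text \<open>
  Krull valuations, written additively. The value at \<open>0\<close>, conventionally infinity, is left
  unspecified and no definition below depends on it.
\<close>

definition valuation :: "('k::field \<Rightarrow> 'g::linordered_ab_group_add) \<Rightarrow> bool" where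
  "valuation v \<longleftrightarrow>
     (\<forall>a b. a \<noteq> 0 \<longrightarrow> b \<noteq> 0 \<longrightarrow> v (a * b) = v a + v b) \<and>
     (\<forall>a b. a \<noteq> 0 \<longrightarrow> b \<noteq> 0 \<longrightarrow> a + b \<noteq> 0 \<longrightarrow> min (v a) (v b) \<le> v (a + b))"

definition value_group :: "('k::field \<Rightarrow> 'g::linordered_ab_group_add) \<Rightarrow> 'g set" where
  "value_group v = v ` (UNIV - {0})"

definition trivial_valuation :: "('k::field \<Rightarrow> 'g::linordered_ab_group_add) \<Rightarrow> bool" where
  "trivial_valuation v \<longleftrightarrow> value_group v = {0}"

definition valuation_ring :: "('k::field \<Rightarrow> 'g::linordered_ab_group_add) \<Rightarrow> 'k ring" where
  "valuation_ring v = ring_of_type_algebra\<lparr>carrier := {a. a = 0 \<or> 0 \<le> v a}\<rparr>"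

definition valuation_ideal :: "('k::field \<Rightarrow> 'g::linordered_ab_group_add) \<Rightarrow> 'k set" where
  "valuation_ideal v = {a. a = 0 \<or> 0 < v a}"

definition residue_field :: "('k::field \<Rightarrow> 'g::linordered_ab_group_add) \<Rightarrow> 'k set ring" where
  "residue_field v = valuation_ring v Quot valuation_ideal v"

definition residue :: "('k::field \<Rightarrow> 'g::linordered_ab_group_add) \<Rightarrow> 'k \<Rightarrow> 'k set" where
  "residue v a = valuation_ideal v +>\<^bsub>valuation_ring v\<^esub> a"

text \<open>
  \<open>\<Gamma>\<^sub>0/vK\<close>, where \<open>\<Gamma>\<^sub>0\<close> is the whole type \<open>'g\<close>.
\<close>

definition value_quotient :: "('k::field \<Rightarrow> 'g::linordered_ab_group_add) \<Rightarrow> 'g set monoid" where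
  "value_quotient v = additive_group Mod value_group v"

text \<open>
  \<open>w\<close> extends \<open>v\<close>, where \<open>i\<close> embeds the fields and \<open>j\<close> embeds the ordered groups in which the
  valuations take their values.
\<close>

definition valuation_extends ::
    "('k::field \<Rightarrow> 'l::field) \<Rightarrow> ('g::linordered_ab_group_add \<Rightarrow> 'd::linordered_ab_group_add) \<Rightarrow>
     ('k \<Rightarrow> 'g) \<Rightarrow> ('l \<Rightarrow> 'd) \<Rightarrow> bool" where
  "valuation_extends i j v w \<longleftrightarrow>
     i \<in> ring_hom ring_of_type_algebra ring_of_type_algebra \<and>
     valuation w \<and> (\<forall>a. a \<noteq> 0 \<longrightarrow> w (i a) = j (v a))"

text \<open>
  The field \<open>'f\<close> is regarded as an extension of the residue field \<open>Kv\<close> by means of \<open>\<phi>\<close>.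
  The isomorphism is required to be one over \<open>Kv\<close>: it must be compatible with \<open>\<phi>\<close> and with the
  canonical embedding of \<open>Kv\<close> in \<open>Lw\<close>, which sends the residue of \<open>a\<close> to that of \<open>i a\<close>.
\<close>

definition residue_field_iso_over ::
    "('k::field \<Rightarrow> 'l::field) \<Rightarrow> ('k \<Rightarrow> 'g::linordered_ab_group_add) \<Rightarrow>
     ('l \<Rightarrow> 'd::linordered_ab_group_add) \<Rightarrow> ('k set \<Rightarrow> 'f::field) \<Rightarrow> bool" where
  "residue_field_iso_over i v w \<phi> \<longleftrightarrow>
     (\<exists>h \<in> ring_iso (residue_field w) ring_of_type_algebra.
        \<forall>a \<in> carrier (valuation_ring v). h (residue w (i a)) = \<phi> (residue v a))"

text \<open>
  In an immediate extension \<open>(L|K, u)\<close> the value group of \<open>u\<close> is that of \<open>v\<close>, so \<open>u\<close> may be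
  taken with values in the same ordered group \<open>'g\<close> as \<open>v\<close>. The last conjunct says that the
  canonical embedding of \<open>Kv\<close> in \<open>Lu\<close> is onto. In a hypothesis that such an extension exists,
  the type variable \<open>'l\<close> of a theorem ranges over all possible fields \<open>L\<close>.
\<close>

definition immediate_transcendental_ext ::
    "('k::field \<Rightarrow> 'l::field) \<Rightarrow> ('k \<Rightarrow> 'g::linordered_ab_group_add) \<Rightarrow> ('l \<Rightarrow> 'g) \<Rightarrow> bool" where
  "immediate_transcendental_ext i v u \<longleftrightarrow>
     valuation_extends i id v u \<and>
     \<not> algebraic_field_ext (range i) \<and>
     value_group u = value_group v \<and>
     carrier (residue_field u) = (\<lambda>a. residue u (i a)) ` carrier (valuation_ring v)"

end

theory Submission
  imports Defs
begin

text \<open>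
  The valuations are built on \<open>K[x]\<close> by MacLane's method, without passing to algebraic extensions
  of \<open>K\<close>. A stage is a monic irreducible \<open>\<phi>\<close> with a valuation \<open>V\<close> of \<open>K[x]/(\<phi>)\<close>. Giving \<open>\<phi>\<close>
  a sufficiently large value \<open>\<gamma>\<close>, the formula \<open>W (\<Sum> a\<^sub>k \<phi>\<^sup>k) = min (V a\<^sub>k + k \<gamma>)\<close> defines a
  valuation of \<open>K[x]\<close>, and a key polynomial \<open>\<phi>'\<close> for \<open>W\<close> gives a new stage. If \<open>\<gamma>\<close> has order \<open>e\<close>
  modulo the value group, then \<open>\<phi>\<^sup>e - d\<close> with \<open>V d = e \<gamma>\<close> is a key polynomial and adjoins \<open>\<gamma>\<close> to
  the value group; if \<open>\<gamma>\<close> is already a value, a lift of the minimal polynomial of \<open>\<tau>\<close> over the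
  residue field adjoins \<open>\<tau>\<close> to the residue field.

  Finitely many steps reach \<open>\<Gamma>\<^sub>0\<close> and \<open>k\<^sub>0\<close> when these are finite over \<open>vK\<close> and \<open>Kv\<close>. Then \<open>W\<close> itself,
  with \<open>\<gamma>\<close> outside or inside \<open>\<Gamma>\<^sub>0\<close>, gives both extensions of part (1). In part (2) the steps either go
  on forever with unbounded degrees, and the limit of the stages is the extension, or they are carried
  out over the immediate extension \<open>L\<close> with polynomials over \<open>K\<close>; the last one, \<open>\<phi>\<close>, is then perturbed to
  \<open>\<phi> - z\<close> for a transcendental \<open>z\<close> of large value, so that \<open>K[x]\<close> embeds in \<open>L[x]/(\<phi> - z)\<close>.
\<close>

section \<open>Pseudo-valuations and residue maps\<close>

text \<open>Why \<open>\<beta>\<close> is there: for \<open>a\<close>, \<open>b\<close> of degree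
  below that of \<phi> write \<open>a * b = q * \<phi> + r\<close>. Multiplication in the quotient
  field sees only \<open>r\<close>, so \<open>W\<close> can be multiplicative only if
  \<open>q * \<phi>\<close> is negligible, that is, if \<open>V q + \<gamma>\<close> exceeds
  \<open>V a + V b\<close>. Then \<open>W\<close> behaves like a Gauss valuation on polynomials in
  \<phi> over \<open>K[x]/(\<phi>)\<close>. After a step, the value of the new key polynomial is the
  new \<open>\<beta>\<close>. Every step therefore needs some \<gamma> above \<beta>. If
  \<open>v\<close> is non-trivial, torsion makes \<open>vK\<close> cofinal in
  \<open>\<Gamma>\<^sub>0\<close>, and a wanted value can be shifted by an element of
  \<open>vK\<close>. If \<open>v\<close> is trivial, there is no positive value to use; but at the
  stage \<open>K[x]/(x)\<close> products of constants have quotient 0, so \<beta> may be taken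
  negative, and one residual step with \<open>\<gamma> = 0\<close> is possible. A primitive element
  makes this one step enough. The other obstacle is that each stage is algebraic over its base
  field. In the limit, unbounded degrees keep every nonzero polynomial away from value infinity.
  Over \<open>L\<close>, key polynomials with coefficients in \<open>K\<close> exist because only
  initial forms matter, and immediacy lets those be approximated from \<open>K\<close>.\<close>

primrec nmul :: "nat \<Rightarrow> 'g::ab_group_add \<Rightarrow> 'g" where
  "nmul 0 g = 0"
| "nmul (Suc n) g = g + nmul n g"

lemma nmul_1 [simp]: "nmul 1 g = g" "nmul (Suc 0) g = g"
  by simp_all

lemma nmul_zero [simp]: "nmul n 0 = 0"
  by (induction n) auto

lemma nmul_add: "nmul (m + n) g = nmul m g + nmul n g"
  by (induction m) (auto simp: algebra_simps)

lemma nmul_distrib: "nmul n (g + h) = nmul n g + nmul n h"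
  by (induction n) (auto simp: algebra_simps)

lemma nmul_uminus: "nmul n (- g) = - nmul n g"
  by (induction n) (auto simp: algebra_simps)

lemma nmul_diff: "m \<le> n \<Longrightarrow> nmul (n - m) g = nmul n g - nmul m g"
  using nmul_add[of "n - m" m g] by simp

lemma nmul_pos:
  fixes g :: "'g::linordered_ab_group_add"
  shows "0 < g \<Longrightarrow> 0 < n \<Longrightarrow> g \<le> nmul n g"
proof (induction n)
  case (Suc n)
  then show ?case by (cases n) (auto simp: add_increasing2)
qed simp

lemma nmul_eq_0_iff:
  fixes g :: "'g::linordered_ab_group_add"
  shows "nmul n g = 0 \<longleftrightarrow> n = 0 \<or> g = 0"
proof (cases n)
  case (Suc m)
  have "nmul n g \<noteq> 0" if "g \<noteq> 0"
  proof (cases "0 < g")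
    case True
    then show ?thesis using nmul_pos[of g n] Suc by (metis leD zero_less_Suc)
  next
    case False
    then have "0 < - g" using that by auto
    then show ?thesis using nmul_pos[of "- g" n] Suc
      by (metis neg_equal_0_iff_equal nmul_uminus not_le zero_less_Suc)
  qed
  then show ?thesis using Suc by auto
qed simp

lemma nmul_add_closed:
  assumes "0 \<in> A" "\<And>x y. x \<in> A \<Longrightarrow> y \<in> A \<Longrightarrow> x + y \<in> A" "a \<in> A"
  shows "nmul n a \<in> A"
  using assms by (induction n) auto

text \<open>
  A pseudo-valuation: \<open>V\<close> is a valuation of the quotient by the prime ideal \<open>N\<close>, whose elements
  have the value infinity.
\<close>

locale pval =
  fixes N :: "'a::comm_ring_1 \<Rightarrow> bool" and V :: "'a \<Rightarrow> 'g::linordered_ab_group_add"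
  assumes N_0: "N 0"
    and N_1: "\<not> N 1"
    and N_add: "N a \<Longrightarrow> N b \<Longrightarrow> N (a + b)"
    and N_mult: "N (a * b) \<longleftrightarrow> N a \<or> N b"
    and V_cong: "N (a - b) \<Longrightarrow> V a = V b"
    and V_mult: "\<not> N a \<Longrightarrow> \<not> N b \<Longrightarrow> V (a * b) = V a + V b"
    and V_add: "\<not> N a \<Longrightarrow> \<not> N b \<Longrightarrow> \<not> N (a + b) \<Longrightarrow> min (V a) (V b) \<le> V (a + b)"
begin

text \<open>Comparisons that treat the elements of \<open>N\<close> as having value infinity, so
  that the value assigned to them by \<open>V\<close> never matters.\<close>

definition vge :: "'a \<Rightarrow> 'g \<Rightarrow> bool" where "vge a g \<longleftrightarrow> N a \<or> g \<le> V a"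
definition vgt :: "'a \<Rightarrow> 'g \<Rightarrow> bool" where "vgt a g \<longleftrightarrow> N a \<or> g < V a"

lemma N_uminus: "N (- a) \<longleftrightarrow> N a"
  using N_mult[of "-1" a] N_mult[of "-1" "-a"] N_mult[of "-1" "-1"] N_1 by auto

lemma N_diff: "N a \<Longrightarrow> N b \<Longrightarrow> N (a - b)"
  using N_add[of a "- b"] by (simp add: N_uminus)

lemma N_diff_iff: "N (a - b) \<Longrightarrow> N a \<longleftrightarrow> N b"
  using N_diff[of a "a - b"] N_add[of "a - b" b] by auto

lemma N_power: "N (a ^ n) \<longleftrightarrow> N a \<and> 0 < n"
  by (induction n) (auto simp: N_mult N_1)

lemma V_1 [simp]: "V 1 = 0"
  using V_mult[of 1 1] by (simp add: N_1)

lemma V_uminus [simp]: "V (- a) = V a"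
proof (cases "N a")
  case True
  then show ?thesis using V_cong[of "- a" a] N_diff[of "- a" a] by (simp add: N_uminus)
next
  case False
  have "V (-1) + V (-1) = 0"
    using V_mult[of "-1" "-1"] by (simp add: N_uminus N_1)
  then have "V (-1) = 0" by simp
  then show ?thesis using V_mult[of "-1" a] False by (simp add: N_uminus N_1)
qed

lemma V_power: "\<not> N a \<Longrightarrow> V (a ^ n) = nmul n (V a)"
  by (induction n) (auto simp: V_mult N_power)

lemma vgt_imp_vge: "vgt a g \<Longrightarrow> vge a g"
  by (auto simp: vge_def vgt_def)

lemma vge_0 [simp]: "vge 0 g" "vgt 0 g"
  by (auto simp: vge_def vgt_def N_0)

lemma vge_self: "vge a (V a)"
  by (auto simp: vge_def)

lemma vgt_mono: "vgt a g \<Longrightarrow> h \<le> g \<Longrightarrow> vgt a h"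
  by (auto simp: vgt_def)

lemma vge_imp_vgt: "vge a g \<Longrightarrow> h < g \<Longrightarrow> vgt a h"
  by (auto simp: vge_def vgt_def)

lemma N_add_iff: "N a \<Longrightarrow> N (a + b) \<longleftrightarrow> N b"
  using N_diff_iff[of "a + b" b] by simp

lemma V_add_N: "N a \<Longrightarrow> V (a + b) = V b"
  using V_cong[of "a + b" b] by simp

lemma vge_add:
  assumes "vge a g" "vge b g"
  shows "vge (a + b) g"
proof (cases "N a \<or> N b")
  case True
  then show ?thesis
    using assms V_add_N[of a b] V_add_N[of b a] N_add_iff[of a b] N_add_iff[of b a]
    by (auto simp: vge_def add.commute)
next
  case False
  then show ?thesis using assms V_add[of a b] min.boundedI[of g "V a" "V b"]
    unfolding vge_def by (meson order_trans)
qed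

lemma vgt_add:
  assumes "vgt a g" "vgt b g"
  shows "vgt (a + b) g"
proof (cases "N a \<or> N b")
  case True
  then show ?thesis
    using assms V_add_N[of a b] V_add_N[of b a] N_add_iff[of a b] N_add_iff[of b a]
    by (auto simp: vgt_def add.commute)
next
  case False
  then show ?thesis using assms V_add[of a b] min_less_iff_conj[of g "V a" "V b"]
    unfolding vgt_def by (meson less_le_trans min_less_iff_conj)
qed

lemma vge_uminus [simp]: "vge (- a) g \<longleftrightarrow> vge a g"
  by (simp add: vge_def N_uminus)

lemma vgt_uminus [simp]: "vgt (- a) g \<longleftrightarrow> vgt a g"
  by (simp add: vgt_def N_uminus)

lemma vge_diff: "vge a g \<Longrightarrow> vge b g \<Longrightarrow> vge (a - b) g"
  using vge_add[of a g "- b"] by simp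

lemma vgt_diff: "vgt a g \<Longrightarrow> vgt b g \<Longrightarrow> vgt (a - b) g"
  using vgt_add[of a g "- b"] by simp

lemma vge_sum: "(\<And>x. x \<in> A \<Longrightarrow> vge (f x) g) \<Longrightarrow> vge (sum f A) g"
  by (induction A rule: infinite_finite_induct) (auto intro: vge_add)

lemma vgt_sum: "(\<And>x. x \<in> A \<Longrightarrow> vgt (f x) g) \<Longrightarrow> vgt (sum f A) g"
  by (induction A rule: infinite_finite_induct) (auto intro: vgt_add)

lemma vge_mult:
  assumes "vge a g" "vge b h"
  shows "vge (a * b) (g + h)"
proof (cases "N a \<or> N b")
  case False
  then show ?thesis using assms V_mult[of a b] by (auto simp: vge_def intro: add_mono)
qed (auto simp: vge_def N_mult)

lemma vgt_mult:
  assumes "vge a g" "vgt b h"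
  shows "vgt (a * b) (g + h)"
proof (cases "N a \<or> N b")
  case False
  then show ?thesis using assms V_mult[of a b]
    by (auto simp: vge_def vgt_def intro: add_le_less_mono)
qed (auto simp: vgt_def N_mult)

lemma vgt_mult2: "vgt a g \<Longrightarrow> vge b h \<Longrightarrow> vgt (a * b) (g + h)"
  using vgt_mult[of b h a g] by (simp add: ac_simps)

lemma vge_mult_iff: "\<not> N a \<Longrightarrow> vge (a * b) (V a + g) \<longleftrightarrow> vge b g"
  by (cases "N b") (auto simp: vge_def N_mult V_mult)

lemma vgt_mult_iff: "\<not> N a \<Longrightarrow> vgt (a * b) (V a + g) \<longleftrightarrow> vgt b g"
  by (cases "N b") (auto simp: vgt_def N_mult V_mult)

lemma vge_power: "vge a g \<Longrightarrow> vge (a ^ n) (nmul n g)"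
  by (induction n) (auto intro: vge_mult simp: vge_def[of 1])

lemma vge_cong: "N (a - b) \<Longrightarrow> vge a g \<longleftrightarrow> vge b g"
  using V_cong N_diff_iff by (auto simp: vge_def)

lemma vgt_cong: "N (a - b) \<Longrightarrow> vgt a g \<longleftrightarrow> vgt b g"
  using V_cong N_diff_iff by (auto simp: vgt_def)

text \<open>The ultrametric rule that a perturbation of larger value leaves the value alone.
  Congruence modulo larger values replaces equality in the associated graded ring in all that
  follows.\<close>

lemma V_eq_of_vgt_diff:
  assumes "\<not> N a" "vgt (a - b) (V a)"
  shows "\<not> N b" "V b = V a"
proof -
  have b: "vge b (V a)"
    using vge_diff[OF vge_self vgt_imp_vge[OF assms(2)]] by simp
  have "\<not> vgt a (V a)" using assms by (auto simp: vgt_def)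
  then have "\<not> vgt b (V a)" using vgt_add[OF assms(2), of b] by auto
  then show "\<not> N b" "V b = V a" using b by (auto simp: vgt_def vge_def)
qed

end

text \<open>The residue field enters only through a map into a given ring, constrained on elements
  of value at least 0. The target is a domain rather than a field because the Gauss residue map
  \<open>T\<close> below takes values in a polynomial ring.\<close>

locale pvres = pval N V
  for N :: "'a::comm_ring_1 \<Rightarrow> bool" and V :: "'a \<Rightarrow> 'g::linordered_ab_group_add" +
  fixes R :: "'a \<Rightarrow> 'e::idom"
  assumes R_add: "vge a 0 \<Longrightarrow> vge b 0 \<Longrightarrow> R (a + b) = R a + R b"
    and R_mult: "vge a 0 \<Longrightarrow> vge b 0 \<Longrightarrow> R (a * b) = R a * R b"
    and R_1 [simp]: "R 1 = 1"
    and R_eq_0_iff: "vge a 0 \<Longrightarrow> R a = 0 \<longleftrightarrow> vgt a 0"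
begin

lemma R_0 [simp]: "R 0 = 0"
  using R_eq_0_iff[of 0] by simp

lemma R_uminus: "vge a 0 \<Longrightarrow> R (- a) = - R a"
  using R_add[of a "- a"] by (simp add: add_eq_0_iff2)

lemma R_diff: "vge a 0 \<Longrightarrow> vge b 0 \<Longrightarrow> R (a - b) = R a - R b"
  using R_add[of a "- b"] R_uminus[of b] by simp

lemma R_eqI: 
  assumes "vge a 0" "vgt (a - b) 0"
  shows "R a = R b"
proof -
  have "vge b 0" using vge_diff[OF assms(1) vgt_imp_vge[OF assms(2)]] by simp
  then show ?thesis
    using R_diff[of a b] R_eq_0_iff[of "a - b"] assms vgt_imp_vge by auto
qed

lemma R_cong: "vge a 0 \<Longrightarrow> N (a - b) \<Longrightarrow> R a = R b"
  by (rule R_eqI) (auto simp: vgt_def)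

lemma vge_0_mult: "vge a 0 \<Longrightarrow> vge b 0 \<Longrightarrow> vge (a * b) 0"
  using vge_mult[of a 0 b 0] by simp

lemma vge_0_power: "vge a 0 \<Longrightarrow> vge (a ^ n) 0"
  using vge_power[of a 0 n] by simp

lemma R_power: "vge a 0 \<Longrightarrow> R (a ^ n) = R a ^ n"
  by (induction n) (auto simp: R_mult vge_0_power)

lemma R_sum: "(\<And>x. x \<in> A \<Longrightarrow> vge (f x) 0) \<Longrightarrow> R (sum f A) = (\<Sum>x\<in>A. R (f x))"
  by (induction A rule: infinite_finite_induct) (auto simp: R_add vge_sum)

end

section \<open>Stages and their augmentations\<close>

text \<open>
  A valued field \<open>K[x]/(\<phi>)\<close> with its residue map \<open>R\<close> into a given field. The constant \<open>\<beta>\<close> measures how much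
  value a quotient by \<open>\<phi>\<close> can lose; MacLane's condition on \<open>\<gamma>\<close> is \<open>\<beta> < \<gamma>\<close>.
\<close>

locale stage = pvres "\<lambda>F. \<phi> dvd F" V R
  for \<phi> :: "'m::field poly" and V :: "'m poly \<Rightarrow> 'g::linordered_ab_group_add"
    and R :: "'m poly \<Rightarrow> 'e::field" +
  fixes \<beta> :: 'g
  assumes monic: "lead_coeff \<phi> = 1" and deg_pos: "0 < degree \<phi>"
    and V_quot: "degree a < degree \<phi> \<Longrightarrow> degree b < degree \<phi> \<Longrightarrow> a \<noteq> 0 \<Longrightarrow> b \<noteq> 0 \<Longrightarrow>
      a * b div \<phi> \<noteq> 0 \<Longrightarrow> V a + V b \<le> V (a * b div \<phi>) + \<beta>"
begin

lemma phi_nz [simp]: "\<phi> \<noteq> 0"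
  using deg_pos by auto

lemma dvd_small [simp]: "degree a < degree \<phi> \<Longrightarrow> \<phi> dvd a \<longleftrightarrow> a = 0"
  using dvd_imp_degree_le[of \<phi> a] by (cases "a = 0") auto

lemma degree_mod_phi [simp]: "degree (F mod \<phi>) < degree \<phi>"
  using degree_mod_less[of \<phi> F] deg_pos by auto

lemma V_mod [simp]: "V (F mod \<phi>) = V F"
  by (rule V_cong) (simp add: mod_eq_dvd_iff[symmetric])

lemma vge_mod [simp]: "vge (F mod \<phi>) g \<longleftrightarrow> vge F g"
  by (rule vge_cong) (simp add: mod_eq_dvd_iff[symmetric])

lemma vgt_mod [simp]: "vgt (F mod \<phi>) g \<longleftrightarrow> vgt F g"
  by (rule vgt_cong) (simp add: mod_eq_dvd_iff[symmetric])

lemma R_mod: "vge F 0 \<Longrightarrow> R (F mod \<phi>) = R F"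
  by (rule R_cong) (simp_all add: mod_eq_dvd_iff[symmetric])

lemma degree_quot_small:
  assumes "degree a < degree \<phi>" "degree b < degree \<phi>"
  shows "degree (a * b div \<phi>) < degree \<phi>"
proof (cases "a * b div \<phi> = 0")
  case False
  let ?q = "a * b div \<phi>" and ?r = "a * b mod \<phi>"
  have "degree ?q + degree \<phi> = degree (a * b - ?r)"
    using False degree_mult_eq[OF False phi_nz] unfolding minus_mod_eq_div_mult by (rule_tac sym)
  also have "\<dots> \<le> max (degree (a * b)) (degree ?r)" by (rule degree_diff_le_max)
  also have "\<dots> < degree \<phi> + degree \<phi>"
    using assms degree_mult_le[of a b] degree_mod_phi[of "a * b"] by linarith
  finally show ?thesis by simp
qed (use deg_pos in simp)

lemma ex_inverse_mod:
  assumes "\<not> \<phi> dvd a"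
  shows "\<exists>b. degree b < degree \<phi> \<and> a * b mod \<phi> = 1"
proof -
  \<comment> \<open>Bezout through a nonzero element \<open>g\<close> of least degree in the ideal
    generated by \<open>a\<close> and \<phi>. It divides both; since \<phi> is prime and does not
    divide \<open>a\<close>, the cofactor \<open>h\<close> absorbs \<phi>, so \<open>g\<close> is a
    constant.\<close>
  define I where "I = {u * a + v * \<phi> | u v. True}"
  have I_minus: "f - q * g \<in> I" if "f \<in> I" "g \<in> I" for f g q
  proof -
    from that obtain u v u' v' where "f = u * a + v * \<phi>" "g = u' * a + v' * \<phi>"
      unfolding I_def by blast
    then have "f - q * g = (u - q * u') * a + (v - q * v') * \<phi>" by (simp add: algebra_simps)
    then show ?thesis unfolding I_def by blast
  qed
  have aI: "a \<in> I" unfolding I_def by (rule CollectI, rule exI[of _ 1], rule exI[of _ 0]) simp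
  have pI: "\<phi> \<in> I" unfolding I_def by (rule CollectI, rule exI[of _ 0], rule exI[of _ 1]) simp
  obtain g where g: "g \<in> I" "g \<noteq> 0" and min: "\<And>f. f \<in> I \<Longrightarrow> f \<noteq> 0 \<Longrightarrow> degree g \<le> degree f"
    using pI phi_nz ex_has_least_nat[of "\<lambda>f. f \<in> I \<and> f \<noteq> 0" \<phi> degree] by auto
  have dvd: "g dvd f" if "f \<in> I" for f
  proof (rule ccontr)
    assume "\<not> g dvd f"
    moreover have "f mod g \<in> I" using I_minus[OF that g(1), of "f div g"]
      by (simp add: minus_div_mult_eq_mod)
    ultimately show False
      using min[of "f mod g"] degree_mod_less_degree[OF g(2), of f] by (auto simp: dvd_eq_mod_eq_0)
  qed
  from dvd[OF pI] obtain h where h: "\<phi> = g * h" by (auto simp: dvd_def)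
  have "\<not> \<phi> dvd g" using dvd[OF aI] assms by (meson dvd_trans)
  then have "\<phi> dvd h" using N_mult[of g h] h by auto
  moreover have "h \<noteq> 0" using h by auto
  ultimately have "degree \<phi> \<le> degree h" by (simp add: dvd_imp_degree_le)
  then have "degree g = 0" using h g \<open>h \<noteq> 0\<close> by (simp add: degree_mult_eq)
  then obtain c where c: "g = [:c:]" by (rule degree_eq_zeroE)
  with g have c0: "c \<noteq> 0" by auto
  from g obtain u v where uv: "[:c:] = u * a + v * \<phi>" unfolding I_def c by blast
  let ?b = "smult (1 / c) u mod \<phi>"
  have "1 = smult (1/c) (u * a + v * \<phi>)" using c0 uv[symmetric] by (simp add: one_pCons)
  then have "a * smult (1/c) u = 1 - smult (1/c) v * \<phi>"
    by (simp add: smult_add_right mult.commute eq_diff_eq)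
  then have "a * smult (1/c) u mod \<phi> = 1 mod \<phi>"
    unfolding mod_eq_dvd_iff by (simp add: dvd_smult)
  also have "1 mod \<phi> = 1" using deg_pos by (simp add: mod_poly_less)
  finally have "a * ?b mod \<phi> = 1" by (simp only: mod_mult_right_eq)
  then show ?thesis using degree_mod_phi by blast
qed

lemma inverse_small:
  assumes "\<not> \<phi> dvd a"
  obtains b where "degree b < degree \<phi>" "b \<noteq> 0" "\<not> \<phi> dvd b" "\<phi> dvd a * b - 1" "V b = - V a"
proof -
  from ex_inverse_mod[OF assms] obtain b where b: "degree b < degree \<phi>" "a * b mod \<phi> = 1" by blast
  then have b0: "b \<noteq> 0" by auto
  have 1: "\<phi> dvd a * b - 1"
    using b deg_pos by (metis mod_eq_dvd_iff mod_mod_trivial)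
  have nb: "\<not> \<phi> dvd b" using b b0 by simp
  have "V a + V b = 0" using V_mult[OF assms nb] V_cong[OF 1] by simp
  then have "V b = - V a" by (simp add: eq_neg_iff_add_eq_0 add.commute)
  then show ?thesis using that b b0 1 nb by blast
qed

text \<open>The form in which \<open>V_quot\<close> is used: multiplying the quotient part of a
  product by something of value \<open>c\<close> makes it negligible. Later \<open>c\<close> is the
  value \<gamma> of \<phi>, and once the value of a constant \<open>z\<close> that perturbs
  \<phi>.\<close>

lemma small_prod:
  assumes "degree a < degree \<phi>" "degree b < degree \<phi>" "vge a g" "vge b h" "\<beta> < c"
  shows "vgt (a * b div \<phi>) (g + h - c)"
proof (cases "a * b div \<phi> = 0")
  case False
  then have nz: "a \<noteq> 0" "b \<noteq> 0" by auto
  then have "g + h \<le> V a + V b" using assms by (auto simp: vge_def intro: add_mono)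
  also have "\<dots> \<le> V (a * b div \<phi>) + \<beta>" using V_quot assms nz False by blast
  also have "\<dots> < V (a * b div \<phi>) + c" using assms by simp
  finally show ?thesis by (simp add: vgt_def algebra_simps)
qed simp

end

lemma degree_power_monic: "degree (p ^ n) = n * degree (p :: 'a::field poly)"
  by (cases "p = 0") (auto simp: degree_power_eq power_0_left)

section \<open>The augmented valuation, computed from expansions in powers of the key
  polynomial\<close>

locale aug = stage \<phi> V R \<beta>
  for \<phi> :: "'m::field poly" and V :: "'m poly \<Rightarrow> 'g::linordered_ab_group_add"
    and R :: "'m poly \<Rightarrow> 'e::field" and \<beta> +
  fixes \<gamma> :: 'g
  assumes beta_less: "\<beta> < \<gamma>"
begin

text \<open>The digit at \<open>\<phi> ^ k\<close> of the \<phi>-adic expansion. Written with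
  \<open>div\<close> and \<open>mod\<close> it is visibly additive and defined for all
  \<open>k\<close>.\<close>

definition cf :: "'m poly \<Rightarrow> nat \<Rightarrow> 'm poly" where
  "cf F k = (F div \<phi> ^ k) mod \<phi>"

lemma degree_cf [simp]: "degree (cf F k) < degree \<phi>"
  by (simp add: cf_def)

lemma cf_dvd [simp]: "\<phi> dvd cf F k \<longleftrightarrow> cf F k = 0"
  by simp

lemma cf_0 [simp]: "cf 0 k = 0"
  by (simp add: cf_def)

lemma cf_add: "cf (F + G) k = cf F k + cf G k"
  by (simp add: cf_def poly_div_add_left poly_mod_add_left)

lemma cf_diff: "cf (F - G) k = cf F k - cf G k"
  by (simp add: cf_def poly_div_diff_left poly_mod_diff_left)

lemma cf_sum: "cf (sum f A) k = (\<Sum>x\<in>A. cf (f x) k)"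
  by (induction A rule: infinite_finite_induct) (auto simp: cf_add)

lemma cf_monom:
  assumes "degree a < degree \<phi>"
  shows "cf (a * \<phi> ^ l) k = (if k = l then a else 0)"
proof (cases "k \<le> l")
  case True
  then have "\<phi> ^ l = \<phi> ^ (l - k) * \<phi> ^ k" by (simp flip: power_add)
  then have "a * \<phi> ^ l div \<phi> ^ k = a * \<phi> ^ (l - k)"
    by (simp flip: mult.assoc)
  moreover have "a * \<phi> ^ (l - k) mod \<phi> = (if k = l then a else 0)"
    using True assms by (cases "l - k") (auto simp: mod_poly_less)
  ultimately show ?thesis by (simp add: cf_def)
next
  case False
  have "a * \<phi> ^ l div \<phi> ^ k = 0"
  proof (cases "a = 0")
    case False
    have "degree (a * \<phi> ^ l) = degree a + l * degree \<phi>"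
      using False by (simp add: degree_mult_eq degree_power_monic)
    also have "\<dots> < Suc l * degree \<phi>" using assms by simp
    also have "\<dots> \<le> k * degree \<phi>" using \<open>\<not> k \<le> l\<close> by (intro mult_le_mono1) simp
    finally show ?thesis by (intro div_poly_less) (simp add: degree_power_monic)
  qed simp
  then show ?thesis using False by (simp add: cf_def)
qed

lemma cf_small: "degree a < degree \<phi> \<Longrightarrow> cf a k = (if k = 0 then a else 0)"
  using cf_monom[of a 0 k] by simp

lemma expand_aux: "F = (\<Sum>k<n. cf F k * \<phi> ^ k) + (F div \<phi> ^ n) * \<phi> ^ n"
proof (induction n)
  case (Suc n)
  have "F div \<phi> ^ n = (F div \<phi> ^ Suc n) * \<phi> + cf F n"
    unfolding cf_def power_Suc2 poly_div_mult_right by (rule div_mult_mod_eq[symmetric])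
  then have "(F div \<phi> ^ n) * \<phi> ^ n = cf F n * \<phi> ^ n + (F div \<phi> ^ Suc n) * \<phi> ^ Suc n"
    by (simp only: distrib_right mult.assoc power_Suc add.commute)
  then have "(\<Sum>k<n. cf F k * \<phi> ^ k) + (F div \<phi> ^ n) * \<phi> ^ n
      = (\<Sum>k<Suc n. cf F k * \<phi> ^ k) + (F div \<phi> ^ Suc n) * \<phi> ^ Suc n"
    by (simp only: sum.lessThan_Suc add.assoc)
  with Suc show ?case by (rule trans)
qed simp

lemma expand_less:
  assumes "degree F < n * degree \<phi>"
  shows "F = (\<Sum>k<n. cf F k * \<phi> ^ k)"
proof -
  have "F div \<phi> ^ n = 0" using assms by (intro div_poly_less) (simp add: degree_power_monic)
  then have "(\<Sum>k<n. cf F k * \<phi> ^ k) + (F div \<phi> ^ n) * \<phi> ^ n = (\<Sum>k<n. cf F k * \<phi> ^ k)"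
    by simp
  with expand_aux show ?thesis by (rule trans)
qed

lemma cf_eq_0:
  assumes "degree F < k * degree \<phi>"
  shows "cf F k = 0"
proof -
  have "F div \<phi> ^ k = 0" using assms by (intro div_poly_less) (simp add: degree_power_monic)
  then show ?thesis by (simp add: cf_def)
qed

lemma degree_bound: "degree F < Suc (degree F) * degree \<phi>"
  using deg_pos by (cases "degree \<phi>") auto

lemma expand: "F = (\<Sum>k\<le>degree F. cf F k * \<phi> ^ k)"
  using expand_less[OF degree_bound, of F] unfolding lessThan_Suc_atMost .

lemma cf_nz_le: "cf F k \<noteq> 0 \<Longrightarrow> k \<le> degree F"
proof (rule ccontr)
  assume nz: "cf F k \<noteq> 0" and "\<not> k \<le> degree F"
  then have "Suc (degree F) * degree \<phi> \<le> k * degree \<phi>" by (intro mult_le_mono1) simp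
  then have "degree F < k * degree \<phi>" using degree_bound[of F] by linarith
  then show False using nz cf_eq_0 by blast
qed

lemma finite_cf: "finite {k. cf F k \<noteq> 0}"
  by (rule finite_subset[of _ "{..degree F}"]) (auto dest: cf_nz_le)

lemma ex_cf_nz: "F \<noteq> 0 \<Longrightarrow> \<exists>k. cf F k \<noteq> 0"
proof (rule ccontr)
  assume F: "F \<noteq> 0" and "\<nexists>k. cf F k \<noteq> 0"
  then have "(\<Sum>k\<le>degree F. cf F k * \<phi> ^ k) = 0" by simp
  with expand have "F = 0" by (rule trans)
  with F show False by simp
qed

text \<open>Inequalities for \<open>W\<close>, stated digit by digit: this covers
  \<open>F = 0\<close>, where the minimum in \<open>W\<close> is over the empty set, and reduces
  estimates to those for \<open>V\<close>.\<close>

definition wge :: "'m poly \<Rightarrow> 'g \<Rightarrow> bool" where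
  "wge F g \<longleftrightarrow> (\<forall>k. vge (cf F k) (g - nmul k \<gamma>))"

definition wgt :: "'m poly \<Rightarrow> 'g \<Rightarrow> bool" where
  "wgt F g \<longleftrightarrow> (\<forall>k. vgt (cf F k) (g - nmul k \<gamma>))"

definition W :: "'m poly \<Rightarrow> 'g" where
  "W F = Min ((\<lambda>k. V (cf F k) + nmul k \<gamma>) ` {k. cf F k \<noteq> 0})"

text \<open>For \<open>g = W F\<close> these are the exponents at which the minimum is attained,
  that is, the points of the Newton polygon of \<open>F\<close> on its supporting line for \<gamma>.
  Another \<open>g\<close> is allowed so that products can be compared with \<open>W F + W G\<close>
  before multiplicativity is known.\<close>

definition crit :: "'m poly \<Rightarrow> 'g \<Rightarrow> nat set" where
  "crit F g = {k. cf F k \<noteq> 0 \<and> V (cf F k) + nmul k \<gamma> = g}"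

lemma wge_iff: "F \<noteq> 0 \<Longrightarrow> wge F g \<longleftrightarrow> g \<le> W F"
  unfolding W_def wge_def using finite_cf ex_cf_nz
  by (subst Min_ge_iff) (auto simp: vge_def diff_le_eq)

lemma wgt_iff: "F \<noteq> 0 \<Longrightarrow> wgt F g \<longleftrightarrow> g < W F"
  unfolding W_def wgt_def using finite_cf ex_cf_nz
  by (subst Min_gr_iff) (auto simp: vgt_def diff_less_eq)

lemma wge_0 [simp]: "wge 0 g" "wgt 0 g"
  by (simp_all add: wge_def wgt_def)

lemma wge_add: "wge F g \<Longrightarrow> wge G g \<Longrightarrow> wge (F + G) g"
  by (simp add: wge_def cf_add vge_add)

lemma wgt_add: "wgt F g \<Longrightarrow> wgt G g \<Longrightarrow> wgt (F + G) g"
  by (simp add: wgt_def cf_add vgt_add)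

lemma wgt_sum: "(\<And>x. x \<in> A \<Longrightarrow> wgt (f x) g) \<Longrightarrow> wgt (sum f A) g"
  by (induction A rule: infinite_finite_induct) (auto intro: wgt_add)

lemma wge_monom: "degree a < degree \<phi> \<Longrightarrow> vge a (g - nmul k \<gamma>) \<Longrightarrow> wge (a * \<phi> ^ k) g"
  by (simp add: wge_def cf_monom)

lemma wgt_monom: "degree a < degree \<phi> \<Longrightarrow> vgt a (g - nmul k \<gamma>) \<Longrightarrow> wgt (a * \<phi> ^ k) g"
  by (simp add: wgt_def cf_monom)

text \<open>The difference is the quotient of \<open>a * b\<close> by \<phi> times one more power of
  \<phi>, and \<open>\<beta> < \<gamma>\<close> makes this extra factor outweigh the loss of value
  in the quotient.\<close>

lemma wgt_quot:
  assumes "degree a < degree \<phi>" "degree b < degree \<phi>"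
    "vge a (g - nmul i \<gamma>)" "vge b (h - nmul j \<gamma>)"
  shows "wgt (a * b * \<phi> ^ (i + j) - (a * b mod \<phi>) * \<phi> ^ (i + j)) (g + h)"
proof -
  have "a * b * \<phi> ^ (i + j) - (a * b mod \<phi>) * \<phi> ^ (i + j) = (a * b - a * b mod \<phi>) * \<phi> ^ (i + j)"
    by (simp add: algebra_simps)
  also have "a * b - a * b mod \<phi> = (a * b div \<phi>) * \<phi>"
    by (simp add: minus_mod_eq_div_mult)
  finally have "a * b * \<phi> ^ (i + j) - (a * b mod \<phi>) * \<phi> ^ (i + j) = (a * b div \<phi>) * \<phi> ^ Suc (i + j)"
    by (simp add: mult.assoc)
  moreover have "wgt ((a * b div \<phi>) * \<phi> ^ Suc (i + j)) (g + h)"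
  proof (rule wgt_monom)
    have "g - nmul i \<gamma> + (h - nmul j \<gamma>) - \<gamma> = g + h - nmul (Suc (i + j)) \<gamma>"
      by (simp add: nmul_add algebra_simps)
    then show "vgt (a * b div \<phi>) (g + h - nmul (Suc (i + j)) \<gamma>)"
      using small_prod[OF assms beta_less] by (simp only:)
  qed (use assms in \<open>simp add: degree_quot_small\<close>)
  ultimately show ?thesis by simp
qed

text \<open>The product of \<open>F\<close> and \<open>G\<close> read as polynomials in an
  indeterminate \<phi> over the field of residue classes modulo \<phi>. Up to larger values it is
  the true product, which reduces \<open>W\<close> to a Gauss valuation.\<close>

definition tr :: "'m poly \<Rightarrow> 'm poly \<Rightarrow> 'm poly" where
  "tr F G = (\<Sum>i\<le>degree F. \<Sum>j\<le>degree G. (cf F i * cf G j mod \<phi>) * \<phi> ^ (i + j))"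

lemma wgt_tr:
  assumes "wge F g" "wge G h"
  shows "wgt (F * G - tr F G) (g + h)"
proof -
  have "F * G = (\<Sum>i\<le>degree F. cf F i * \<phi> ^ i) * (\<Sum>j\<le>degree G. cf G j * \<phi> ^ j)"
    by (rule arg_cong2[OF expand expand])
  also have "\<dots> = (\<Sum>i\<le>degree F. \<Sum>j\<le>degree G. cf F i * cf G j * \<phi> ^ (i + j))"
    by (simp add: sum_product power_add ac_simps)
  finally have "F * G - tr F G = (\<Sum>i\<le>degree F. \<Sum>j\<le>degree G.
      cf F i * cf G j * \<phi> ^ (i + j) - (cf F i * cf G j mod \<phi>) * \<phi> ^ (i + j))"
    by (simp add: tr_def sum_subtractf)
  moreover have "wgt \<dots> (g + h)"
    using assms by (intro wgt_sum wgt_quot) (auto simp: wge_def)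
  ultimately show ?thesis by simp
qed

lemma cf_tr: "cf (tr F G) k =
  (\<Sum>i\<le>degree F. \<Sum>j\<le>degree G. if i + j = k then cf F i * cf G j mod \<phi> else 0)"
  unfolding tr_def cf_sum by (intro sum.cong refl) (auto simp: cf_monom)

end

context aug
begin

lemma not_crit: "wge F g \<Longrightarrow> k \<notin> crit F g \<Longrightarrow> vgt (cf F k) (g - nmul k \<gamma>)"
  by (auto simp: wge_def crit_def vge_def vgt_def diff_less_eq diff_le_eq dest!: spec[of _ k])

text \<open>The initial form of a product depends only on those of the factors: a term with a
  non-critical exponent on either side has strictly larger value.\<close>

lemma cf_mult_crit:
  assumes "wge F g" "wge G h"
  shows "vgt (cf (F * G) k - (\<Sum>i\<le>degree F. \<Sum>j\<le>degree G.
    if i + j = k \<and> i \<in> crit F g \<and> j \<in> crit G h then cf F i * cf G j mod \<phi> else 0))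
    (g + h - nmul k \<gamma>)" (is "vgt (_ - ?S) _")
proof -
  have 1: "vgt (cf (F * G) k - cf (tr F G) k) (g + h - nmul k \<gamma>)"
    using wgt_tr[OF assms] by (simp add: wgt_def cf_diff)
  have "cf (tr F G) k - ?S = (\<Sum>i\<le>degree F. \<Sum>j\<le>degree G.
      if i + j = k \<and> \<not> (i \<in> crit F g \<and> j \<in> crit G h) then cf F i * cf G j mod \<phi> else 0)"
    unfolding cf_tr sum_subtractf[symmetric] by (intro sum.cong refl) auto
  moreover have "vgt \<dots> (g + h - nmul k \<gamma>)"
  proof (intro vgt_sum, goal_cases)
    case (1 i j)
    show ?case
    proof (cases "i + j = k \<and> \<not> (i \<in> crit F g \<and> j \<in> crit G h)")
      case True
      have e: "g + h - nmul k \<gamma> = (g - nmul i \<gamma>) + (h - nmul j \<gamma>)"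
        using True by (auto simp: nmul_add algebra_simps)
      have ge: "vge (cf F i) (g - nmul i \<gamma>)" "vge (cf G j) (h - nmul j \<gamma>)"
        using assms by (auto simp: wge_def)
      have "vgt (cf F i * cf G j) (g + h - nmul k \<gamma>)"
      proof (cases "i \<in> crit F g")
        case True
        with \<open>i + j = k \<and> _\<close> have "j \<notin> crit G h" by blast
        then show ?thesis unfolding e using ge not_crit[OF assms(2)] by (intro vgt_mult)
      next
        case False
        then show ?thesis unfolding e using ge not_crit[OF assms(1)] by (intro vgt_mult2)
      qed
      then show ?thesis using True by simp
    qed auto
  qed
  ultimately have 2: "vgt (cf (tr F G) k - ?S) (g + h - nmul k \<gamma>)" by simp
  show ?thesis using vgt_add[OF 1 2] by simp
qed

text \<open>As in Gauss's lemma, a sum of critical exponents that arises in one way only is the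
  exponent of a term that nothing can cancel.\<close>

lemma crit_mult_unique:
  assumes "wge F g" "wge G h" "i0 \<in> crit F g" "j0 \<in> crit G h"
    and "\<And>i j. i \<in> crit F g \<Longrightarrow> j \<in> crit G h \<Longrightarrow> i + j = i0 + j0 \<Longrightarrow> i = i0"
  shows "vgt (cf (F * G) (i0 + j0) - cf F i0 * cf G j0) (g + h - nmul (i0 + j0) \<gamma>)"
    and "i0 + j0 \<in> crit (F * G) (g + h)"
proof -
  let ?a = "cf F i0" and ?b = "cf G j0"
  have le: "i0 \<le> degree F" "j0 \<le> degree G" using assms cf_nz_le by (auto simp: crit_def)
  have "(\<Sum>i\<le>degree F. \<Sum>j\<le>degree G.
    if i + j = i0 + j0 \<and> i \<in> crit F g \<and> j \<in> crit G h then cf F i * cf G j mod \<phi> else 0)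
    = (\<Sum>i\<le>degree F. \<Sum>j\<le>degree G. if i = i0 then if j = j0 then ?a * ?b mod \<phi> else 0 else 0)"
  proof (intro sum.cong refl, goal_cases)
    case (1 i j)
    show ?case using assms(3,4) assms(5)[of i j] by auto
  qed
  also have "\<dots> = (\<Sum>i\<le>degree F. if i = i0 then \<Sum>j\<le>degree G. if j = j0 then ?a * ?b mod \<phi> else 0 else 0)"
    by (intro sum.cong refl) auto
  also have "\<dots> = ?a * ?b mod \<phi>" using le by simp
  finally have 1: "vgt (cf (F * G) (i0 + j0) - ?a * ?b mod \<phi>) (g + h - nmul (i0 + j0) \<gamma>)"
    using cf_mult_crit[OF assms(1,2), of "i0 + j0"] by simp
  have nz: "\<not> \<phi> dvd ?a * ?b" using assms(3,4) by (simp add: N_mult crit_def)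
  have Vab: "V (?a * ?b) = g + h - nmul (i0 + j0) \<gamma>"
    using assms(3,4) by (auto simp: crit_def V_mult nmul_add algebra_simps)
  have "\<phi> dvd (cf (F * G) (i0 + j0) - ?a * ?b mod \<phi>) - (cf (F * G) (i0 + j0) - ?a * ?b)"
    by (simp add: mod_eq_dvd_iff[symmetric] algebra_simps minus_mod_eq_mult_div)
  then show 2: "vgt (cf (F * G) (i0 + j0) - ?a * ?b) (g + h - nmul (i0 + j0) \<gamma>)"
    using 1 vgt_cong by blast
  then have "vgt (?a * ?b - cf (F * G) (i0 + j0)) (V (?a * ?b))"
    using Vab vgt_uminus[of "?a * ?b - cf (F * G) (i0 + j0)"] by simp
  from V_eq_of_vgt_diff[OF nz this] show "i0 + j0 \<in> crit (F * G) (g + h)"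
    using Vab by (auto simp: crit_def)
qed

lemma crit_mult_none:
  assumes "wge F g" "wge G h" "\<And>i j. i \<in> crit F g \<Longrightarrow> j \<in> crit G h \<Longrightarrow> i + j \<noteq> k"
  shows "k \<notin> crit (F * G) (g + h)"
proof -
  have "(\<Sum>i\<le>degree F. \<Sum>j\<le>degree G.
    if i + j = k \<and> i \<in> crit F g \<and> j \<in> crit G h then cf F i * cf G j mod \<phi> else 0) = 0"
    using assms(3) by (intro sum.neutral ballI) auto
  then have "vgt (cf (F * G) k) (g + h - nmul k \<gamma>)"
    using cf_mult_crit[OF assms(1,2), of k] by simp
  then show ?thesis by (auto simp: crit_def vgt_def diff_less_eq)
qed

lemma finite_crit: "finite (crit F g)"
  by (rule finite_subset[OF _ finite_cf[of F]]) (auto simp: crit_def)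

lemma crit_nonempty: "F \<noteq> 0 \<Longrightarrow> crit F (W F) \<noteq> {}"
proof -
  assume "F \<noteq> 0"
  then have "W F \<in> (\<lambda>k. V (cf F k) + nmul k \<gamma>) ` {k. cf F k \<noteq> 0}"
    unfolding W_def using finite_cf ex_cf_nz by (intro Min_in) auto
  then show ?thesis by (auto simp: crit_def)
qed

lemma wge_W: "wge F (W F)"
  by (cases "F = 0") (auto simp: wge_iff)

lemma crit_imp_W: "wge F g \<Longrightarrow> k \<in> crit F g \<Longrightarrow> F \<noteq> 0 \<and> W F = g"
proof -
  assume F: "wge F g" and k: "k \<in> crit F g"
  then have nz: "F \<noteq> 0" by (auto simp: crit_def)
  have "\<not> wgt F g" using k by (auto simp: wgt_def crit_def vgt_def dest!: spec[of _ k])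
  then show ?thesis using F nz by (auto simp: wge_iff wgt_iff)
qed

lemma wge_mult:
  assumes "wge F g" "wge G h"
  shows "wge (F * G) (g + h)"
  unfolding wge_def
proof
  fix k
  have "vge (cf (F * G) k - cf (tr F G) k) (g + h - nmul k \<gamma>)"
    using wgt_tr[OF assms] vgt_imp_vge by (simp add: wgt_def cf_diff)
  moreover have "vge (cf (tr F G) k) (g + h - nmul k \<gamma>)"
    unfolding cf_tr
  proof (intro vge_sum, goal_cases)
    case (1 i j)
    show ?case
    proof (cases "i + j = k")
      case True
      have "g + h - nmul k \<gamma> = (g - nmul i \<gamma>) + (h - nmul j \<gamma>)"
        using True by (auto simp: nmul_add algebra_simps)
      then have "vge (cf F i * cf G j) (g + h - nmul k \<gamma>)"
        using assms vge_mult unfolding wge_def by metis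
      then show ?thesis using True by simp
    qed auto
  qed
  ultimately show "vge (cf (F * G) k) (g + h - nmul k \<gamma>)" using vge_add by fastforce
qed

text \<open>The two least and the two greatest critical exponents have sums that arise in one way
  only. Both ends are followed because the width of \<open>crit\<close>, which is additive by this
  lemma, later shows that a polynomial is key.\<close>

lemma crit_W_mult:
  assumes "F \<noteq> 0" "G \<noteq> 0"
  shows "Min (crit (F * G) (W F + W G)) = Min (crit F (W F)) + Min (crit G (W G))"
    and "Max (crit (F * G) (W F + W G)) = Max (crit F (W F)) + Max (crit G (W G))"
    and "W (F * G) = W F + W G"
proof -
  let ?C = "crit F (W F)" and ?D = "crit G (W G)"
  note ne = crit_nonempty[OF assms(1)] crit_nonempty[OF assms(2)]
  note f = finite_crit[of F "W F"] finite_crit[of G "W G"]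
  note in' = Min_in[OF f(1) ne(1)] Min_in[OF f(2) ne(2)] Max_in[OF f(1) ne(1)] Max_in[OF f(2) ne(2)]
  have 1: "Min ?C + Min ?D \<in> crit (F * G) (W F + W G)"
  proof (rule crit_mult_unique(2)[OF wge_W wge_W in'(1,2)])
    fix i j assume "i \<in> ?C" "j \<in> ?D" "i + j = Min ?C + Min ?D"
    then show "i = Min ?C" using Min_le[OF f(1), of i] Min_le[OF f(2), of j] by linarith
  qed
  have 2: "Max ?C + Max ?D \<in> crit (F * G) (W F + W G)"
  proof (rule crit_mult_unique(2)[OF wge_W wge_W in'(3,4)])
    fix i j assume "i \<in> ?C" "j \<in> ?D" "i + j = Max ?C + Max ?D"
    then show "i = Max ?C" using Max_ge[OF f(1), of i] Max_ge[OF f(2), of j] by linarith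
  qed
  show "W (F * G) = W F + W G" using crit_imp_W[OF wge_mult[OF wge_W wge_W] 1] by simp
  have 3: "Min ?C + Min ?D \<le> k \<and> k \<le> Max ?C + Max ?D" if "k \<in> crit (F * G) (W F + W G)" for k
  proof -
    obtain i j where "i \<in> ?C" "j \<in> ?D" "i + j = k"
      using crit_mult_none[OF wge_W wge_W, of F G k] \<open>k \<in> _\<close> by blast
    then show ?thesis using Min_le[OF f(1)] Min_le[OF f(2)] Max_ge[OF f(1)] Max_ge[OF f(2)]
      by (auto intro!: add_mono)
  qed
  show "Min (crit (F * G) (W F + W G)) = Min ?C + Min ?D"
    using 1 3 finite_crit by (intro Min_eqI) auto
  show "Max (crit (F * G) (W F + W G)) = Max ?C + Max ?D"
    using 2 3 finite_crit by (intro Max_eqI) auto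
qed

sublocale W: pval "\<lambda>F. F = 0" W
proof
  fix a b :: "'m poly"
  assume "a \<noteq> 0" "b \<noteq> 0" "a + b \<noteq> 0"
  then show "min (W a) (W b) \<le> W (a + b)"
    using wge_add[of a "min (W a) (W b)" b] by (simp add: wge_iff)
qed (auto simp: crit_W_mult)

lemma W_vge: "W.vge F g \<longleftrightarrow> wge F g"
  by (cases "F = 0") (auto simp: W.vge_def wge_iff)

lemma W_vgt: "W.vgt F g \<longleftrightarrow> wgt F g"
  by (cases "F = 0") (auto simp: W.vgt_def wgt_iff)

lemma W_monom:
  assumes "degree a < degree \<phi>" "a \<noteq> 0"
  shows "W (a * \<phi> ^ k) = V a + nmul k \<gamma>"
proof -
  have "wge (a * \<phi> ^ k) (V a + nmul k \<gamma>)"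
    using assms by (intro wge_monom) (auto simp: vge_def)
  moreover have "k \<in> crit (a * \<phi> ^ k) (V a + nmul k \<gamma>)"
    using assms by (simp add: crit_def cf_monom)
  ultimately show ?thesis using crit_imp_W by blast
qed

lemma W_small: "degree a < degree \<phi> \<Longrightarrow> a \<noteq> 0 \<Longrightarrow> W a = V a"
  using W_monom[of a 0] by simp

lemma wge_small: "degree a < degree \<phi> \<Longrightarrow> wge a g \<longleftrightarrow> vge a g"
  by (cases "a = 0") (auto simp: wge_iff W_small vge_def)

section \<open>Key polynomials\<close>

text \<open>
  MacLane's notion of a key polynomial: the initial form of \<open>\<phi>'\<close> does not divide
  a product of two initial forms of polynomials of smaller degree.
\<close>

definition key :: "'m poly \<Rightarrow> bool" where
  "key \<phi>' \<longleftrightarrow> lead_coeff \<phi>' = 1 \<and> 0 < degree \<phi>' \<and>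
     (\<forall>a b q. a \<noteq> 0 \<longrightarrow> b \<noteq> 0 \<longrightarrow> degree a < degree \<phi>' \<longrightarrow> degree b < degree \<phi>' \<longrightarrow>
        \<not> wgt (a * b - q * \<phi>') (W a + W b))"

text \<open>If the remainder had value below \<open>g\<close>, then adding the multiple
  \<open>?q * \<phi>'\<close> to it would give \<open>F\<close>, of larger value; so the remainder
  would be a multiple of \<open>\<phi>'\<close> modulo larger values, against \<open>key\<close> for
  the remainder and 1.\<close>

lemma key_mod:
  assumes "key \<phi>'" "wge F g"
  shows "wge (F mod \<phi>') g" "wge (F div \<phi>' * \<phi>') g"
proof -
  let ?r = "F mod \<phi>'" and ?q = "F div \<phi>'"
  have deg: "0 < degree \<phi>'" using assms by (simp add: key_def)
  then have "degree ?r < degree \<phi>'" using degree_mod_less[of \<phi>' F] by (cases "\<phi>' = 0") auto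
  moreover have "W.vgt (?r * 1 - (- ?q) * \<phi>') (W ?r)" if "\<not> wge ?r g"
  proof -
    have "W ?r < g" using that by (cases "?r = 0") (auto simp: wge_iff)
    then have "W.vgt F (W ?r)" using assms(2) W.vge_imp_vgt by (simp add: W_vge)
    then show ?thesis by (simp add: ac_simps)
  qed
  moreover have "\<not> wgt (?r * 1 - (- ?q) * \<phi>') (W ?r + W 1)" if "?r \<noteq> 0" "degree ?r < degree \<phi>'"
    using assms(1) that deg unfolding key_def by (metis degree_1 one_neq_zero)
  ultimately show *: "wge ?r g"
    unfolding W_vgt by (cases "?r = 0") auto
  have "?q * \<phi>' = F - ?r" by (simp add: minus_mod_eq_div_mult)
  then show "wge (?q * \<phi>') g" using W.vge_diff[of F g ?r] assms(2) * by (simp add: W_vge)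
qed

lemma key_mod_gt:
  assumes "key \<phi>'" "wgt F g"
  shows "wgt (F mod \<phi>') g"
proof (cases "F = 0")
  case False
  then have "g < W F" using assms by (simp add: wgt_iff)
  then show ?thesis using W.vge_imp_vgt key_mod(1)[OF assms(1) wge_W, of F]
    unfolding W_vge W_vgt by blast
qed simp

lemma key_mult:
  assumes "key \<phi>'" "a \<noteq> 0" "b \<noteq> 0" "degree a < degree \<phi>'" "degree b < degree \<phi>'"
  shows "a * b mod \<phi>' \<noteq> 0" "W (a * b mod \<phi>') = W a + W b"
proof -
  have "\<not> wgt (a * b - (a * b div \<phi>') * \<phi>') (W a + W b)"
    using assms unfolding key_def by blast
  then have *: "\<not> wgt (a * b mod \<phi>') (W a + W b)" by (simp add: minus_div_mult_eq_mod)
  then show nz: "a * b mod \<phi>' \<noteq> 0" by auto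
  have "wge (a * b mod \<phi>') (W a + W b)"
    using key_mod(1)[OF assms(1) wge_mult[OF wge_W wge_W]] .
  then show "W (a * b mod \<phi>') = W a + W b" using * nz by (simp add: wge_iff wgt_iff)
qed

lemma key_prime:
  assumes "key \<phi>'"
  shows "\<phi>' dvd F * G \<longleftrightarrow> \<phi>' dvd F \<or> \<phi>' dvd G"
proof
  have deg: "0 < degree \<phi>'" using assms by (simp add: key_def)
  then have d: "degree (F mod \<phi>') < degree \<phi>'" for F
    using degree_mod_less[of \<phi>' F] by (cases "\<phi>' = 0") auto
  assume "\<phi>' dvd F * G"
  then have "(F mod \<phi>') * (G mod \<phi>') mod \<phi>' = 0" by (simp add: mod_mult_eq)
  then show "\<phi>' dvd F \<or> \<phi>' dvd G" using key_mult(1)[OF assms _ _ d d] by (auto simp: mod_eq_0_iff_dvd)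
qed auto

text \<open>By \<open>key_mult\<close> the function \<open>W\<close> is multiplicative on
  remainders, hence a valuation of the new quotient. By \<open>key_mod\<close> the multiple of
  \<open>\<phi>'\<close> split off from \<open>a * b\<close> has value at least
  \<open>W a + W b\<close>, so \<open>W \<phi>'\<close> bounds the loss in a quotient and serves as
  the new \<beta>.\<close>

lemma key_stage:
  fixes R' :: "'m poly \<Rightarrow> 'e"
  assumes key: "key \<phi>'"
    and R'_1: "R' 1 = 1"
    and R'_add: "\<And>a b. degree a < degree \<phi>' \<Longrightarrow> degree b < degree \<phi>' \<Longrightarrow> wge a 0 \<Longrightarrow> wge b 0 \<Longrightarrow>
      R' (a + b) = R' a + R' b"
    and R'_mult: "\<And>a b. degree a < degree \<phi>' \<Longrightarrow> degree b < degree \<phi>' \<Longrightarrow> wge a 0 \<Longrightarrow> wge b 0 \<Longrightarrow>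
      R' (a * b mod \<phi>') = R' a * R' b"
    and R'_0: "\<And>a. degree a < degree \<phi>' \<Longrightarrow> wge a 0 \<Longrightarrow> R' a = 0 \<longleftrightarrow> wgt a 0"
  shows "stage \<phi>' (\<lambda>F. W (F mod \<phi>')) (\<lambda>F. R' (F mod \<phi>')) (W \<phi>')"
proof -
  let ?V = "\<lambda>F. W (F mod \<phi>')"
  have deg: "0 < degree \<phi>'" and nz [simp]: "\<phi>' \<noteq> 0" using key by (auto simp: key_def)
  then have d [simp]: "degree (F mod \<phi>') < degree \<phi>'" for F
    using degree_mod_less[of \<phi>' F] by auto
  have one [simp]: "1 mod \<phi>' = 1" using deg by (simp add: mod_poly_less)
  interpret V': pval "\<lambda>F. \<phi>' dvd F" ?V
  proof
    show "\<not> \<phi>' dvd 1" using deg by (metis degree_1 dvd_imp_degree_le leD one_neq_zero)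
    show "\<phi>' dvd a * b \<longleftrightarrow> \<phi>' dvd a \<or> \<phi>' dvd b" for a b by (rule key_prime[OF key])
    show "?V a = ?V b" if "\<phi>' dvd a - b" for a b
      using that by (simp add: mod_eq_dvd_iff[symmetric])
    show "?V (a * b) = ?V a + ?V b" if "\<not> \<phi>' dvd a" "\<not> \<phi>' dvd b" for a b
      using key_mult(2)[OF key, of "a mod \<phi>'" "b mod \<phi>'"] that
      by (simp add: mod_mult_eq mod_eq_0_iff_dvd)
    show "min (?V a) (?V b) \<le> ?V (a + b)"
      if "\<not> \<phi>' dvd a" "\<not> \<phi>' dvd b" "\<not> \<phi>' dvd (a + b)" for a b
    proof -
      have "(a + b) mod \<phi>' \<noteq> 0" using that by (simp only: mod_eq_0_iff_dvd not_False_eq_True)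
      then show ?thesis
        using that W.V_add[of "a mod \<phi>'" "b mod \<phi>'"] by (simp add: poly_mod_add_left mod_eq_0_iff_dvd)
    qed
  qed auto
  have vge: "V'.vge F 0 \<longleftrightarrow> wge (F mod \<phi>') 0" for F
    by (cases "F mod \<phi>' = 0") (auto simp: V'.vge_def wge_iff mod_eq_0_iff_dvd)
  have vgt: "V'.vgt F 0 \<longleftrightarrow> wgt (F mod \<phi>') 0" for F
    by (cases "F mod \<phi>' = 0") (auto simp: V'.vgt_def wgt_iff mod_eq_0_iff_dvd)
  show ?thesis
  proof
    fix a b :: "'m poly"
    assume ab: "degree a < degree \<phi>'" "degree b < degree \<phi>'" "a \<noteq> 0" "b \<noteq> 0"
    assume q: "a * b div \<phi>' \<noteq> 0"
    have "degree (a * b div \<phi>') + degree \<phi>' = degree (a * b - a * b mod \<phi>')"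
      using q by (simp add: minus_mod_eq_div_mult degree_mult_eq)
    also have "\<dots> \<le> max (degree (a * b)) (degree (a * b mod \<phi>'))" by (rule degree_diff_le_max)
    also have "\<dots> < degree \<phi>' + degree \<phi>'"
      using ab degree_mult_le[of a b] d[of "a * b"] by linarith
    finally have "degree (a * b div \<phi>') < degree \<phi>'" by simp
    then have m: "(a * b div \<phi>') mod \<phi>' = a * b div \<phi>'" by (rule mod_poly_less)
    have "wge (a * b div \<phi>' * \<phi>') (W a + W b)"
      using key_mod(2)[OF key wge_mult[OF wge_W wge_W]] .
    then have "W a + W b \<le> W (a * b div \<phi>') + W \<phi>'"
      using q by (simp add: wge_iff W.V_mult)
    then show "?V a + ?V b \<le> ?V (a * b div \<phi>') + W \<phi>'"
      using ab m by (simp add: mod_poly_less)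
  qed (use key deg in \<open>auto simp: key_def vge vgt R'_1 poly_mod_add_left R'_add
      R'_mult[symmetric] mod_mult_eq R'_0\<close>)
qed

end

context aug
begin

lemma cf_eq_0_le: "degree F < e * degree \<phi> \<Longrightarrow> e \<le> k \<Longrightarrow> cf F k = 0"
  using cf_eq_0[of F k] mult_le_mono1[of e k "degree \<phi>"] by linarith

lemma less_mult_degree: "0 < e \<Longrightarrow> n < degree \<phi> \<Longrightarrow> n < e * degree \<phi>"
  by (cases e) auto

lemma crit_cong:
  assumes "wgt (F - G) g"
  shows "crit F g = crit G g"
proof -
  have *: "k \<in> crit G g" if "wgt (F - G) g" "k \<in> crit F g" for F G k
  proof -
    have "vgt (cf F k - cf G k) (V (cf F k))" "\<not> \<phi> dvd cf F k"
      using that by (auto simp: wgt_def crit_def cf_diff dest: spec[of _ k])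
    from V_eq_of_vgt_diff[OF this(2,1)] show ?thesis using that by (auto simp: crit_def)
  qed
  have "wgt (G - F) g" using assms W.vgt_uminus[of "F - G"] by (simp add: W_vgt)
  with assms * show ?thesis by blast
qed

lemma wge_cf_0: "wge F 0 \<Longrightarrow> vge (cf F 0) 0"
  by (auto simp: wge_def dest: spec[of _ 0])

lemma ex_small_quot:
  assumes "degree a < degree \<phi>" "degree b < degree \<phi>" "a \<noteq> 0" "b \<noteq> 0"
  obtains c where "degree c < degree \<phi>" "c \<noteq> 0" "V c = V a - V b"
proof -
  obtain b' where b': "degree b' < degree \<phi>" "b' \<noteq> 0" "V b' = - V b"
    using inverse_small[of b] assms by auto
  have nz: "\<not> \<phi> dvd a * b'" using assms b' by (simp add: N_mult)
  have "V (a * b' mod \<phi>) = V a - V b" using assms b' by (simp add: V_mult)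
  then show ?thesis using nz that[of "a * b' mod \<phi>"] by (simp add: mod_eq_0_iff_dvd)
qed

subsection \<open>Ramified key polynomials\<close>

context
  fixes e :: nat and d :: "'m poly"
  assumes e: "0 < e" and d: "degree d < degree \<phi>" "d \<noteq> 0" "V d = nmul e \<gamma>"
    and order: "\<And>i a. 0 < i \<Longrightarrow> i < e \<Longrightarrow> degree a < degree \<phi> \<Longrightarrow> a \<noteq> 0 \<Longrightarrow> V a \<noteq> nmul i \<gamma>"
begin

lemma degree_ramified: "degree (\<phi> ^ e - d) = e * degree \<phi>"
proof -
  have "degree d < degree (\<phi> ^ e)" using d(1) e by (simp add: degree_power_monic less_mult_degree)
  then show ?thesis using degree_add_eq_left[of "- d" "\<phi> ^ e"] by (simp add: degree_power_monic)
qed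

lemma cf_ramified: "cf (\<phi> ^ e - d) k = (if k = e then 1 else 0) - (if k = 0 then d else 0)"
  using cf_monom[of 1 e k] cf_small[OF d(1), of k] deg_pos by (simp add: cf_diff)

lemma crit_ramified: "crit (\<phi> ^ e - d) (nmul e \<gamma>) = {0, e}" "W (\<phi> ^ e - d) = nmul e \<gamma>"
proof -
  show "crit (\<phi> ^ e - d) (nmul e \<gamma>) = {0, e}"
    using e d by (auto simp: crit_def cf_ramified)
  moreover have "wge (\<phi> ^ e - d) (nmul e \<gamma>)"
    using e d by (auto simp: wge_def cf_ramified vge_def)
  ultimately show "W (\<phi> ^ e - d) = nmul e \<gamma>" using crit_imp_W by blast
qed

text \<open>Two critical exponents \<open>i < j\<close> below \<open>e\<close> would make
  \<open>nmul (j - i) \<gamma>\<close> a value of \<open>V\<close>, against the choice of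
  \<open>e\<close> as the order of \<gamma>.\<close>

lemma crit_small_unique:
  assumes "degree a < e * degree \<phi>" "i \<in> crit a g" "j \<in> crit a g"
  shows "i = j"
proof -
  have False if "i < j" "i \<in> crit a g" "j \<in> crit a g" for i j
  proof -
    have "j < e"
      using that cf_eq_0_le[OF assms(1), of j] by (force simp: crit_def)
    moreover have "cf a i \<noteq> 0" "cf a j \<noteq> 0" "V (cf a i) + nmul i \<gamma> = V (cf a j) + nmul j \<gamma>"
      using that by (auto simp: crit_def)
    moreover obtain c where "degree c < degree \<phi>" "c \<noteq> 0" "V c = V (cf a i) - V (cf a j)"
      using ex_small_quot[of "cf a i" "cf a j"] calculation by auto
    moreover have "V (cf a i) - V (cf a j) = nmul (j - i) \<gamma>"
      using calculation(4) that(1) by (simp add: nmul_diff algebra_simps)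
    ultimately show False using order[of "j - i" c] that(1) by simp
  qed
  then show ?thesis using assms(2,3) nat_neq_iff by blast
qed

text \<open>Only the digit at exponent 0 can contribute value exactly 0: at an exponent
  \<open>k\<close> with \<open>0 < k < e\<close> this would make \<open>nmul k \<gamma>\<close> a
  value of \<open>V\<close>.\<close>

lemma wgt_ramified_iff:
  assumes "degree a < e * degree \<phi>" "wge a 0"
  shows "wgt a 0 \<longleftrightarrow> vgt (cf a 0) 0"
proof
  assume "vgt (cf a 0) 0"
  show "wgt a 0"
    unfolding wgt_def
  proof
    fix k
    show "vgt (cf a k) (0 - nmul k \<gamma>)"
    proof (cases "k = 0 \<or> cf a k = 0")
      case True
      then show ?thesis using \<open>vgt (cf a 0) 0\<close> by auto
    next
      case False
      have "k < e"
        using False cf_eq_0_le[OF assms(1), of k] by force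
      have "V (cf a k) \<noteq> - nmul k \<gamma>"
      proof
        assume "V (cf a k) = - nmul k \<gamma>"
        then obtain c where "degree c < degree \<phi>" "c \<noteq> 0" "V c = nmul k \<gamma>"
          using inverse_small[of "cf a k"] False by auto
        then show False using order[of k c] \<open>k < e\<close> False by auto
      qed
      moreover have "vge (cf a k) (0 - nmul k \<gamma>)" using assms(2) by (auto simp: wge_def)
      ultimately show ?thesis by (auto simp: vge_def vgt_def)
    qed
  qed
qed (auto simp: wgt_def dest: spec[of _ 0])

text \<open>A Newton polygon argument. Polynomials of smaller degree have a single critical
  exponent, hence so has a product of two of them; a multiple of \<open>\<phi> ^ e - d\<close> has
  critical exponents at distance at least \<open>e\<close>, by additivity of the width.\<close>

lemma key_ramified: "key (\<phi> ^ e - d)"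
  unfolding key_def degree_ramified
proof (intro conjI allI impI notI)
  have "degree d < e * degree \<phi>" using d(1) e by (simp add: less_mult_degree)
  then show "coeff (\<phi> ^ e - d) (e * degree \<phi>) = 1"
    using lead_coeff_power[of \<phi> e] monic by (simp add: coeff_eq_0 degree_power_monic)
  show "0 < e * degree \<phi>" using e deg_pos by simp
next
  fix a b q :: "'m poly"
  let ?f = "\<phi> ^ e - d"
  assume ab: "a \<noteq> 0" "b \<noteq> 0" "degree a < e * degree \<phi>" "degree b < e * degree \<phi>"
    and gt: "wgt (a * b - q * ?f) (W a + W b)"
  have W_ab: "W (a * b) = W a + W b" using ab by (simp add: W.V_mult)
  have qf: "q * ?f \<noteq> 0" "W (q * ?f) = W a + W b"
    using W.V_eq_of_vgt_diff[of "a * b" "q * ?f"] ab gt by (simp_all add: W_vgt W_ab)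
  have eq: "crit (q * ?f) (W q + W ?f) = crit (a * b) (W a + W b)"
    using crit_cong[OF gt] qf by (simp add: W.V_mult)
  have "Min (crit c (W c)) = Max (crit c (W c))" if c: "c \<noteq> 0" "degree c < e * degree \<phi>" for c
  proof -
    obtain k where "k \<in> crit c (W c)" using crit_nonempty[OF c(1)] by blast
    then have "crit c (W c) = {k}" using crit_small_unique[OF c(2)] by blast
    then show ?thesis by simp
  qed
  then have "Min (crit (a * b) (W a + W b)) = Max (crit (a * b) (W a + W b))"
    using ab by (simp add: crit_W_mult)
  then have "Min (crit q (W q)) + Min (crit ?f (W ?f)) = Max (crit q (W q)) + Max (crit ?f (W ?f))"
    using qf crit_W_mult(1,2)[of q ?f] unfolding eq[symmetric] by simp
  moreover have "Min (crit q (W q)) \<le> Max (crit q (W q))"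
    using qf crit_nonempty[of q] finite_crit[of q "W q"] by (auto intro: Max_ge Min_in)
  ultimately show False
    using e by (simp add: crit_ramified)
qed

lemma stage_ramified:
  "stage (\<phi> ^ e - d) (\<lambda>F. W (F mod (\<phi> ^ e - d))) (\<lambda>F. R (cf (F mod (\<phi> ^ e - d)) 0)) (nmul e \<gamma>)"
proof -
  let ?f = "\<phi> ^ e - d"
  have "stage ?f (\<lambda>F. W (F mod ?f)) (\<lambda>F. R (cf (F mod ?f) 0)) (W ?f)"
  proof (rule key_stage[OF key_ramified, where R' = "\<lambda>F. R (cf F 0)"])
    show "R (cf 1 0) = 1" using deg_pos by (simp add: cf_small)
    show "R (cf (a + b) 0) = R (cf a 0) + R (cf b 0)" if "wge a 0" "wge b 0" for a b
      using that by (simp add: cf_add R_add wge_cf_0)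
    show "R (cf a 0) = 0 \<longleftrightarrow> wgt a 0" if "degree a < degree ?f" "wge a 0" for a
      using that by (simp add: R_eq_0_iff wge_cf_0 wgt_ramified_iff degree_ramified)
    fix a b :: "'m poly"
    assume ab: "degree a < degree ?f" "degree b < degree ?f" "wge a 0" "wge b 0"
    let ?a = "cf a 0" and ?b = "cf b 0"
    \<comment> \<open>An element of value at least 0 agrees with its digit at exponent 0 up to
      positive value. This is why the residue field does not grow and why the new residue map may be
      read off from that digit.\<close>
    have eq: "wgt (a - cf a 0) 0" if "degree a < degree ?f" "wge a 0" for a
    proof -
      have "degree (a - cf a 0) < e * degree \<phi>"
      proof -
        have "degree (cf a 0) < e * degree \<phi>" using e by (simp add: less_mult_degree)
        then show ?thesis using that degree_diff_le_max[of a "cf a 0"] by (simp add: degree_ramified)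
      qed
      moreover have "wge (a - cf a 0) 0"
        using that W.vge_diff[of a 0 "cf a 0"] wge_cf_0 by (simp add: W_vge wge_small)
      ultimately show ?thesis by (simp add: wgt_ramified_iff cf_diff cf_small)
    qed
    have ge: "wge ?a 0" "wge ?b 0" using ab wge_cf_0 by (auto simp: wge_small)
    have 1: "wgt (a * b - ?a * ?b) 0"
    proof -
      have "a * b - ?a * ?b = (a - ?a) * b + ?a * (b - ?b)" by (simp add: algebra_simps)
      moreover have "W.vgt ((a - ?a) * b) (0 + 0)"
        using eq[OF ab(1,3)] ab(4) W.vgt_mult2[of "a - ?a" 0 b 0] by (simp add: W_vgt W_vge)
      moreover have "W.vgt (?a * (b - ?b)) (0 + 0)"
        using eq[OF ab(2,4)] ge(1) W.vgt_mult[of ?a 0 "b - ?b" 0] by (simp add: W_vgt W_vge)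
      ultimately show ?thesis using W.vgt_add by (simp add: W_vgt)
    qed
    have 2: "wgt (?a * ?b - ?a * ?b mod \<phi>) 0"
      using wgt_quot[of ?a ?b 0 0 0 0] ab wge_cf_0 by simp
    have 3: "wgt (a * b - ?a * ?b mod \<phi>) 0"
      using wgt_add[OF 1 2] by simp
    have dr: "degree (?a * ?b mod \<phi>) < degree ?f"
      using e unfolding degree_ramified by (simp add: less_mult_degree)
    have "(a * b - ?a * ?b mod \<phi>) mod ?f = a * b mod ?f - ?a * ?b mod \<phi>"
      using dr by (simp add: poly_mod_diff_left mod_poly_less)
    then have "wgt (a * b mod ?f - ?a * ?b mod \<phi>) 0"
      using key_mod_gt[OF key_ramified 3] by simp
    then have "vgt (cf (a * b mod ?f - ?a * ?b mod \<phi>) 0) 0"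
      by (auto simp: wgt_def dest: spec[of _ 0])
    then have 4: "vgt (cf (a * b mod ?f) 0 - ?a * ?b mod \<phi>) 0"
      by (simp add: cf_diff cf_small)
    have "wge (a * b) 0" using wge_mult[OF ab(3,4)] by simp
    then have "vge (cf (a * b mod ?f) 0) 0"
      using key_mod(1)[OF key_ramified] wge_cf_0 by blast
    then have "R (cf (a * b mod ?f) 0) = R (?a * ?b mod \<phi>)" using 4 by (rule R_eqI)
    also have "\<dots> = R ?a * R ?b" using ab wge_cf_0 by (simp add: R_mod R_mult vge_0_mult)
    finally show "R (cf (a * b mod ?f) 0) = R ?a * R ?b" .
  qed
  then show ?thesis by (simp add: crit_ramified)
qed

end

end

section \<open>Residual key polynomials\<close>

context aug
begin

text \<open>The initial form of \<open>F\<close> is that of its remainder, so \<open>F\<close>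
  counts as a constant with respect to \<phi>. Products such as \<open>c i * d' ^ (e - i)\<close>
  may have large degree; this property allows \<open>R\<close> to be applied to them as if they were
  reduced.\<close>

definition approx :: "'m poly \<Rightarrow> bool" where
  "approx F \<longleftrightarrow> wgt (F - F mod \<phi>) (W F)"

lemma approx_small: "degree a < degree \<phi> \<Longrightarrow> approx a"
  by (simp add: approx_def mod_poly_less)

lemma approx_mult:
  assumes "approx F" "degree b < degree \<phi>"
  shows "approx (F * b)"
proof (cases "F * b = 0")
  case False
  have gt: "W.vgt (F - F mod \<phi>) (W F)" using assms by (simp add: approx_def W_vgt)
  then have "wge (F mod \<phi>) (W F)"
    using W.vge_diff[of F "W F" "F - F mod \<phi>"] W.vgt_imp_vge W.vge_self by (simp add: W_vge)
  then have 1: "vge (F mod \<phi>) (W F)" by (simp add: wge_small)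
  have 2: "wgt ((F - F mod \<phi>) * b) (W F + W b)"
    using W.vgt_mult2[OF gt W.vge_self] by (simp add: W_vgt)
  have "vge b (W b)" using wge_W[of b] assms by (simp add: wge_small)
  then have 3: "wgt ((F mod \<phi>) * b - (F mod \<phi>) * b mod \<phi>) (W F + W b)"
    using wgt_quot[of "F mod \<phi>" b "W F" 0 "W b" 0] 1 assms by simp
  show ?thesis
    using wgt_add[OF 2 3] False by (simp add: approx_def W.V_mult algebra_simps mod_mult_right_eq)
qed (auto simp: approx_def)

lemma approx_mult_power: "approx F \<Longrightarrow> degree b < degree \<phi> \<Longrightarrow> approx (F * b ^ n)"
proof (induction n)
  case (Suc n)
  then show ?case using approx_mult[of "F * b ^ n" b] by (simp add: ac_simps)
qed simp

abbreviation lift_poly :: "nat \<Rightarrow> (nat \<Rightarrow> 'm poly) \<Rightarrow> 'm poly" where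
  "lift_poly e c \<equiv> \<phi> ^ e + (\<Sum>i<e. c i * \<phi> ^ i)"

context
  fixes d :: "'m poly"
  assumes d: "degree d < degree \<phi>" "d \<noteq> 0" "V d = \<gamma>"
begin

text \<open>The Gauss residue map: \<open>F\<close> is rewritten as a polynomial in
  \<phi>\<open>/d\<close>, an element of value 0, with coefficients \<open>cf F k * d ^ k\<close>,
  and these are reduced by \<open>R\<close>.\<close>

definition T :: "'m poly \<Rightarrow> 'e poly" where
  "T F = (\<Sum>k\<le>degree F. Polynomial.monom (R (cf F k * d ^ k)) k)"

lemma V_d_power: "\<not> \<phi> dvd d ^ k" "V (d ^ k) = nmul k \<gamma>"
  using d by (simp_all add: N_power V_power)

lemma vge_cf_d: "wge F 0 \<Longrightarrow> vge (cf F k * d ^ k) 0"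
  using vge_mult_iff[of "d ^ k" "cf F k" "- nmul k \<gamma>"] V_d_power[of k]
  by (simp add: wge_def mult.commute)

lemma vgt_cf_d: "wgt F 0 \<longleftrightarrow> (\<forall>k. vgt (cf F k * d ^ k) 0)"
proof -
  have "vgt (cf F k * d ^ k) 0 \<longleftrightarrow> vgt (cf F k) (0 - nmul k \<gamma>)" for k
    using vgt_mult_iff[of "d ^ k" "cf F k" "- nmul k \<gamma>"] V_d_power[of k] by (simp add: mult.commute)
  then show ?thesis by (simp add: wgt_def)
qed

lemma coeff_T: "coeff (T F) k = R (cf F k * d ^ k)"
proof -
  have "coeff (T F) k = (\<Sum>i\<le>degree F. if i = k then R (cf F i * d ^ i) else 0)"
    by (simp add: T_def coeff_sum)
  then show ?thesis using cf_nz_le[of F k] by (cases "cf F k = 0") auto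
qed

lemma T_add: "wge F 0 \<Longrightarrow> wge G 0 \<Longrightarrow> T (F + G) = T F + T G"
  by (rule poly_eqI) (simp add: coeff_T cf_add distrib_right R_add vge_cf_d)

lemma T_eq_0_iff: "wge F 0 \<Longrightarrow> T F = 0 \<longleftrightarrow> wgt F 0"
  by (simp add: poly_eq_iff coeff_T vgt_cf_d R_eq_0_iff vge_cf_d)

lemma T_small: "degree a < degree \<phi> \<Longrightarrow> T a = [:R a:]"
  by (rule poly_eqI) (auto simp: coeff_T cf_small coeff_pCons split: nat.splits)

text \<open>The true product may be replaced by \<open>tr F G\<close>, whose digits are sums of
  products in the residue class field modulo \<phi>; there \<open>R\<close> is
  multiplicative.\<close>

lemma T_mult:
  assumes "wge F 0" "wge G 0"
  shows "T (F * G) = T F * T G"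
proof (rule poly_eqI)
  fix k
  have tr: "wgt (F * G - tr F G) 0" using wgt_tr[OF assms] by simp
  then have "vgt (cf (F * G - tr F G) k * d ^ k) 0" unfolding vgt_cf_d by blast
  then have "vgt (cf (F * G) k * d ^ k - cf (tr F G) k * d ^ k) 0"
    by (simp add: cf_diff left_diff_distrib)
  moreover have "vge (cf (F * G) k * d ^ k) 0"
    using wge_mult[OF assms] by (intro vge_cf_d) simp
  ultimately have "coeff (T (F * G)) k = R (cf (tr F G) k * d ^ k)"
    unfolding coeff_T by (intro R_eqI)
  also have "cf (tr F G) k * d ^ k = (\<Sum>i\<le>degree F. \<Sum>j\<le>degree G.
      if i + j = k then (cf F i * cf G j mod \<phi>) * d ^ k else 0)"
    unfolding cf_tr sum_distrib_right by (intro sum.cong refl) auto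
  also have "R \<dots> = (\<Sum>i\<le>degree F. \<Sum>j\<le>degree G.
      if i + j = k then R (cf F i * d ^ i) * R (cf G j * d ^ j) else 0)"
  proof -
    have *: "vge ((cf F i * cf G j mod \<phi>) * d ^ k) 0 \<and>
        R ((cf F i * cf G j mod \<phi>) * d ^ k) = R (cf F i * d ^ i) * R (cf G j * d ^ j)"
      if "i + j = k" for i j
    proof -
      have ge: "vge ((cf F i * d ^ i) * (cf G j * d ^ j)) 0"
        using assms by (intro vge_0_mult vge_cf_d)
      have "(cf F i * d ^ i) * (cf G j * d ^ j) = cf F i * cf G j * d ^ k"
        using that by (auto simp: power_add)
      moreover have "\<phi> dvd (cf F i * cf G j) * d ^ k - (cf F i * cf G j mod \<phi>) * d ^ k"
        by (simp add: mod_eq_dvd_iff[symmetric] mod_mult_left_eq)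
      ultimately show ?thesis using ge R_cong vge_cong R_mult[of "cf F i * d ^ i" "cf G j * d ^ j"]
        assms vge_cf_d by metis
    qed
    show ?thesis
    proof (subst R_sum)
      show "vge (\<Sum>j\<le>degree G. if i + j = k then (cf F i * cf G j mod \<phi>) * d ^ k else 0) 0" for i
        using * by (intro vge_sum) auto
      show "(\<Sum>i\<le>degree F. R (\<Sum>j\<le>degree G. if i + j = k then (cf F i * cf G j mod \<phi>) * d ^ k else 0))
        = (\<Sum>i\<le>degree F. \<Sum>j\<le>degree G. if i + j = k then R (cf F i * d ^ i) * R (cf G j * d ^ j) else 0)"
        using * by (intro sum.cong refl, subst R_sum) (auto intro!: sum.cong)
    qed
  qed
  also have "\<dots> = coeff (T F * T G) k"
    unfolding T_def sum_product coeff_sum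
    by (intro sum.cong refl) (simp add: mult_monom)
  finally show "coeff (T (F * G)) k = coeff (T F * T G) k" .
qed

lemma pvres_T: "pvres (\<lambda>F. F = 0) W T"
proof
  have "degree (1 :: 'm poly) < degree \<phi>" using deg_pos by simp
  from T_small[OF this] show "T 1 = 1" by simp
qed (simp_all add: W_vge W_vgt T_add T_mult T_eq_0_iff)

interpretation T: pvres "\<lambda>F. F = 0" W T
  by (rule pvres_T)

lemma T_approx:
  assumes "approx F" "wge F 0"
  shows "T F = [:R F:]" "vge F 0"
proof -
  have "wgt (F - F mod \<phi>) 0"
  proof (cases "F = 0")
    case False
    then show ?thesis using assms W.vgt_mono[of "F - F mod \<phi>" "W F" 0]
      by (simp add: approx_def W_vgt wge_iff)
  qed simp
  then have "T F = T (F mod \<phi>)" and ge: "wge (F mod \<phi>) 0"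
    using T.R_eqI[of F "F mod \<phi>"] assms W.vge_diff[of F 0 "F - F mod \<phi>"] W.vgt_imp_vge
    by (auto simp: W_vge W_vgt)
  moreover from ge show "vge F 0" by (simp add: wge_small)
  ultimately show "T F = [:R F:]" by (simp add: T_small R_mod)
qed

lemma ex_normalizer:
  assumes "a \<noteq> 0"
  obtains s where "degree s < degree \<phi>" "s \<noteq> 0" "W (s * a) = 0"
proof -
  obtain k where "k \<in> crit a (W a)" using crit_nonempty[OF assms] by blast
  then have k: "cf a k \<noteq> 0" "V (cf a k) + nmul k \<gamma> = W a" by (auto simp: crit_def)
  then have nz: "\<not> \<phi> dvd cf a k * d ^ k" using V_d_power by (simp add: N_mult)
  \<comment> \<open>The inverse of a critical term of \<open>a\<close>, with \<phi> replaced by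
    \<open>d\<close>, which has the same value. This keeps \<open>s\<close> of small degree.\<close>
  obtain s where s: "degree s < degree \<phi>" "s \<noteq> 0" "V s = - V (cf a k * d ^ k)"
    using inverse_small[OF nz] by metis
  then have "W (s * a) = 0"
    using k assms V_d_power[of k] by (simp add: W.V_mult W_small V_mult)
  with s show ?thesis using that by blast
qed

text \<open>Here \<open>lift_poly e c\<close> imitates \<open>d ^ e\<close> times the minimal
  polynomial of \<tau>, of degree \<open>e\<close>, evaluated at \<phi>\<open>/d\<close>.
  Accordingly the coefficient at exponent \<open>i\<close> is lifted to \<open>c i\<close> only
  after multiplication by \<open>d ^ (e - i)\<close>, which \<open>d'\<close>, an inverse of
  \<open>d\<close> modulo \<phi>, undoes.\<close>

context
  fixes d' :: "'m poly" and e :: nat and c :: "nat \<Rightarrow> 'm poly" and \<tau> :: 'e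
  assumes d': "degree d' < degree \<phi>" "d' \<noteq> 0" "\<phi> dvd d * d' - 1" "V d' = - \<gamma>"
    and e: "0 < e" and c: "\<And>i. i < e \<Longrightarrow> degree (c i) < degree \<phi>"
    and c_ge: "\<And>i. i < e \<Longrightarrow> vge (c i * d' ^ (e - i)) 0"
    and root: "\<tau> ^ e + (\<Sum>i<e. R (c i * d' ^ (e - i)) * \<tau> ^ i) = 0"
    and minimal: "\<And>p. p \<noteq> 0 \<Longrightarrow> degree p < e \<Longrightarrow> (\<And>k. coeff p k \<in> R ` {a. vge a 0}) \<Longrightarrow>
      poly p \<tau> \<noteq> 0"
begin

lemma cf_residual: "cf (lift_poly e c) k = (if k = e then 1 else if k < e then c k else 0)"
proof -
  have "cf (\<phi> ^ e) k = (if k = e then 1 else 0)"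
    using cf_monom[of 1 e k] deg_pos by simp
  moreover have "cf (\<Sum>i<e. c i * \<phi> ^ i) k = (\<Sum>i<e. if i = k then c i else 0)"
    unfolding cf_sum using c by (intro sum.cong refl) (simp add: cf_monom)
  ultimately show ?thesis by (simp add: cf_add)
qed

lemma degree_sum_c: "degree (\<Sum>i<e. c i * \<phi> ^ i) < e * degree \<phi>"
proof (rule degree_sum_less)
  fix i assume i: "i \<in> {..<e}"
  have "degree (c i * \<phi> ^ i) \<le> degree (c i) + i * degree \<phi>"
    using degree_mult_le[of "c i" "\<phi> ^ i"] by (simp add: degree_power_monic)
  also have "\<dots> < Suc i * degree \<phi>" using c i by simp
  also have "\<dots> \<le> e * degree \<phi>" using i by (intro mult_le_mono1) simp
  finally show "degree (c i * \<phi> ^ i) < e * degree \<phi>" .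
qed (use e deg_pos in simp)

lemma degree_residual: "degree (lift_poly e c) = e * degree \<phi>"
  using degree_add_eq_left[of "\<Sum>i<e. c i * \<phi> ^ i" "\<phi> ^ e"] degree_sum_c
  by (simp add: degree_power_monic)

lemma monic_residual: "lead_coeff (lift_poly e c) = 1"
  unfolding degree_residual using lead_coeff_power[of \<phi> e] monic degree_sum_c
  by (simp add: coeff_eq_0 degree_power_monic)

lemma vge_c: "i < e \<Longrightarrow> vge (c i) (nmul (e - i) \<gamma>)"
  using c_ge[of i] vge_mult_iff[of "d' ^ (e - i)" "c i" "nmul (e - i) \<gamma>"] d'
  by (simp add: N_power V_power nmul_uminus mult.commute)

lemma W_residual: "W (lift_poly e c) = nmul e \<gamma>"
proof -
  have "wge (lift_poly e c) (nmul e \<gamma>)"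
    unfolding wge_def cf_residual using vge_c by (auto simp: vge_def[of 1] nmul_diff)
  moreover have "e \<in> crit (lift_poly e c) (nmul e \<gamma>)"
    by (simp add: crit_def cf_residual)
  ultimately show ?thesis using crit_imp_W by blast
qed

lemma W_d: "W d = \<gamma>" "W d' = - \<gamma>"
  using W_small d d' by auto

lemma T_dd': "T (d * d') = 1" "wge (d * d') 0"
proof -
  have W0: "W (d * d') = 0" using d d' by (simp add: W.V_mult W_d)
  then show ge: "wge (d * d') 0" using d d' by (simp add: wge_iff)
  have "T (d * d') = [:R (d * d'):]"
    using ge approx_mult[OF approx_small] d d' by (intro T_approx) auto
  also have "R (d * d') = 1"
    using R_cong[of "d * d'" 1] d'(3) ge T_approx(2) approx_mult[OF approx_small, of d d'] d d'
    by simp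
  finally show "T (d * d') = 1" by (simp add: one_pCons)
qed

text \<open>The element \<open>d' * \<phi>\<close> plays the role of \<phi>\<open>/d\<close>, so its
  residue is the indeterminate.\<close>

lemma T_d'_phi: "T (d' * \<phi>) = Polynomial.monom 1 1" "wge (d' * \<phi>) 0"
proof -
  have R1: "R (d * d') = 1" using T_dd' T_approx[of "d * d'"] approx_mult[OF approx_small, of d d'] d d'
    by (simp add: one_pCons)
  show "T (d' * \<phi>) = Polynomial.monom 1 1"
  proof (rule poly_eqI)
    show "coeff (T (d' * \<phi>)) k = coeff (Polynomial.monom 1 1) k" for k
      using cf_monom[OF d'(1), of 1 k] R1 by (cases "k = 1") (auto simp: coeff_T mult.commute[of d'])
  qed
  show "wge (d' * \<phi>) 0" using wge_monom[OF d'(1), of 0 1] d' by (simp add: vge_def)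
qed

text \<open>Multiplication by \<open>d' ^ e\<close> brings the key polynomial to value 0, and its
  residue is then the monic polynomial whose vanishing at \<tau> is the assumption
  \<open>root\<close>.\<close>

lemma root_T: "poly (T (d' ^ e * (lift_poly e c))) \<tau> = 0" "wge (d' ^ e * (lift_poly e c)) 0"
proof -
  have term_eq: "d' ^ e * (c i * \<phi> ^ i) = (c i * d' ^ (e - i)) * (d' * \<phi>) ^ i" if "i < e" for i
  proof -
    have "d' ^ e = d' ^ (e - i) * d' ^ i" using that by (simp flip: power_add)
    then show ?thesis by (simp add: power_mult_distrib ac_simps)
  qed
  have ge_c: "wge (c i * d' ^ (e - i)) 0" if "i < e" for i
    using vge_c[OF that] W.vge_mult[of "c i" "nmul (e - i) \<gamma>" "d' ^ (e - i)" "- nmul (e - i) \<gamma>"]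
      c[OF that] W.vge_power[OF W.vge_self[of d'], of "e - i"]
    by (simp add: W_vge wge_small W_d nmul_uminus)
  have T_c: "T (c i * d' ^ (e - i)) = [:R (c i * d' ^ (e - i)):]" if "i < e" for i
    using T_approx[OF approx_mult_power[OF approx_small[OF c[OF that]] d'(1)] ge_c[OF that]] by simp
  have ge_phi: "W.vge ((d' * \<phi>) ^ i) 0" for i
    using T_d'_phi(2) by (intro T.vge_0_power) (simp add: W_vge)
  have eq: "d' ^ e * (lift_poly e c) = (d' * \<phi>) ^ e + (\<Sum>i<e. (c i * d' ^ (e - i)) * (d' * \<phi>) ^ i)"
    by (simp add: distrib_left sum_distrib_left power_mult_distrib[of d' \<phi> e] term_eq)
  have ge2: "W.vge ((c i * d' ^ (e - i)) * (d' * \<phi>) ^ i) 0" if "i < e" for i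
    using ge_c[OF that] ge_phi[of i] T.vge_0_mult[of "c i * d' ^ (e - i)" "(d' * \<phi>) ^ i"]
    by (simp only: W_vge)
  have "T (d' ^ e * (lift_poly e c)) = T ((d' * \<phi>) ^ e) + T (\<Sum>i<e. (c i * d' ^ (e - i)) * (d' * \<phi>) ^ i)"
    unfolding eq using ge2 ge_phi by (intro T.R_add W.vge_sum) auto
  also have "T (\<Sum>i<e. (c i * d' ^ (e - i)) * (d' * \<phi>) ^ i) =
      (\<Sum>i<e. [:R (c i * d' ^ (e - i)):] * T (d' * \<phi>) ^ i)"
    using ge2 ge_phi ge_c T_c T_d'_phi(2)
    by (subst T.R_sum) (auto intro!: sum.cong simp: T.R_mult T.R_power W_vge)
  also have "T ((d' * \<phi>) ^ e) = T (d' * \<phi>) ^ e"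
    using T_d'_phi(2) by (intro T.R_power) (simp add: W_vge)
  finally have "poly (T (d' ^ e * (lift_poly e c))) \<tau> = \<tau> ^ e + (\<Sum>i<e. R (c i * d' ^ (e - i)) * \<tau> ^ i)"
    by (simp add: T_d'_phi poly_sum poly_monom)
  then show "poly (T (d' ^ e * (lift_poly e c))) \<tau> = 0" using root by simp
  show "wge (d' ^ e * (lift_poly e c)) 0"
    unfolding eq W_vge[symmetric] using ge2 ge_phi by (intro W.vge_add W.vge_sum) auto
qed

text \<open>Neither \<open>q\<close> nor the key polynomial need have value 0. Inserting the factor
  \<open>(d * d') ^ e\<close>, of residue 1, and distributing it over the two makes
  \<open>T_mult\<close> applicable.\<close>

lemma T_multiple:
  assumes "wge (q * (lift_poly e c)) 0"
  shows "poly (T (q * (lift_poly e c))) \<tau> = 0"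
proof (cases "q = 0")
  case False
  have nz: "(lift_poly e c) \<noteq> 0" using degree_residual e deg_pos by (metis degree_0 less_irrefl nat_0_less_mult_iff)
  have "W q + nmul e \<gamma> \<ge> 0" using assms False nz by (simp add: wge_iff W.V_mult W_residual)
  then have ge: "wge (d ^ e * q) 0"
    using False d by (simp add: wge_iff W.V_mult W.V_power W_d add.commute)
  have "T (q * (lift_poly e c)) = T (q * (lift_poly e c)) * T (d * d') ^ e" by (simp add: T_dd')
  also have "\<dots> = T (q * (lift_poly e c) * (d * d') ^ e)"
    using T_dd'(2) assms T.vge_0_power by (simp add: T.R_mult T.R_power W_vge)
  also have "q * (lift_poly e c) * (d * d') ^ e = (d ^ e * q) * (d' ^ e * (lift_poly e c))"
    by (simp add: power_mult_distrib ac_simps)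
  also have "T \<dots> = T (d ^ e * q) * T (d' ^ e * (lift_poly e c))"
    using ge root_T by (intro T_mult)
  finally show ?thesis using root_T by simp
qed (simp add: T_def)

text \<open>In the truncated product \<open>s\<close> contributes only to exponent 0, so no digit
  appears at \<open>e\<close> or beyond; the true product differs from it by something of positive
  value.\<close>

lemma T_small_degree:
  assumes "degree a < e * degree \<phi>" "wge (s * a) 0" "degree s < degree \<phi>"
  shows "degree (T (s * a)) < e"
proof -
  have "coeff (T (s * a)) k = 0" if "e \<le> k" for k
  proof -
    have "cf (tr s a) k = 0"
      unfolding cf_tr using cf_eq_0_le[OF assms(1) that] by (auto intro!: sum.neutral simp: cf_small[OF assms(3)])
    moreover have "wgt (s * a - tr s a) (W s + W a)" by (rule wgt_tr[OF wge_W wge_W])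
    moreover have "s = 0 \<or> a = 0 \<or> 0 \<le> W s + W a"
      using assms(2) by (cases "s * a = 0") (auto simp: wge_iff W.V_mult)
    ultimately have "wgt (s * a - tr s a) 0"
      using W.vgt_mono[of _ "W s + W a" 0] by (auto simp: W_vgt tr_def)
    then have "vgt (cf (s * a - tr s a) k * d ^ k) 0" unfolding vgt_cf_d by blast
    then show ?thesis
      using \<open>cf (tr s a) k = 0\<close> R_eq_0_iff[OF vge_cf_d[OF assms(2)]] by (simp add: coeff_T cf_diff)
  qed
  then show ?thesis using e by (metis leI leading_coeff_0_iff degree_0)
qed

lemma poly_T_eq_0:
  assumes "degree (T F) < e" "wge F 0" "poly (T F) \<tau> = 0"
  shows "wgt F 0"
proof -
  have "coeff (T F) k \<in> R ` {a. vge a 0}" for k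
    using vge_cf_d[OF assms(2)] by (auto simp: coeff_T)
  then have "T F = 0" using minimal assms by blast
  then show ?thesis using assms T_eq_0_iff by blast
qed

text \<open>Normalise \<open>a\<close> and \<open>b\<close> to value 0. Their residues are nonzero
  polynomials of degree below \<open>e\<close>, so by minimality they do not vanish at \<tau>; but a
  multiple of the key polynomial has a residue that does.\<close>

lemma key_residual: "key (lift_poly e c)"
  unfolding key_def
proof (intro conjI allI impI notI)
  show "lead_coeff (lift_poly e c) = 1" by (rule monic_residual)
  show "0 < degree (lift_poly e c)" using e deg_pos by (simp add: degree_residual)
next
  fix a b q :: "'m poly"
  assume ab: "a \<noteq> 0" "b \<noteq> 0" "degree a < degree (lift_poly e c)" "degree b < degree (lift_poly e c)"
    and gt: "wgt (a * b - q * (lift_poly e c)) (W a + W b)"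
  obtain s where s: "degree s < degree \<phi>" "s \<noteq> 0" "W (s * a) = 0" using ex_normalizer[OF ab(1)] .
  obtain t where t: "degree t < degree \<phi>" "t \<noteq> 0" "W (t * b) = 0" using ex_normalizer[OF ab(2)] .
  have ge: "wge (s * a) 0" "wge (t * b) 0" and ngt: "\<not> wgt (s * a) 0" "\<not> wgt (t * b) 0"
    using s t ab by (auto simp: wge_iff wgt_iff)
  have sum0: "W s + W t + (W a + W b) = 0"
    using s t ab W.V_mult[of s a] W.V_mult[of t b] by (metis (no_types, lifting) add.assoc add.commute add_0_left)
  have "W.vgt ((s * t) * (a * b - q * (lift_poly e c))) (W (s * t) + (W a + W b))"
    using gt W.vgt_mult[OF W.vge_self] by (simp add: W_vgt)
  then have 1: "W.vgt ((s * a) * (t * b) - (s * t * q) * (lift_poly e c)) 0"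
    using s t sum0 by (simp add: W.V_mult algebra_simps)
  have 2: "W.vge ((s * a) * (t * b)) 0"
    using ge T.vge_0_mult[of "s * a" "t * b"] by (simp only: W_vge)
  have 3: "wge ((s * t * q) * (lift_poly e c)) 0"
    using W.vge_diff[OF 2 W.vgt_imp_vge[OF 1]] by (simp add: W_vge)
  have "T (s * a) * T (t * b) = T ((s * t * q) * (lift_poly e c))"
    using T.R_eqI[OF 2 1] T_mult[OF ge] by simp
  then have "poly (T (s * a)) \<tau> * poly (T (t * b)) \<tau> = 0"
    using T_multiple[OF 3] by (metis poly_mult)
  then show False
    using poly_T_eq_0[OF T_small_degree ge(1)] poly_T_eq_0[OF T_small_degree ge(2)] ab s t ge ngt
    unfolding degree_residual by auto
qed

lemma stage_residual:
  "stage (lift_poly e c) (\<lambda>F. W (F mod (lift_poly e c))) (\<lambda>F. poly (T (F mod (lift_poly e c))) \<tau>) (nmul e \<gamma>)"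
proof -
  have "stage (lift_poly e c) (\<lambda>F. W (F mod (lift_poly e c))) (\<lambda>F. poly (T (F mod (lift_poly e c))) \<tau>) (W (lift_poly e c))"
  proof (rule key_stage[OF key_residual, where R' = "\<lambda>F. poly (T F) \<tau>"])
    show "poly (T 1) \<tau> = 1" by simp
    show "poly (T (a + b)) \<tau> = poly (T a) \<tau> + poly (T b) \<tau>" if "wge a 0" "wge b 0" for a b
      using that by (simp add: T_add)
    show "poly (T a) \<tau> = 0 \<longleftrightarrow> wgt a 0" if "degree a < degree (lift_poly e c)" "wge a 0" for a
    proof -
      have "degree (T a) < e"
        using T_small_degree[of a 1] that deg_pos by (simp add: degree_residual)
      then show ?thesis using poly_T_eq_0[of a] that T_eq_0_iff[of a] by fastforce
    qed
    fix a b :: "'m poly"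
    assume ab: "wge a 0" "wge b 0"
    have ge: "wge (a * b) 0" using wge_mult[OF ab] by simp
    have "T (a * b) = T (a * b div (lift_poly e c) * (lift_poly e c) + a * b mod (lift_poly e c))"
      by (simp only: div_mult_mod_eq)
    also have "\<dots> = T (a * b div (lift_poly e c) * (lift_poly e c)) + T (a * b mod (lift_poly e c))"
      by (intro T_add key_mod[OF key_residual ge])
    finally have "poly (T (a * b)) \<tau> = poly (T (a * b div (lift_poly e c) * (lift_poly e c))) \<tau> + poly (T (a * b mod (lift_poly e c))) \<tau>"
      by (simp only: poly_add)
    then show "poly (T (a * b mod (lift_poly e c))) \<tau> = poly (T a) \<tau> * poly (T b) \<tau>"
      by (simp only: T_multiple[OF key_mod(2)[OF key_residual ge]] T_mult[OF ab] poly_mult add_0_left)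
  qed
  then show ?thesis by (simp add: W_residual)
qed

end

end

end

section \<open>Adjoining a value or a residue\<close>

definition mod_closed :: "'m::field poly set \<Rightarrow> bool" where
  "mod_closed S \<longleftrightarrow> 0 \<in> S \<and> 1 \<in> S \<and> (\<forall>a\<in>S. \<forall>b\<in>S. a + b \<in> S \<and> a - b \<in> S \<and> a * b \<in> S \<and> a mod b \<in> S)"

text \<open>Every element of the stage has the initial form of some member of \<open>S\<close>. Over
  an immediate extension \<open>S\<close> is the image of \<open>K[x]\<close>, and this property,
  handed on from stage to stage, lets each new key polynomial be chosen with coefficients in
  \<open>K\<close>.\<close>

definition rational :: "'m::field poly set \<Rightarrow> 'm poly \<Rightarrow> ('m poly \<Rightarrow> 'g::linordered_ab_group_add) \<Rightarrow> bool" where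
  "rational S \<phi> V \<longleftrightarrow> \<phi> \<in> S \<and> (\<forall>a. degree a < degree \<phi> \<longrightarrow> a \<noteq> 0 \<longrightarrow>
     (\<exists>a'\<in>S. degree a' < degree \<phi> \<and> (a = a' \<or> V a < V (a - a'))))"

definition vals :: "'m::field poly \<Rightarrow> ('m poly \<Rightarrow> 'g::linordered_ab_group_add) \<Rightarrow> 'g set" where
  "vals \<phi> V = V ` {a. degree a < degree \<phi> \<and> a \<noteq> 0}"

definition ress :: "'m::field poly \<Rightarrow> ('m poly \<Rightarrow> 'g::linordered_ab_group_add) \<Rightarrow> ('m poly \<Rightarrow> 'e) \<Rightarrow> 'e set" where
  "ress \<phi> V R = R ` {a. degree a < degree \<phi> \<and> (a = 0 \<or> 0 \<le> V a)}"

text \<open>Agreement on representatives of small degree; no field homomorphism between the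
  quotients is involved. Degrees do not decrease, so these representatives remain reduced at the
  later stage.\<close>

definition stage_le ::
    "'m::field poly \<Rightarrow> ('m poly \<Rightarrow> 'g::linordered_ab_group_add) \<Rightarrow> ('m poly \<Rightarrow> 'e) \<Rightarrow>
     'm poly \<Rightarrow> ('m poly \<Rightarrow> 'g) \<Rightarrow> ('m poly \<Rightarrow> 'e) \<Rightarrow> bool" where
  "stage_le \<phi> V R \<phi>' V' R' \<longleftrightarrow> degree \<phi> \<le> degree \<phi>' \<and>
     (\<forall>a. degree a < degree \<phi> \<longrightarrow> R' a = R a \<and> (a \<noteq> 0 \<longrightarrow> V' a = V a))"

lemma mod_closed_sum: "mod_closed S \<Longrightarrow> (\<And>x. x \<in> A \<Longrightarrow> f x \<in> S) \<Longrightarrow> sum f A \<in> S"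
  by (induction A rule: infinite_finite_induct) (auto simp: mod_closed_def)

lemma mod_closed_power: "mod_closed S \<Longrightarrow> a \<in> S \<Longrightarrow> a ^ n \<in> S"
  by (induction n) (auto simp: mod_closed_def)

lemma stage_le_refl: "stage_le \<phi> V R \<phi> V R"
  by (simp add: stage_le_def)

lemma stage_le_trans: "stage_le \<phi> V R \<phi>' V' R' \<Longrightarrow> stage_le \<phi>' V' R' \<phi>'' V'' R'' \<Longrightarrow> stage_le \<phi> V R \<phi>'' V'' R''"
  by (auto simp: stage_le_def)

lemma stage_le_vals: "stage_le \<phi> V R \<phi>' V' R' \<Longrightarrow> vals \<phi> V \<subseteq> vals \<phi>' V'"
  unfolding stage_le_def vals_def by (auto simp: image_iff) (metis less_le_trans)

lemma stage_le_ress: "stage_le \<phi> V R \<phi>' V' R' \<Longrightarrow> ress \<phi> V R \<subseteq> ress \<phi>' V' R'"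
  unfolding ress_def
proof (rule image_subsetI)
  fix a assume le: "stage_le \<phi> V R \<phi>' V' R'" and "a \<in> {a. degree a < degree \<phi> \<and> (a = 0 \<or> 0 \<le> V a)}"
  then have a: "degree a < degree \<phi>" "a = 0 \<or> 0 \<le> V a" by auto
  then have "R' a = R a" "degree a < degree \<phi>'" "a = 0 \<or> 0 \<le> V' a" using le by (auto simp: stage_le_def)
  then show "R a \<in> R' ` {a. degree a < degree \<phi>' \<and> (a = 0 \<or> 0 \<le> V' a)}"
    by (intro image_eqI[of _ _ a]) auto
qed

context stage
begin

lemma vals_iff: "g \<in> vals \<phi> V \<longleftrightarrow> (\<exists>F. \<not> \<phi> dvd F \<and> V F = g)"
proof
  assume "\<exists>F. \<not> \<phi> dvd F \<and> V F = g"
  then obtain F where "\<not> \<phi> dvd F" "V F = g" by blast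
  then have "F mod \<phi> \<noteq> 0" "V (F mod \<phi>) = g" by (auto simp: mod_eq_0_iff_dvd)
  then show "g \<in> vals \<phi> V" unfolding vals_def by (intro image_eqI[of _ _ "F mod \<phi>"]) auto
next
  assume "g \<in> vals \<phi> V"
  then obtain a where "degree a < degree \<phi>" "a \<noteq> 0" "V a = g" by (auto simp: vals_def)
  then show "\<exists>F. \<not> \<phi> dvd F \<and> V F = g" by (intro exI[of _ a]) simp
qed

lemma ress_iff: "y \<in> ress \<phi> V R \<longleftrightarrow> (\<exists>F. vge F 0 \<and> R F = y)"
proof
  assume "\<exists>F. vge F 0 \<and> R F = y"
  then obtain F where F: "vge F 0" "R F = y" by blast
  have "vge (F mod \<phi>) 0" "R (F mod \<phi>) = y" using F R_mod by auto
  then have "F mod \<phi> = 0 \<or> 0 \<le> V (F mod \<phi>)" by (auto simp: vge_def)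
  then show "y \<in> ress \<phi> V R" unfolding ress_def using \<open>R (F mod \<phi>) = y\<close>
    by (intro image_eqI[of _ _ "F mod \<phi>"]) auto
next
  assume "y \<in> ress \<phi> V R"
  then obtain a where "degree a < degree \<phi>" "a = 0 \<or> 0 \<le> V a" "R a = y" by (auto simp: ress_def)
  then show "\<exists>F. vge F 0 \<and> R F = y" by (intro exI[of _ a]) (auto simp: vge_def)
qed

lemma ress_eq: "ress \<phi> V R = R ` {a. vge a 0}"
  using ress_iff by (auto simp: image_iff)

lemma vals_0: "0 \<in> vals \<phi> V"
  unfolding vals_iff by (intro exI[of _ 1]) (simp add: N_1)

lemma vals_add: "g \<in> vals \<phi> V \<Longrightarrow> h \<in> vals \<phi> V \<Longrightarrow> g + h \<in> vals \<phi> V"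
  unfolding vals_iff by (metis N_mult V_mult)

lemma vals_uminus: "g \<in> vals \<phi> V \<Longrightarrow> - g \<in> vals \<phi> V"
  unfolding vals_iff using inverse_small by metis

lemma vals_diff: "g \<in> vals \<phi> V \<Longrightarrow> h \<in> vals \<phi> V \<Longrightarrow> g - h \<in> vals \<phi> V"
  using vals_add[of g "- h"] vals_uminus by simp

lemma vals_nmul: "g \<in> vals \<phi> V \<Longrightarrow> nmul n g \<in> vals \<phi> V"
  by (rule nmul_add_closed) (auto simp: vals_0 vals_add)

lemma ress_0: "0 \<in> ress \<phi> V R"
  unfolding ress_iff by (intro exI[of _ 0]) simp

lemma ress_mult: "x \<in> ress \<phi> V R \<Longrightarrow> y \<in> ress \<phi> V R \<Longrightarrow> x * y \<in> ress \<phi> V R"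
  unfolding ress_iff using R_mult vge_0_mult by metis

lemma ress_inverse: 
  assumes "x \<in> ress \<phi> V R" "x \<noteq> 0"
  shows "inverse x \<in> ress \<phi> V R"
proof -
  obtain F where F: "vge F 0" "R F = x" using assms ress_iff by blast
  then have VF: "\<not> \<phi> dvd F" "V F = 0" using assms R_eq_0_iff[of F] by (auto simp: vge_def vgt_def)
  obtain b where b: "\<phi> dvd F * b - 1" "V b = - V F" using inverse_small[OF VF(1)] by metis
  have gb: "vge b 0" using b VF by (simp add: vge_def)
  then have "R (F * b) = R 1" using b F by (intro R_cong vge_0_mult)
  then have "x * R b = 1" using R_mult[OF F(1) gb] F by simp
  then have "inverse x = R b" using assms by (simp add: field_simps)
  then show ?thesis unfolding ress_iff using gb by metis
qed

lemma rational_vals: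
  assumes "rational S \<phi> V" "g \<in> vals \<phi> V"
  obtains d where "d \<in> S" "degree d < degree \<phi>" "d \<noteq> 0" "V d = g"
proof -
  obtain a where a: "degree a < degree \<phi>" "a \<noteq> 0" "V a = g" using assms(2) by (auto simp: vals_def)
  then obtain a' where a': "a' \<in> S" "degree a' < degree \<phi>" "a = a' \<or> V a < V (a - a')"
    using assms(1) by (auto simp: rational_def)
  then have "vgt (a - a') (V a)" by (auto simp: vgt_def)
  from V_eq_of_vgt_diff[OF _ this] a a' show ?thesis using that by auto
qed

end

context aug
begin

text \<open>\<open>W\<close> is computed from the digits, so it is enough to approximate each of
  them by an element of \<open>S\<close>.\<close>

lemma rational_approx:
  assumes "mod_closed S" "rational S \<phi> V" "0 < e" "degree a < e * degree \<phi>"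
  obtains a' where "a' \<in> S" "degree a' < e * degree \<phi>" "wgt (a - a') (W a)"
proof -
  have "\<exists>b\<in>S. degree b < degree \<phi> \<and> vgt (cf a k - b) (W a - nmul k \<gamma>)" for k
  proof (cases "cf a k = 0")
    case True
    then show ?thesis using assms(1) deg_pos by (intro bexI[of _ 0]) (auto simp: mod_closed_def)
  next
    case False
    then obtain b where b: "b \<in> S" "degree b < degree \<phi>" "cf a k = b \<or> V (cf a k) < V (cf a k - b)"
      using assms(2) degree_cf[of a k] unfolding rational_def by blast
    have "W a - nmul k \<gamma> \<le> V (cf a k)"
      using wge_W[of a] False by (auto simp: wge_def vge_def dest: spec[of _ k])
    then have "vgt (cf a k - b) (W a - nmul k \<gamma>)" using b by (auto simp: vgt_def)
    then show ?thesis using b by blast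
  qed
  then obtain b where b: "\<And>k. b k \<in> S" "\<And>k. degree (b k) < degree \<phi>"
      "\<And>k. vgt (cf a k - b k) (W a - nmul k \<gamma>)"
    by metis
  let ?a' = "\<Sum>k<e. b k * \<phi> ^ k"
  have "?a' \<in> S" using assms(1,2) b(1)
    by (intro mod_closed_sum) (auto simp: mod_closed_def rational_def mod_closed_power[OF assms(1)])
  moreover have "degree ?a' < e * degree \<phi>"
  proof (rule degree_sum_less)
    fix i assume i: "i \<in> {..<e}"
    have "degree (b i * \<phi> ^ i) \<le> degree (b i) + i * degree \<phi>"
      using degree_mult_le[of "b i" "\<phi> ^ i"] by (simp add: degree_power_monic)
    also have "\<dots> < Suc i * degree \<phi>" using b(2)[of i] by simp
    also have "\<dots> \<le> e * degree \<phi>" using i by (intro mult_le_mono1) simp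
    finally show "degree (b i * \<phi> ^ i) < e * degree \<phi>" .
  qed (use assms(3) deg_pos in simp)
  moreover have "wgt (a - ?a') (W a)"
    unfolding wgt_def
  proof
    fix k
    have "cf ?a' k = (\<Sum>i<e. if i = k then b i else 0)"
      unfolding cf_sum using b(2) by (intro sum.cong refl) (simp add: cf_monom)
    then have "cf (a - ?a') k = (if k < e then cf a k - b k else 0)"
      using cf_eq_0_le[OF assms(4), of k] by (auto simp: cf_diff not_less)
    then show "vgt (cf (a - ?a') k) (W a - nmul k \<gamma>)" using b(3) by auto
  qed
  ultimately show ?thesis using that by blast
qed

lemma rational_next:
  assumes "mod_closed S" "rational S \<phi> V" "0 < e" "degree \<phi>' = e * degree \<phi>" "\<phi>' \<in> S"
  shows "rational S \<phi>' (\<lambda>F. W (F mod \<phi>'))"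
  unfolding rational_def
proof (intro conjI allI impI)
  fix a :: "'m poly" assume a: "degree a < degree \<phi>'" "a \<noteq> 0"
  obtain a' where a': "a' \<in> S" "degree a' < e * degree \<phi>" "wgt (a - a') (W a)"
    using rational_approx[OF assms(1-3)] a assms(4) by metis
  moreover have "degree (a - a') < degree \<phi>'"
    using a a' degree_diff_le_max[of a a'] assms(4) by simp
  ultimately show "\<exists>a'\<in>S. degree a' < degree \<phi>' \<and> (a = a' \<or> W (a mod \<phi>') < W ((a - a') mod \<phi>'))"
    using a assms(4) by (intro bexI[of _ a']) (cases "a = a'"; auto simp: mod_poly_less wgt_iff)+
qed (use assms in simp)

lemma W_le_crit:
  assumes "degree a < e * degree \<phi>" "a \<noteq> 0"
  obtains b k where "degree b < degree \<phi>" "b \<noteq> 0" "k < e" "W a = V b + nmul k \<gamma>"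
proof -
  obtain k where k: "k \<in> crit a (W a)" using crit_nonempty[OF assms(2)] by blast
  then have "k < e" using cf_eq_0_le[OF assms(1), of k] by (force simp: crit_def)
  with k show ?thesis using that[of "cf a k" k] by (auto simp: crit_def)
qed

end

context stage
begin

text \<open>The wanted value \<open>g\<close> may lie below \<beta>. Adjoining \<open>g + h\<close>
  with \<open>h\<close> already a value amounts to adjoining \<open>g\<close>, and \<open>h\<close>
  can be chosen to lift it above \<beta>.\<close>

lemma ramified_step:
  assumes S: "mod_closed S" "rational S \<phi> V"
    and tors: "0 < n" "nmul n g \<in> vals \<phi> V" and h: "h \<in> vals \<phi> V" "\<beta> < g + h"
  obtains \<phi>' V' R' \<beta>' e where "stage \<phi>' V' R' \<beta>'" "rational S \<phi>' V'" "stage_le \<phi> V R \<phi>' V' R'"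
    "g \<in> vals \<phi>' V'" "\<beta>' \<in> vals \<phi> V" "ress \<phi>' V' R' \<subseteq> ress \<phi> V R"
    "\<forall>x\<in>vals \<phi>' V'. \<exists>y\<in>vals \<phi> V. \<exists>k<e. x = y + nmul k g"
proof -
  define \<gamma> where "\<gamma> = g + h"
  interpret aug \<phi> V R \<beta> \<gamma> by unfold_locales (use h in \<open>simp add: \<gamma>_def\<close>)
  have "nmul n \<gamma> \<in> vals \<phi> V" using tors h by (simp add: \<gamma>_def nmul_distrib vals_add vals_nmul)
  then have ex: "\<exists>n. 0 < n \<and> nmul n \<gamma> \<in> vals \<phi> V" using tors by blast
  define e where "e = (LEAST n. 0 < n \<and> nmul n \<gamma> \<in> vals \<phi> V)"
  have e: "0 < e" "nmul e \<gamma> \<in> vals \<phi> V" using LeastI_ex[OF ex] by (auto simp: e_def)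
  have min: "nmul i \<gamma> \<notin> vals \<phi> V" if "0 < i" "i < e" for i
    using that not_less_Least unfolding e_def by blast
  obtain d where d: "d \<in> S" "degree d < degree \<phi>" "d \<noteq> 0" "V d = nmul e \<gamma>"
    using rational_vals[OF S(2) e(2)] .
  have order: "V a \<noteq> nmul i \<gamma>" if "0 < i" "i < e" "degree a < degree \<phi>" "a \<noteq> 0" for i a
    using min[OF that(1,2)] that(3,4) unfolding vals_def by (metis (mono_tags, lifting) imageI mem_Collect_eq)
  note facts = e(1) d(2-4) order
  let ?f = "\<phi> ^ e - d" and ?V = "\<lambda>F. W (F mod (\<phi> ^ e - d))" and ?R = "\<lambda>F. R (cf (F mod (\<phi> ^ e - d)) 0)"
  have deg: "degree ?f = e * degree \<phi>" by (rule degree_ramified[OF facts])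
  have st: "stage ?f ?V ?R (nmul e \<gamma>)" by (rule stage_ramified[OF facts])
  have "\<phi> \<in> S" using S by (simp add: rational_def)
  then have "?f \<in> S" using S(1) d(1) mod_closed_power[OF S(1)] unfolding mod_closed_def by blast
  then have rat: "rational S ?f ?V" using rational_next[OF S e(1) deg] by blast
  have small: "a mod ?f = a" if "degree a < e * degree \<phi>" for a
    using that deg by (simp add: mod_poly_less)
  have le: "stage_le \<phi> V R ?f ?V ?R"
    using e less_mult_degree deg
    by (auto simp: stage_le_def small cf_small W_small)
  \<comment> \<open>For \<open>e = 1\<close> the value \<open>g\<close> was present before the step.
    Otherwise \<open>b * \<phi>\<close> with \<open>V b = - h\<close> has value
    \<gamma>\<open>- h\<close>, and its degree is below \<open>2 * degree \<phi>\<close>, hence it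
    is still reduced.\<close>
  have gv: "g \<in> vals ?f ?V"
  proof (cases "e = 1")
    case True
    then have "\<gamma> - h \<in> vals \<phi> V" using e h by (intro vals_diff) simp_all
    then show ?thesis using stage_le_vals[OF le] by (auto simp: \<gamma>_def)
  next
    case False
    have "- h \<in> vals \<phi> V" using h vals_uminus by simp
    then obtain b where b: "degree b < degree \<phi>" "b \<noteq> 0" "V b = - h" by (auto simp: vals_def)
    have "degree (b * \<phi>) < 2 * degree \<phi>" using b by (simp add: degree_mult_eq)
    also have "\<dots> \<le> e * degree \<phi>" using e False by (intro mult_le_mono1) simp
    finally have "degree (b * \<phi>) < e * degree \<phi>" .
    moreover have "W (b * \<phi>) = g" using W_monom[OF b(1,2), of 1] b by (simp add: \<gamma>_def)
    ultimately show ?thesis unfolding vals_def using b deg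
      by (intro image_eqI[of _ _ "b * \<phi>"]) (auto simp: small)
  qed
  have vals': "\<exists>y\<in>vals \<phi> V. \<exists>k<e. x = y + nmul k g" if "x \<in> vals ?f ?V" for x
  proof -
    obtain a where a: "degree a < e * degree \<phi>" "a \<noteq> 0" "x = W a"
      using \<open>x \<in> _\<close> by (auto simp: vals_def deg small)
    obtain b k where b: "degree b < degree \<phi>" "b \<noteq> 0" "k < e" "W a = V b + nmul k \<gamma>"
      using W_le_crit[OF a(1,2)] .
    have "V b \<in> vals \<phi> V" using b by (auto simp: vals_def)
    then have "V b + nmul k h \<in> vals \<phi> V" using h by (intro vals_add vals_nmul)
    moreover have "x = (V b + nmul k h) + nmul k g" using a b by (simp add: \<gamma>_def nmul_distrib)
    ultimately show ?thesis using b by blast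
  qed
  have ress': "ress ?f ?V ?R \<subseteq> ress \<phi> V R"
  proof
    fix y assume "y \<in> ress ?f ?V ?R"
    then obtain a where a: "degree a < e * degree \<phi>" "a = 0 \<or> 0 \<le> W a" "y = R (cf a 0)"
      by (auto simp: ress_def deg small)
    then have "wge a 0" by (cases "a = 0") (auto simp: wge_iff)
    then show "y \<in> ress \<phi> V R" using a wge_cf_0 ress_iff by blast
  qed
  show ?thesis by (rule that[OF st rat le gv e(2) ress' ballI[OF vals']])
qed

lemma residual_step:
  fixes \<tau> :: 'e
  assumes S: "mod_closed S" "rational S \<phi> V"
    and alg: "p \<noteq> 0" "\<And>k. coeff p k \<in> ress \<phi> V R" "poly p \<tau> = 0"
    and h: "\<gamma> \<in> vals \<phi> V" "\<beta> < \<gamma>"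
  obtains \<phi>' V' R' \<beta>' where "stage \<phi>' V' R' \<beta>'" "rational S \<phi>' V'" "stage_le \<phi> V R \<phi>' V' R'"
    "\<tau> \<in> ress \<phi>' V' R'" "\<beta>' = nmul (degree \<phi>' div degree \<phi>) \<gamma>" "vals \<phi>' V' \<subseteq> vals \<phi> V"
    "\<forall>x\<in>ress \<phi>' V' R'. \<exists>q. (\<forall>k. coeff q k \<in> ress \<phi> V R) \<and> x = poly q \<tau>"
proof -
  interpret aug \<phi> V R \<beta> \<gamma> by unfold_locales (use h in simp)
  let ?A = "\<lambda>p. p \<noteq> 0 \<and> (\<forall>k. coeff p k \<in> ress \<phi> V R) \<and> poly p \<tau> = 0"
  \<comment> \<open>A polynomial of least degree vanishing at \<tau> over the current residue field;
    division by its leading coefficient gives the monic coefficients \<open>s i\<close>.\<close>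
  obtain q where q: "?A q" and qmin: "\<And>p. ?A p \<Longrightarrow> degree q \<le> degree p"
    using ex_has_least_nat[of ?A p degree] alg by auto
  define e where "e = degree q"
  define s where "s i = coeff q i / lead_coeff q" for i
  have e: "0 < e"
  proof (rule ccontr)
    assume "\<not> 0 < e"
    then have "degree q = 0" by (simp add: e_def)
    then obtain c where "q = [:c:]" by (rule degree_eq_zeroE)
    then show False using q by auto
  qed
  have s_res: "s i \<in> ress \<phi> V R" for i
    unfolding s_def divide_inverse using q by (intro ress_mult ress_inverse) auto
  have "poly q \<tau> = (\<Sum>i\<le>e. coeff q i * \<tau> ^ i)" unfolding e_def by (rule poly_altdef)
  also have "\<dots> = (\<Sum>i<e. coeff q i * \<tau> ^ i) + lead_coeff q * \<tau> ^ e"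
    by (simp add: e_def flip: lessThan_Suc_atMost)
  finally have root: "\<tau> ^ e + (\<Sum>i<e. s i * \<tau> ^ i) = 0"
  proof -
    assume "poly q \<tau> = (\<Sum>i<e. coeff q i * \<tau> ^ i) + lead_coeff q * \<tau> ^ e"
    moreover have "(\<Sum>i<e. s i * \<tau> ^ i) = (\<Sum>i<e. coeff q i * \<tau> ^ i) / lead_coeff q"
      unfolding sum_divide_distrib s_def by (intro sum.cong refl) simp
    ultimately have "lead_coeff q * (\<tau> ^ e + (\<Sum>i<e. s i * \<tau> ^ i)) = 0"
      using q by (simp add: distrib_left add.commute)
    then show ?thesis using q by simp
  qed
  have minimal: "poly p \<tau> \<noteq> 0" if "p \<noteq> 0" "degree p < e" "\<And>k. coeff p k \<in> R ` {a. vge a 0}" for p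
    using qmin[of p] that by (auto simp: e_def ress_eq)
  obtain d where d: "d \<in> S" "degree d < degree \<phi>" "d \<noteq> 0" "V d = \<gamma>"
    using rational_vals[OF S(2) h(1)] .
  then have nd: "\<not> \<phi> dvd d" by simp
  obtain d' where d': "degree d' < degree \<phi>" "d' \<noteq> 0" "\<phi> dvd d * d' - 1" "V d' = - \<gamma>"
    using inverse_small[OF nd] d by metis
  have dd: "vge (d * d') 0" "R (d * d') = 1"
  proof -
    show ge: "vge (d * d') 0" using d d' by (simp add: vge_def V_mult)
    show "R (d * d') = 1" using R_cong[OF ge d'(3)] by simp
  qed
  \<comment> \<open>Take \<open>a\<close> with residue \<open>s i\<close>, multiply by
    \<open>d ^ j\<close>, reduce modulo \<phi>, and replace the result by an element
    \<open>c\<close> of \<open>S\<close> with the same initial form. Multiplying by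
    \<open>d' ^ j\<close> brings the error to positive value, so the residue is still
    \<open>s i\<close>.\<close>
  have ex_c: "\<exists>c\<in>S. degree c < degree \<phi> \<and> vge (c * d' ^ j) 0 \<and> R (c * d' ^ j) = s i" for i j
  proof (cases "s i = 0")
    case True
    then show ?thesis using S deg_pos by (intro bexI[of _ 0]) (auto simp: mod_closed_def)
  next
    case False
    obtain a where a: "vge a 0" "R a = s i" using s_res ress_iff by metis
    then have Va: "\<not> \<phi> dvd a" "V a = 0" using False R_eq_0_iff[of a] by (auto simp: vge_def vgt_def)
    let ?b = "a * d ^ j mod \<phi>"
    have nb: "\<not> \<phi> dvd a * d ^ j" using Va nd by (simp add: N_mult N_power)
    then have b0: "?b \<noteq> 0" by (simp add: mod_eq_0_iff_dvd)
    obtain c where c: "c \<in> S" "degree c < degree \<phi>" "?b = c \<or> V ?b < V (?b - c)"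
      using S(2) b0 unfolding rational_def by (metis degree_mod_phi)
    have gt: "vgt (?b - c) (V ?b)" using c by (auto simp: vgt_def)
    have Vb: "V ?b = nmul j \<gamma>" using Va nd d by (simp add: V_mult N_power V_power)
    have "vgt ((?b - c) * d' ^ j) (nmul j \<gamma> + nmul j (- \<gamma>))"
      using gt d' unfolding Vb by (intro vgt_mult2) (simp_all add: vge_def N_power V_power)
    then have 1: "vgt (?b * d' ^ j - c * d' ^ j) 0"
      by (simp add: nmul_uminus left_diff_distrib)
    have pow: "vge ((d * d') ^ j) 0" by (rule vge_0_power[OF dd(1)])
    have ge: "vge (a * (d * d') ^ j) 0" by (rule vge_0_mult[OF a(1) pow])
    have "\<phi> dvd a * d ^ j * d' ^ j - ?b * d' ^ j"
      by (simp add: mod_eq_dvd_iff[symmetric] mod_mult_left_eq)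
    then have 2: "\<phi> dvd a * (d * d') ^ j - ?b * d' ^ j" by (simp add: power_mult_distrib mult.assoc)
    then have ge2: "vge (?b * d' ^ j) 0" using ge vge_cong by blast
    have "R (a * (d * d') ^ j) = s i" using R_mult[OF a(1) pow] R_power[OF dd(1), of j] a dd by simp
    then have "R (?b * d' ^ j) = s i" using R_cong[OF ge 2] by simp
    then have "R (c * d' ^ j) = s i" using R_eqI[OF ge2 1] by simp
    moreover have "vge (c * d' ^ j) 0" using vge_diff[OF ge2 vgt_imp_vge[OF 1]] by simp
    ultimately show ?thesis using c by blast
  qed
  define cc where "cc i j = (SOME c. c \<in> S \<and> degree c < degree \<phi> \<and> vge (c * d' ^ j) 0 \<and>
    R (c * d' ^ j) = s i)" for i j
  have cc: "cc i j \<in> S" "degree (cc i j) < degree \<phi>" "vge (cc i j * d' ^ j) 0" "R (cc i j * d' ^ j) = s i"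
    for i j using someI_ex[OF ex_c[of j i, unfolded Bex_def]] unfolding cc_def by blast+
  define c where "c i = cc i (e - i)" for i
  have root': "\<tau> ^ e + (\<Sum>i<e. R (c i * d' ^ (e - i)) * \<tau> ^ i) = 0"
    using root cc(4) by (simp add: c_def)
  have c: "degree (c i) < degree \<phi>" "vge (c i * d' ^ (e - i)) 0" for i
    using cc by (simp_all add: c_def)
  note facts = d(2-4) d' e c root' minimal
  let ?f = "\<phi> ^ e + (\<Sum>i<e. c i * \<phi> ^ i)"
  let ?V = "\<lambda>F. W (F mod ?f)" and ?R = "\<lambda>F. poly (T d (F mod ?f)) \<tau>"
  have deg: "degree ?f = e * degree \<phi>"
    by (rule degree_residual[OF facts])
  have st: "stage ?f ?V ?R (nmul e \<gamma>)"
    by (rule stage_residual[OF facts])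
  have "\<phi> \<in> S" using S by (simp add: rational_def)
  moreover have "(\<Sum>i<e. c i * \<phi> ^ i) \<in> S"
    using S calculation cc(1) unfolding c_def
    by (intro mod_closed_sum) (auto simp: mod_closed_def mod_closed_power[OF S(1)])
  ultimately have "?f \<in> S" using S(1) mod_closed_power[OF S(1)] unfolding mod_closed_def by blast
  then have rat: "rational S ?f ?V" using rational_next[OF S e deg] by blast
  have small: "a mod ?f = a" if "degree a < e * degree \<phi>" for a
    using that deg by (simp add: mod_poly_less)
  have le: "stage_le \<phi> V R ?f ?V ?R"
    using e less_mult_degree deg T_small[OF d(2-4)]
    by (auto simp: stage_le_def small W_small)
  have vals': "vals ?f ?V \<subseteq> vals \<phi> V"
  proof
    fix x assume "x \<in> vals ?f ?V"
    then obtain a where a: "degree a < e * degree \<phi>" "a \<noteq> 0" "x = W a"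
      by (auto simp: vals_def deg small)
    obtain b k where b: "degree b < degree \<phi>" "b \<noteq> 0" "k < e" "W a = V b + nmul k \<gamma>"
      using W_le_crit[OF a(1,2)] .
    have "V b \<in> vals \<phi> V" using b by (auto simp: vals_def)
    then show "x \<in> vals \<phi> V" using a b h by (simp add: vals_add vals_nmul)
  qed
  have ress': "\<exists>q. (\<forall>k. coeff q k \<in> ress \<phi> V R) \<and> x = poly q \<tau>" if x: "x \<in> ress ?f ?V ?R" for x
  proof -
    obtain a where a: "degree a < e * degree \<phi>" "a = 0 \<or> 0 \<le> W a" "x = poly (T d a) \<tau>"
      using x by (auto simp: ress_def deg small)
    then have "wge a 0" by (cases "a = 0") (auto simp: wge_iff)
    then have "coeff (T d a) k \<in> ress \<phi> V R" for k
      unfolding ress_iff coeff_T[OF d(2-4)] using vge_cf_d[OF d(2-4)] by blast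
    then show ?thesis using a by blast
  qed
  \<comment> \<open>The class of \<open>d' * \<phi>\<close> has residue \<tau>, since the residue
    map of the new stage puts \<tau> for the indeterminate. For \<open>e = 1\<close> this product
    need not be reduced, but the multiple of \<open>?f\<close> that is split off vanishes at
    \<tau>.\<close>
  have tau: "\<tau> \<in> ress ?f ?V ?R"
  proof -
    interpret st: stage ?f ?V ?R "nmul e \<gamma>" by (rule st)
    interpret T: pvres "\<lambda>F. F = 0" W "T d" by (rule pvres_T[OF d(2-4)])
    have ge: "wge (d' * \<phi>) 0" by (rule T_d'_phi(2)[OF facts])
    have T: "T d (d' * \<phi>) = Polynomial.monom 1 1" by (rule T_d'_phi(1)[OF facts])
    have key: "key ?f" by (rule key_residual[OF facts])
    let ?q = "d' * \<phi> div ?f * ?f" and ?r = "d' * \<phi> mod ?f"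
    have ge2: "wge ?q 0" "wge ?r 0" using key_mod[OF key ge] by blast+
    have "T d (d' * \<phi>) = T d (?q + ?r)" by (simp only: div_mult_mod_eq)
    have zero: "poly (T d ?q) \<tau> = 0" by (rule T_multiple[OF facts ge2(1)])
    note \<open>T d (d' * \<phi>) = T d (?q + ?r)\<close>
    also have "T d (?q + ?r) = T d ?q + T d ?r" using ge2 by (intro T.R_add) (auto simp only: W_vge)
    finally have eq: "poly (Polynomial.monom 1 1) \<tau> = poly (T d ?q) \<tau> + poly (T d ?r) \<tau>"
      by (simp only: T poly_add)
    have "poly (T d ?r) \<tau> = poly (Polynomial.monom 1 1) \<tau>"
      unfolding eq zero by (simp only: add_0_left)
    also have "\<dots> = \<tau>" by (simp only: poly_monom power_one_right mult_1_left)
    finally have 1: "poly (T d ?r) \<tau> = \<tau>" .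
    have 2: "st.vge (d' * \<phi>) 0"
    proof (cases "?r = 0")
      case True
      then show ?thesis by (simp only: st.vge_def mod_eq_0_iff_dvd simp_thms)
    next
      case False
      then show ?thesis using ge2(2) unfolding st.vge_def by (simp only: wge_iff simp_thms)
    qed
    from 2 1 show ?thesis unfolding st.ress_iff by (intro exI[of _ "d' * \<phi>"] conjI)
  qed
  \<comment> \<open>Degrees express \<open>e\<close> in the conclusion. For
    \<open>\<gamma> = 0\<close> this yields the new constant 0 that the trivially valued case relies
    on.\<close>
  have e_eq: "nmul e \<gamma> = nmul (degree ?f div degree \<phi>) \<gamma>"
    using deg deg_pos by simp
  show ?thesis by (rule that[OF st rat le tau e_eq vals' ballI[OF ress']])
qed

end

section \<open>Towers of stages\<close>

lemma pX_dvd: "[:0, 1:] dvd F \<longleftrightarrow> poly F 0 = (0::'m::field)"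
  using poly_eq_0_iff_dvd[of F 0] by simp

text \<open>The base field as the quotient modulo the indeterminate. Products of constants have
  quotient 0, so the condition on \<beta> is vacuous and \<beta> is arbitrary, in particular
  possibly negative.\<close>

lemma stage_0:
  assumes "pvres (\<lambda>a. a = 0) u r"
  shows "stage [:0, 1:] (\<lambda>F. u (poly F 0)) (\<lambda>F. r (poly F 0)) \<beta>"
proof -
  interpret b: pvres "\<lambda>a. a = 0" u r by fact
  interpret pval "\<lambda>F. [:0, 1:] dvd F" "\<lambda>F. u (poly F 0)"
    by unfold_locales (auto simp: pX_dvd b.V_mult intro: b.V_add)
  have vge: "vge F g \<longleftrightarrow> b.vge (poly F 0) g" "vgt F g \<longleftrightarrow> b.vgt (poly F 0) g" for F g
    unfolding vge_def vgt_def b.vge_def b.vgt_def by (simp_all only: pX_dvd)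
  show ?thesis
  proof
    fix a b :: "'a poly"
    assume "degree a < degree [:0, 1::'a:]" "degree b < degree [:0, 1::'a:]" "a * b div [:0, 1:] \<noteq> 0"
    moreover from this have "degree (a * b) < degree [:0, 1::'a:]"
      using degree_mult_le[of a b] by simp
    ultimately show "u (poly a 0) + u (poly b 0) \<le> u (poly (a * b div [:0, 1:]) 0) + \<beta>"
      using div_poly_less by blast
  qed (auto simp: vge b.R_add b.R_mult b.R_eq_0_iff)
qed

definition ring_closed :: "'e::ring_1 set \<Rightarrow> bool" where
  "ring_closed E \<longleftrightarrow> (\<forall>x\<in>E. \<forall>y\<in>E. x + y \<in> E \<and> x * y \<in> E)"

lemma ring_closed_poly:
  assumes "ring_closed E" "1 \<in> E" "0 \<in> E" "\<And>k. coeff q k \<in> E" "\<tau> \<in> E"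
  shows "poly q \<tau> \<in> E"
proof -
  have "\<tau> ^ k \<in> E" for k using assms by (induction k) (auto simp: ring_closed_def)
  then have "coeff q k * \<tau> ^ k \<in> E" for k using assms by (auto simp: ring_closed_def)
  moreover have "(\<Sum>k\<in>A. coeff q k * \<tau> ^ k) \<in> E" if "finite A" for A
    using that by (induction A) (use calculation assms in \<open>auto simp: ring_closed_def\<close>)
  ultimately show ?thesis by (simp add: poly_altdef)
qed

text \<open>The base field is either \<open>K\<close> with \<open>S\<close> everything, or an
  immediate extension of \<open>K\<close> with \<open>S\<close> the image of \<open>K[x]\<close>.
  The target value group is a set \<Gamma> because in one application it is the proper subgroup
  \<open>\<Gamma>\<^sub>0\<close> of the ordered group used; the target residue field is the whole
  type.\<close>

locale tower = base: pvres "\<lambda>a. a = 0" u r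
  for u :: "'m::field \<Rightarrow> 'g::linordered_ab_group_add" and r :: "'m \<Rightarrow> 'e::field" +
  fixes S :: "'m poly set" and \<Gamma> :: "'g set"
  assumes S: "mod_closed S" "[:0, 1:] \<in> S"
    and dense: "\<And>a. a \<noteq> 0 \<Longrightarrow> \<exists>a'. [:a':] \<in> S \<and> (a = a' \<or> u a < u (a - a'))"
    and G_add: "\<And>g h. g \<in> \<Gamma> \<Longrightarrow> h \<in> \<Gamma> \<Longrightarrow> g + h \<in> \<Gamma>"
    and G_u: "\<And>a. a \<noteq> 0 \<Longrightarrow> u a \<in> \<Gamma>"
    and torsion: "\<And>g. g \<in> \<Gamma> \<Longrightarrow> \<exists>n>0. \<exists>c\<noteq>0. nmul n g = u c"
    and algebraic: "\<And>y. \<exists>p. p \<noteq> 0 \<and> (\<forall>k. coeff p k \<in> r ` {a. base.vge a 0}) \<and> poly p y = 0"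
begin

definition V0 :: "'m poly \<Rightarrow> 'g" where "V0 F = u (poly F 0)"
definition R0 :: "'m poly \<Rightarrow> 'e" where "R0 F = r (poly F 0)"

definition "kv = r ` {a. base.vge a 0}"

text \<open>The last two conjuncts say that a stage is finite over the base: finitely many cosets of
  values, and finitely many ring generators for the residues. They turn infiniteness of the target
  into the impossibility of stopping.\<close>

definition good :: "'m poly \<Rightarrow> ('m poly \<Rightarrow> 'g) \<Rightarrow> ('m poly \<Rightarrow> 'e) \<Rightarrow> 'g \<Rightarrow> bool" where
  "good \<phi> V R \<beta> \<longleftrightarrow> stage \<phi> V R \<beta> \<and> rational S \<phi> V \<and> vals \<phi> V \<subseteq> \<Gamma> \<and>
     stage_le [:0, 1:] V0 R0 \<phi> V R \<and>
     (\<exists>A. finite A \<and> (\<forall>g\<in>vals \<phi> V. \<exists>c a. c \<noteq> 0 \<and> a \<in> A \<and> g = u c + a)) \<and>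
     (\<exists>B. finite B \<and> (\<forall>E. kv \<subseteq> E \<longrightarrow> B \<subseteq> E \<longrightarrow> ring_closed E \<longrightarrow> ress \<phi> V R \<subseteq> E))"

lemma vals_0: "vals [:0, 1:] V0 = u ` (- {0})"
proof -
  have "{a. degree a < degree [:0, 1::'m:] \<and> a \<noteq> 0} = (\<lambda>c. [:c:]) ` (- {0})"
    by (auto elim: degree_eq_zeroE)
  from arg_cong[OF this, of "\<lambda>A. V0 ` A"] show ?thesis
    unfolding vals_def image_image by (simp add: V0_def)
qed

lemma ress_0: "ress [:0, 1:] V0 R0 = kv"
proof -
  have "{a. degree a < degree [:0, 1::'m:] \<and> (a = 0 \<or> 0 \<le> V0 a)} = (\<lambda>c. [:c:]) ` {a. base.vge a 0}"
    by (auto simp: V0_def base.vge_def elim: degree_eq_zeroE)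
  from arg_cong[OF this, of "\<lambda>A. R0 ` A"] show ?thesis
    unfolding ress_def kv_def image_image by (simp add: R0_def)
qed

lemma good_0: "good [:0, 1:] V0 R0 \<beta>"
  unfolding good_def
proof (intro conjI)
  show "stage [:0, 1:] V0 R0 \<beta>"
    unfolding V0_def[abs_def] R0_def[abs_def] by (rule stage_0) (rule base.pvres_axioms)
  show "rational S [:0, 1:] V0"
    unfolding rational_def
  proof (intro conjI allI impI)
    fix a :: "'m poly" assume a: "degree a < degree [:0, 1::'m:]" "a \<noteq> 0"
    then have "degree a = 0" by simp
    then obtain c where c: "a = [:c:]" by (rule degree_eq_zeroE)
    then obtain c' where c': "[:c':] \<in> S" "c = c' \<or> u c < u (c - c')" using dense[of c] a by auto
    then show "\<exists>a'\<in>S. degree a' < degree [:0, 1::'m:] \<and> (a = a' \<or> V0 a < V0 (a - a'))"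
      by (intro bexI[of _ "[:c':]"]) (auto simp: V0_def c)
  qed (rule S)
  show "vals [:0, 1:] V0 \<subseteq> \<Gamma>" using G_u by (auto simp: vals_0)
  show "stage_le [:0, 1:] V0 R0 [:0, 1:] V0 R0" by (rule stage_le_refl)
  show "\<exists>A. finite A \<and> (\<forall>g\<in>vals [:0, 1:] V0. \<exists>c a. c \<noteq> 0 \<and> a \<in> A \<and> g = u c + a)"
    by (intro exI[of _ "{0}"]) (auto simp: vals_0)
  show "\<exists>B. finite B \<and> (\<forall>E. kv \<subseteq> E \<longrightarrow> B \<subseteq> E \<longrightarrow> ring_closed E \<longrightarrow> ress [:0, 1:] V0 R0 \<subseteq> E)"
    by (intro exI[of _ "{}"]) (auto simp: ress_0)
qed

lemma good_base:
  assumes "good \<phi> V R \<beta>"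
  shows "stage \<phi> V R \<beta>" "c \<noteq> 0 \<Longrightarrow> V [:c:] = u c" "R [:c:] = r c" "c \<noteq> 0 \<Longrightarrow> u c \<in> vals \<phi> V"
    "kv \<subseteq> ress \<phi> V R"
proof -
  have le: "stage_le [:0, 1:] V0 R0 \<phi> V R" using assms by (simp add: good_def)
  show "stage \<phi> V R \<beta>" using assms by (simp add: good_def)
  show "c \<noteq> 0 \<Longrightarrow> V [:c:] = u c" "R [:c:] = r c"
    using le by (auto simp: stage_le_def V0_def R0_def)
  show "c \<noteq> 0 \<Longrightarrow> u c \<in> vals \<phi> V" using stage_le_vals[OF le] by (auto simp: vals_0)
  show "kv \<subseteq> ress \<phi> V R" using stage_le_ress[OF le] by (simp add: ress_0)
qed

lemma good_vals:
  assumes "good \<phi> V R \<beta>"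
  obtains A where "finite A" "\<forall>g\<in>vals \<phi> V. \<exists>c a. c \<noteq> 0 \<and> a \<in> A \<and> g = u c + a"
proof -
  have "\<exists>A. finite A \<and> (\<forall>g\<in>vals \<phi> V. \<exists>c a. c \<noteq> 0 \<and> a \<in> A \<and> g = u c + a)"
    using assms by (simp only: good_def)
  then show ?thesis using that by (elim exE conjE)
qed

lemma good_ress:
  assumes "good \<phi> V R \<beta>"
  obtains B where "finite B" "\<And>E. kv \<subseteq> E \<Longrightarrow> B \<subseteq> E \<Longrightarrow> ring_closed E \<Longrightarrow> ress \<phi> V R \<subseteq> E"
proof -
  have "\<exists>B. finite B \<and> (\<forall>E. kv \<subseteq> E \<longrightarrow> B \<subseteq> E \<longrightarrow> ring_closed E \<longrightarrow> ress \<phi> V R \<subseteq> E)"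
    using assms by (simp only: good_def)
  then obtain B where B: "finite B" "\<forall>E. kv \<subseteq> E \<longrightarrow> B \<subseteq> E \<longrightarrow> ring_closed E \<longrightarrow> ress \<phi> V R \<subseteq> E"
    by (elim exE conjE)
  show ?thesis by (rule that[OF B(1)]) (simp add: B(2))
qed

lemma good_ramified:
  assumes good: "good \<phi> V R \<beta>" and g: "g \<in> \<Gamma>" and h: "h \<in> vals \<phi> V" "\<beta> < g + h"
  obtains \<phi>' V' R' \<beta>' where "good \<phi>' V' R' \<beta>'" "stage_le \<phi> V R \<phi>' V' R'" "g \<in> vals \<phi>' V'"
    "\<beta>' \<in> \<Gamma>"
proof -
  interpret stage \<phi> V R \<beta> using good by (simp add: good_def)
  obtain n c where n: "0 < n" "c \<noteq> 0" "nmul n g = u c" using torsion[OF g] by blast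
  then have ng: "nmul n g \<in> vals \<phi> V" using good_base(4)[OF good] by simp
  have rat: "rational S \<phi> V" using good by (simp add: good_def)
  have sub: "vals \<phi> V \<subseteq> \<Gamma>" using good by (simp add: good_def)
  obtain \<phi>' V' R' \<beta>' e where st: "stage \<phi>' V' R' \<beta>'" "rational S \<phi>' V'" "stage_le \<phi> V R \<phi>' V' R'"
    "g \<in> vals \<phi>' V'" "\<beta>' \<in> vals \<phi> V" "ress \<phi>' V' R' \<subseteq> ress \<phi> V R"
    and v: "\<forall>x\<in>vals \<phi>' V'. \<exists>y\<in>vals \<phi> V. \<exists>k<e. x = y + nmul k g"
    by (rule ramified_step[OF S(1) rat n(1) ng h])
  have G0: "0 \<in> \<Gamma>" using sub vals_0 by auto
  have "vals \<phi>' V' \<subseteq> \<Gamma>"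
  proof
    fix x assume "x \<in> vals \<phi>' V'"
    then obtain y k where "y \<in> vals \<phi> V" "x = y + nmul k g" using v by blast
    moreover have "nmul k g \<in> \<Gamma>" by (rule nmul_add_closed[OF G0 G_add g])
    ultimately show "x \<in> \<Gamma>" using sub G_add[of y "nmul k g"] by blast
  qed
  moreover obtain A where A: "finite A" "\<forall>g\<in>vals \<phi> V. \<exists>c a. c \<noteq> 0 \<and> a \<in> A \<and> g = u c + a"
    by (rule good_vals[OF good])
  have "\<exists>A. finite A \<and> (\<forall>g\<in>vals \<phi>' V'. \<exists>c a. c \<noteq> 0 \<and> a \<in> A \<and> g = u c + a)"
  proof (intro exI[of _ "(\<lambda>(a, k). a + nmul k g) ` (A \<times> {..<e})"] conjI ballI)
    fix x assume "x \<in> vals \<phi>' V'"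
    then obtain y k where y: "y \<in> vals \<phi> V" "k < e" "x = y + nmul k g" using v by blast
    then obtain c a where "c \<noteq> 0" "a \<in> A" "y = u c + a" using A by blast
    then show "\<exists>c a. c \<noteq> 0 \<and> a \<in> (\<lambda>(a, k). a + nmul k g) ` (A \<times> {..<e}) \<and> x = u c + a"
      using y by (intro exI[of _ c] exI[of _ "a + nmul k g"]) (auto simp: add.assoc)
  qed (use A in simp)
  moreover have "\<exists>B. finite B \<and> (\<forall>E. kv \<subseteq> E \<longrightarrow> B \<subseteq> E \<longrightarrow> ring_closed E \<longrightarrow> ress \<phi>' V' R' \<subseteq> E)"
  proof -
    obtain B where B: "finite B" "\<And>E. kv \<subseteq> E \<Longrightarrow> B \<subseteq> E \<Longrightarrow> ring_closed E \<Longrightarrow> ress \<phi> V R \<subseteq> E"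
      using good_ress[OF good] by metis
    show ?thesis
      by (intro exI[of _ B] conjI allI impI subset_trans[OF st(6)] B)
  qed
  moreover have "stage_le [:0, 1:] V0 R0 \<phi>' V' R'"
    by (rule stage_le_trans[OF _ st(3)]) (use good in \<open>simp add: good_def\<close>)
  ultimately have "good \<phi>' V' R' \<beta>'" using st(1,2) unfolding good_def by simp
  moreover have "\<beta>' \<in> \<Gamma>" using st(5) sub by blast
  ultimately show ?thesis using that[OF _ st(3,4)] by simp
qed

lemma good_residual:
  assumes good: "good \<phi> V R \<beta>" and h: "\<gamma> \<in> vals \<phi> V" "\<beta> < \<gamma>"
  obtains \<phi>' V' R' \<beta>' where "good \<phi>' V' R' \<beta>'" "stage_le \<phi> V R \<phi>' V' R'" "\<tau> \<in> ress \<phi>' V' R'"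
    "\<beta>' = nmul (degree \<phi>' div degree \<phi>) \<gamma>" "\<beta>' \<in> \<Gamma>"
proof -
  interpret stage \<phi> V R \<beta> using good by (simp add: good_def)
  obtain p where p: "p \<noteq> 0" "\<And>k. coeff p k \<in> ress \<phi> V R" "poly p \<tau> = 0"
    using algebraic[of \<tau>] good_base(5)[OF good] unfolding kv_def by blast
  have rat: "rational S \<phi> V" using good by (simp add: good_def)
  have sub: "vals \<phi> V \<subseteq> \<Gamma>" using good by (simp add: good_def)
  obtain \<phi>' V' R' \<beta>' where st: "stage \<phi>' V' R' \<beta>'" "rational S \<phi>' V'" "stage_le \<phi> V R \<phi>' V' R'"
    "\<tau> \<in> ress \<phi>' V' R'" "\<beta>' = nmul (degree \<phi>' div degree \<phi>) \<gamma>" "vals \<phi>' V' \<subseteq> vals \<phi> V"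
    and v: "\<forall>x\<in>ress \<phi>' V' R'. \<exists>q. (\<forall>k. coeff q k \<in> ress \<phi> V R) \<and> x = poly q \<tau>"
    by (rule residual_step[OF S(1) rat p h])
  obtain B where B: "finite B" "\<And>E. kv \<subseteq> E \<Longrightarrow> B \<subseteq> E \<Longrightarrow> ring_closed E \<Longrightarrow> ress \<phi> V R \<subseteq> E"
    using good_ress[OF good] by metis
  have "\<exists>B. finite B \<and> (\<forall>E. kv \<subseteq> E \<longrightarrow> B \<subseteq> E \<longrightarrow> ring_closed E \<longrightarrow> ress \<phi>' V' R' \<subseteq> E)"
  proof (intro exI[of _ "insert \<tau> B"] conjI allI impI subsetI)
    fix E x assume E: "kv \<subseteq> E" "insert \<tau> B \<subseteq> E" "ring_closed E" and "x \<in> ress \<phi>' V' R'"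
    then obtain q where q: "\<And>k. coeff q k \<in> ress \<phi> V R" "x = poly q \<tau>" using v by blast
    have "ress \<phi> V R \<subseteq> E" using B(2) E by blast
    moreover have "0 \<in> E" "1 \<in> E"
    proof -
      have "r 0 \<in> kv" "r 1 \<in> kv" unfolding kv_def by (rule imageI, simp add: base.vge_def)+
      then show "0 \<in> E" "1 \<in> E" using E(1) by auto
    qed
    ultimately show "x \<in> E" unfolding q(2) using q(1) E by (intro ring_closed_poly) auto
  qed (use B in simp)
  moreover have "stage_le [:0, 1:] V0 R0 \<phi>' V' R'"
    by (rule stage_le_trans[OF _ st(3)]) (use good in \<open>simp add: good_def\<close>)
  moreover have "\<exists>A. finite A \<and> (\<forall>g\<in>vals \<phi>' V'. \<exists>c a. c \<noteq> 0 \<and> a \<in> A \<and> g = u c + a)"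
  proof -
    obtain A where "finite A" "\<forall>g\<in>vals \<phi> V. \<exists>c a. c \<noteq> 0 \<and> a \<in> A \<and> g = u c + a"
      by (rule good_vals[OF good])
    then show ?thesis using st(6) by (intro exI[of _ A]) blast
  qed
  moreover have "vals \<phi>' V' \<subseteq> \<Gamma>" using st(6) sub by (rule subset_trans)
  ultimately have "good \<phi>' V' R' \<beta>'" using st(1,2) unfolding good_def by simp
  moreover have "\<beta>' \<in> \<Gamma>" using st(5) h(1) sub vals_nmul by blast
  ultimately show ?thesis using that[OF _ st(3,4,5)] by simp
qed

end

text \<open>\<open>cofinal\<close> is what a trivial valuation lacks. As long as \<beta> stays in
  \<Gamma>, which \<open>gd\<close> records, some value of the base exceeds it and a further step is
  possible.\<close>

locale nontrivial_tower = tower +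
  assumes cofinal: "\<And>g. g \<in> \<Gamma> \<Longrightarrow> \<exists>c\<noteq>0. g < u c"
begin

definition gd :: "'a poly \<Rightarrow> ('a poly \<Rightarrow> 'b) \<Rightarrow> ('a poly \<Rightarrow> 'c) \<Rightarrow> 'b \<Rightarrow> bool" where
  "gd \<phi> V R \<beta> \<longleftrightarrow> good \<phi> V R \<beta> \<and> \<beta> \<in> \<Gamma>"

text \<open>From \<open>nmul n g = u c\<close> one gets \<open>- g\<close> as
  \<open>nmul (n - 1) g\<close> plus the value of \<open>1 / c\<close>.\<close>

lemma G_uminus:
  assumes "g \<in> \<Gamma>"
  shows "- g \<in> \<Gamma>"
proof -
  obtain n c where n: "0 < n" "c \<noteq> 0" "nmul n g = u c" using torsion[OF assms] by blast
  then obtain m where m: "n = Suc m" by (cases n) auto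
  have "u (1 / c) = - u c" using base.V_mult[of c "1 / c"] n by (simp add: eq_neg_iff_add_eq_0 add.commute)
  then have "- g = nmul m g + u (1 / c)" using n m by (simp add: algebra_simps)
  moreover have "nmul m g \<in> \<Gamma>" using G_u[of 1] assms by (intro nmul_add_closed G_add) auto
  ultimately show ?thesis using G_add G_u[of "1 / c"] n by simp
qed

lemma gd_0: "gd [:0, 1:] V0 R0 0"
  using good_0 G_u[of 1] by (simp add: gd_def)

lemma gd_step:
  assumes "gd \<phi> V R \<beta>" "g \<in> \<Gamma>"
  obtains \<phi>' V' R' \<beta>' where "gd \<phi>' V' R' \<beta>'" "stage_le \<phi> V R \<phi>' V' R'" "g \<in> vals \<phi>' V'" "y \<in> ress \<phi>' V' R'"
proof -
  have g: "good \<phi> V R \<beta>" "\<beta> \<in> \<Gamma>" using assms by (auto simp: gd_def)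
  have "\<beta> + - g \<in> \<Gamma>" using g assms by (intro G_add G_uminus)
  then obtain c where c: "c \<noteq> 0" "\<beta> + - g < u c" using cofinal by blast
  then have "\<beta> < g + u c" by (simp add: algebra_simps)
  then obtain \<phi>1 V1 R1 \<beta>1 where 1: "good \<phi>1 V1 R1 \<beta>1" "stage_le \<phi> V R \<phi>1 V1 R1" "g \<in> vals \<phi>1 V1" "\<beta>1 \<in> \<Gamma>"
    by (rule good_ramified[OF g(1) assms(2) good_base(4)[OF g(1) c(1)]])
  obtain c where c: "c \<noteq> 0" "\<beta>1 < u c" using cofinal[OF 1(4)] by blast
  obtain \<phi>2 V2 R2 \<beta>2 where 2: "good \<phi>2 V2 R2 \<beta>2" "stage_le \<phi>1 V1 R1 \<phi>2 V2 R2" "y \<in> ress \<phi>2 V2 R2"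
      "\<beta>2 = nmul (degree \<phi>2 div degree \<phi>1) (u c)" "\<beta>2 \<in> \<Gamma>"
    by (rule good_residual[OF 1(1) good_base(4)[OF 1(1) c(1)] c(2)])
  show ?thesis
  proof (rule that)
    show "gd \<phi>2 V2 R2 \<beta>2" using 2 by (simp add: gd_def)
    show "stage_le \<phi> V R \<phi>2 V2 R2" by (rule stage_le_trans[OF 1(2) 2(2)])
    show "g \<in> vals \<phi>2 V2" using 1(3) stage_le_vals[OF 2(2)] by blast
  qed (rule 2)
qed

lemma gd_finite:
  assumes "finite A" "A \<subseteq> \<Gamma>" "finite B"
  shows "\<exists>\<phi> V R \<beta>. gd \<phi> V R \<beta> \<and> A \<subseteq> vals \<phi> V \<and> B \<subseteq> ress \<phi> V R"
proof -
  have "\<exists>\<phi> V R \<beta>. gd \<phi> V R \<beta> \<and> A \<subseteq> vals \<phi> V"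
    using assms(1,2)
  proof (induction A)
    case empty
    then show ?case using gd_0 by blast
  next
    case (insert g A)
    then obtain \<phi> V R \<beta> where 1: "gd \<phi> V R \<beta>" "A \<subseteq> vals \<phi> V" by blast
    obtain \<phi>' V' R' \<beta>' where "gd \<phi>' V' R' \<beta>'" "stage_le \<phi> V R \<phi>' V' R'" "g \<in> vals \<phi>' V'"
      using insert.prems by (rule_tac gd_step[OF 1(1), of g]) auto
    moreover from this(2) have "A \<subseteq> vals \<phi>' V'" using 1(2) stage_le_vals by blast
    ultimately show ?case by blast
  qed
  then obtain \<phi> V R \<beta> where 1: "gd \<phi> V R \<beta>" "A \<subseteq> vals \<phi> V" by blast
  from assms(3) show ?thesis
  proof (induction B)
    case empty
    then show ?case using 1 by blast
  next
    case (insert y B)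
    then obtain \<phi> V R \<beta> where 1: "gd \<phi> V R \<beta>" "A \<subseteq> vals \<phi> V" "B \<subseteq> ress \<phi> V R" by blast
    have "0 \<in> \<Gamma>" using G_u[of 1] by simp
    obtain \<phi>' V' R' \<beta>' where "gd \<phi>' V' R' \<beta>'" "stage_le \<phi> V R \<phi>' V' R'" "y \<in> ress \<phi>' V' R'"
      by (rule gd_step[OF 1(1) \<open>0 \<in> \<Gamma>\<close>])
    moreover from this(2) have "A \<subseteq> vals \<phi>' V'" "B \<subseteq> ress \<phi>' V' R'"
      using 1(2,3) stage_le_vals stage_le_ress by blast+
    ultimately show ?case by blast
  qed
qed

end

section \<open>Valuations of the rational function field\<close>

lemmas type_ring_simps = ring_of_type_algebra_def

lemma valuation_pval: "valuation v \<Longrightarrow> pval (\<lambda>a. a = 0) v"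
  by unfold_locales (auto simp: valuation_def)

lemma pval_valuation: "pval (\<lambda>a. a = 0) v \<Longrightarrow> valuation v"
  by (auto simp: valuation_def pval_def)

section \<open>Valuation ring, maximal ideal and residue field of a valuation\<close>

context
  fixes v :: "'k::field \<Rightarrow> 'g::linordered_ab_group_add"
  assumes v: "valuation v"
begin

interpretation pval "\<lambda>a. a = 0" v
  by (rule valuation_pval[OF v])

lemma carrier_valuation_ring: "carrier (valuation_ring v) = {a. vge a 0}"
  by (simp add: valuation_ring_def vge_def)

lemma valuation_ring_ops [simp]:
  "x \<oplus>\<^bsub>valuation_ring v\<^esub> y = x + y" "x \<otimes>\<^bsub>valuation_ring v\<^esub> y = x * y"
  "\<zero>\<^bsub>valuation_ring v\<^esub> = 0" "\<one>\<^bsub>valuation_ring v\<^esub> = 1"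
  by (simp_all add: valuation_ring_def type_ring_simps)

lemma valuation_ideal_eq: "valuation_ideal v = {a. vgt a 0}"
  by (simp add: valuation_ideal_def vgt_def)

lemma ring_valuation_ring: "ring (valuation_ring v)"
proof -
  interpret R: ring "ring_of_type_algebra :: 'k ring" by (rule ring_from_type_algebra)
  have um: "\<ominus>\<^bsub>ring_of_type_algebra\<^esub> h = - h" for h :: 'k
    by (rule R.minus_equality) (simp_all add: type_ring_simps)
  have "subring {a. vge a 0} ring_of_type_algebra"
  proof (rule R.subringI)
    fix a b :: 'k
    show "\<ominus>\<^bsub>ring_of_type_algebra\<^esub> a \<in> {a. vge a 0}" if "a \<in> {a. vge a 0}"
      using that by (simp add: um)
    show "a \<otimes>\<^bsub>ring_of_type_algebra\<^esub> b \<in> {a. vge a 0}" "a \<oplus>\<^bsub>ring_of_type_algebra\<^esub> b \<in> {a. vge a 0}"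
      if "a \<in> {a. vge a 0}" "b \<in> {a. vge a 0}"
      using that vge_add[of a 0 b] vge_mult[of a 0 b 0] by (simp_all add: type_ring_simps)
  qed (simp_all add: type_ring_simps vge_def)
  from R.subring_is_ring[OF this] show ?thesis by (simp add: valuation_ring_def vge_def)
qed

lemma ideal_valuation_ideal: "ideal (valuation_ideal v) (valuation_ring v)"
proof (rule idealI[OF ring_valuation_ring])
  interpret R: ring "valuation_ring v" by (rule ring_valuation_ring)
  show "subgroup (valuation_ideal v) (add_monoid (valuation_ring v))"
  proof (rule R.add.subgroupI)
    show "valuation_ideal v \<subseteq> carrier (valuation_ring v)"
      by (auto simp: carrier_valuation_ring valuation_ideal_eq vgt_imp_vge)
    show "valuation_ideal v \<noteq> {}" by (auto simp: valuation_ideal_def)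
    show "\<ominus>\<^bsub>valuation_ring v\<^esub> a \<in> valuation_ideal v" if "a \<in> valuation_ideal v" for a
    proof -
      have "\<ominus>\<^bsub>valuation_ring v\<^esub> a = - a"
        using that by (intro R.minus_equality) (simp_all add: carrier_valuation_ring valuation_ideal_eq vgt_imp_vge)
      then show ?thesis using that by (simp add: valuation_ideal_eq)
    qed
  qed (auto simp: valuation_ideal_eq vgt_add)
next
  fix a x assume "a \<in> valuation_ideal v" "x \<in> carrier (valuation_ring v)"
  then show "x \<otimes>\<^bsub>valuation_ring v\<^esub> a \<in> valuation_ideal v" "a \<otimes>\<^bsub>valuation_ring v\<^esub> x \<in> valuation_ideal v"
    using vgt_mult[of x 0 a 0] by (auto simp: valuation_ideal_eq carrier_valuation_ring mult.commute)
qed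

lemma residue_hom: "residue v \<in> ring_hom (valuation_ring v) (residue_field v)"
  using ideal.rcos_ring_hom[OF ideal_valuation_ideal]
  by (simp add: residue_def[abs_def] residue_field_def)

lemma residue_eq: "residue v a = {b. vgt (b - a) 0}"
proof -
  have "residue v a = {i + a | i. vgt i 0}"
    by (auto simp: residue_def a_r_coset_def' valuation_ideal_eq)
  also have "\<dots> = {b. vgt (b - a) 0}"
  proof safe
    fix b assume "vgt (b - a) 0"
    then show "\<exists>i. b = i + a \<and> vgt i 0" by (intro exI[of _ "b - a"]) simp
  qed simp
  finally show ?thesis .
qed

lemma carrier_residue_field: "carrier (residue_field v) = residue v ` carrier (valuation_ring v)"
  by (auto simp: residue_field_def FactRing_def A_RCOSETS_def' residue_def)

text \<open>This replaces the residue field by a residue map. That only positive values are sent to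
  0 holds because an element of value 0 is a unit: if its residue went to 0, so would that of
  1.\<close>

lemma pvres_residue:
  assumes "\<phi> \<in> ring_hom (residue_field v) (ring_of_type_algebra :: 'f::field ring)"
  shows "pvres (\<lambda>a. a = 0) v (\<lambda>a. \<phi> (residue v a))"
proof -
  have hom: "\<phi> \<circ> residue v \<in> ring_hom (valuation_ring v) (ring_of_type_algebra :: 'f ring)"
    by (rule ring_hom_trans[OF residue_hom assms])
  have add: "\<phi> (residue v (a + b)) = \<phi> (residue v a) + \<phi> (residue v b)"
    and mult: "\<phi> (residue v (a * b)) = \<phi> (residue v a) * \<phi> (residue v b)" if "vge a 0" "vge b 0" for a b
    using ring_hom_add[OF hom, of a b] ring_hom_mult[OF hom, of a b] that
    by (simp_all add: carrier_valuation_ring type_ring_simps)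
  have one: "\<phi> (residue v 1) = 1" using ring_hom_one[OF hom] by (simp add: type_ring_simps)
  have zero: "\<phi> (residue v 0) = 0" using add[OF vge_0(1) vge_0(1)] by (simp only: add_0_left add_cancel_right_right)
  show ?thesis
  proof (unfold_locales, goal_cases)
    case (4 a)
    show ?case
    proof
      assume 0: "\<phi> (residue v a) = 0"
      show "vgt a 0"
      proof (rule ccontr)
        assume "\<not> vgt a 0"
        then have a: "a \<noteq> 0" "v a = 0" using 4 by (auto simp: vge_def vgt_def)
        then have "v (1 / a) = 0" using V_mult[of a "1 / a"] by simp
        then have "\<phi> (residue v (a * (1 / a))) = 0" using mult[of a "1 / a"] 0 4 by (simp add: vge_def)
        then show False using one a by simp
      qed
    next
      assume "vgt a 0"
      then have "residue v a = residue v 0"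
        unfolding residue_eq using vgt_add[of a 0] vgt_diff[of _ 0 a] by fastforce
      then show "\<phi> (residue v a) = 0" using zero by simp
    qed
  qed (use add mult one in auto)
qed

end

text \<open>The way back from residue maps to residue fields, by the first isomorphism theorem.
  Since the isomorphism is known on residues, its compatibility with the residue map of
  \<open>K\<close> needs no separate construction.\<close>

lemma residue_field_iso:
  fixes w :: "'l::field \<Rightarrow> 'd::linordered_ab_group_add" and \<rho> :: "'l \<Rightarrow> 'e::field"
  assumes "pvres (\<lambda>a. a = 0) w \<rho>" and surj: "\<And>y. \<exists>a. (a = 0 \<or> 0 \<le> w a) \<and> \<rho> a = y"
  shows "\<exists>h \<in> ring_iso (residue_field w) ring_of_type_algebra.
    \<forall>a. a = 0 \<or> 0 \<le> w a \<longrightarrow> h (residue w a) = \<rho> a"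
proof -
  interpret pvres "\<lambda>a. a = 0" w \<rho> by fact
  have w: "valuation w" by (rule pval_valuation) (rule pval_axioms)
  note [simp] = carrier_valuation_ring[OF w] valuation_ring_ops[OF w]
  have hom: "\<rho> \<in> ring_hom (valuation_ring w) ring_of_type_algebra"
    by (rule ring_hom_memI) (simp_all add: R_add R_mult type_ring_simps)
  interpret hom: ring_hom_ring "valuation_ring w" "ring_of_type_algebra :: 'e ring" \<rho>
    by (rule ring_hom_ringI2[OF ring_valuation_ring[OF w] ring_from_type_algebra hom])
  have ker: "a_kernel (valuation_ring w) (ring_of_type_algebra :: 'e ring) \<rho> = valuation_ideal w"
  proof -
    have "\<zero>\<^bsub>ring_of_type_algebra\<^esub> = (0::'e)" by (simp add: type_ring_simps)
    moreover have "vge a 0 \<and> \<rho> a = 0 \<longleftrightarrow> vgt a 0" for a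
      using R_eq_0_iff[of a] vgt_imp_vge[of a 0] by blast
    ultimately show ?thesis unfolding a_kernel_def' valuation_ideal_eq[OF w] by simp
  qed
  have "\<rho> ` carrier (valuation_ring w) = carrier ring_of_type_algebra"
  proof -
    have "y \<in> \<rho> ` {a. vge a 0}" for y
    proof -
      obtain a where "a = 0 \<or> 0 \<le> w a" "\<rho> a = y" using surj by blast
      then show ?thesis by (intro image_eqI[of _ _ a]) (simp_all add: vge_def)
    qed
    then have "\<rho> ` {a. vge a 0} = UNIV" by blast
    then show ?thesis by (simp add: type_ring_simps)
  qed
  from hom.FactRing_iso_set[OF this]
  have iso: "(\<lambda>A. the_elem (\<rho> ` A)) \<in> ring_iso (residue_field w) ring_of_type_algebra"
    by (simp add: ker residue_field_def)
  have elem: "the_elem (\<rho> ` residue w a) = \<rho> a" if "a = 0 \<or> 0 \<le> w a" for a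
  proof -
    have a: "vge a 0" using that by (simp add: vge_def)
    have "\<rho> b = \<rho> a" if "b \<in> residue w a" for b
      using that R_eqI[OF a, of b] vgt_uminus[of "b - a"] by (simp add: residue_eq[OF w])
    moreover have "a \<in> residue w a" by (simp add: residue_eq[OF w])
    ultimately have "\<rho> ` residue w a = {\<rho> a}" by blast
    then show ?thesis by simp
  qed
  show ?thesis by (rule bexI[OF _ iso]) (simp add: elem)
qed

section \<open>From polynomials to fractions\<close>

text \<open>
  \<open>T n F\<close> stands for the residue of \<open>F/t\<^sup>n\<close>, where \<open>t\<close> has the value \<open>\<gamma>\<close>.
\<close>

locale fract_val = pval "\<lambda>F. F = 0" W
  for W :: "'k::field poly \<Rightarrow> 'd::linordered_ab_group_add" +
  fixes T :: "nat \<Rightarrow> 'k poly \<Rightarrow> 'e::field" and \<gamma> :: 'd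
  assumes T_add: "vge F (nmul n \<gamma>) \<Longrightarrow> vge G (nmul n \<gamma>) \<Longrightarrow> T n (F + G) = T n F + T n G"
    and T_mult: "vge F (nmul m \<gamma>) \<Longrightarrow> vge G (nmul n \<gamma>) \<Longrightarrow> T (m + n) (F * G) = T m F * T n G"
    and T_eq_0_iff: "vge F (nmul n \<gamma>) \<Longrightarrow> T n F = 0 \<longleftrightarrow> vgt F (nmul n \<gamma>)"
    and normalize: "G \<noteq> 0 \<Longrightarrow> \<exists>s n. s \<noteq> 0 \<and> W (s * G) = nmul n \<gamma>"
begin

definition wf :: "'k poly fract \<Rightarrow> 'd" where
  "wf q = (SOME g. \<exists>a b. a \<noteq> 0 \<and> b \<noteq> 0 \<and> q = Fract a b \<and> g = W a - W b)"

lemma wf_Fract: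
  assumes "a \<noteq> 0" "b \<noteq> 0"
  shows "wf (Fract a b) = W a - W b"
proof -
  have "W c - W d = W a - W b" if "c \<noteq> 0" "d \<noteq> 0" "Fract a b = Fract c d" for c d
  proof -
    have "a * d = c * b" using that assms by (simp add: eq_fract)
    then have "W a + W d = W c + W b" using V_mult[of a d] V_mult[of c b] that assms by simp
    then show ?thesis by (simp add: algebra_simps)
  qed
  then show ?thesis unfolding wf_def using assms by (intro some_equality) blast+
qed

lemma Fract_eq_0_iff: "b \<noteq> 0 \<Longrightarrow> Fract a b = 0 \<longleftrightarrow> a = (0 :: 'k poly)"
  by (simp add: Zero_fract_def eq_fract)

lemma fract_obtain:
  obtains a b :: "'k poly" where "q = Fract a b" "b \<noteq> 0"
  by (cases q) auto

sublocale wf: pval "\<lambda>q. q = 0" wf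
proof
  fix p q :: "'k poly fract"
  obtain a b where p: "p = Fract a b" "b \<noteq> 0" by (rule fract_obtain)
  obtain c d where q: "q = Fract c d" "d \<noteq> 0" by (rule fract_obtain)
  assume nz: "p \<noteq> 0" "q \<noteq> 0"
  then have ac: "a \<noteq> 0" "c \<noteq> 0" using p q by (auto simp: Fract_eq_0_iff)
  show "wf (p * q) = wf p + wf q"
    using p q ac by (simp add: wf_Fract V_mult)
  assume "p + q \<noteq> 0"
  then have s: "a * d + c * b \<noteq> 0" using p q by (auto simp: Fract_eq_0_iff)
  have "min (W (a * d)) (W (c * b)) \<le> W (a * d + c * b)"
    using ac p q s by (intro V_add) auto
  then have "min (W (a * d)) (W (c * b)) - W (b * d) \<le> W (a * d + c * b) - W (b * d)"
    by (rule diff_right_mono)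
  moreover have "min (W (a * d)) (W (c * b)) - W (b * d) = min (wf p) (wf q)"
    using ac p q by (simp add: wf_Fract V_mult min_def algebra_simps)
  ultimately show "min (wf p) (wf q) \<le> wf (p + q)"
    using p q s by (simp add: wf_Fract)
qed auto

lemma wf_vge: "b \<noteq> 0 \<Longrightarrow> wf.vge (Fract a b) 0 \<longleftrightarrow> vge a (W b)"
  by (cases "a = 0") (auto simp: wf.vge_def vge_def Fract_eq_0_iff wf_Fract)

lemma wf_vgt: "b \<noteq> 0 \<Longrightarrow> wf.vgt (Fract a b) 0 \<longleftrightarrow> vgt a (W b)"
  by (cases "a = 0") (auto simp: wf.vgt_def vgt_def Fract_eq_0_iff wf_Fract)

text \<open>A factor \<open>s\<close> brings the denominator to a value
  \<open>nmul n \<gamma>\<close>, where \<open>T n\<close> can be applied to numerator and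
  denominator. When \<gamma> is outside the old value group, no polynomial factor brings a power of
  \<phi> to value 0, hence the index \<open>n\<close>; in the other cases \<gamma> is 0 and
  \<open>T n\<close> is the same for all \<open>n\<close>.\<close>

definition rf :: "'k poly fract \<Rightarrow> 'e" where
  "rf q = (SOME y. \<exists>F G s n. q = Fract F G \<and> G \<noteq> 0 \<and> s \<noteq> 0 \<and> W (s * G) = nmul n \<gamma> \<and>
     y = T n (s * F) / T n (s * G))"

lemma T_nz: "F \<noteq> 0 \<Longrightarrow> W F = nmul n \<gamma> \<Longrightarrow> T n F \<noteq> 0"
  by (subst T_eq_0_iff) (auto simp: vge_def vgt_def)

lemma vge_scale: 
  assumes "s \<noteq> 0" "G \<noteq> 0" "W (s * G) = g"
  shows "vge (s * F) g \<longleftrightarrow> vge F (W G)" "vgt (s * F) g \<longleftrightarrow> vgt F (W G)"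
  using vge_mult_iff[of s F "W G"] vgt_mult_iff[of s F "W G"] assms V_mult[of s G] by simp_all

text \<open>Independence of all choices: cross-multiplying two representations gives the same
  polynomial at level \<open>n + n'\<close>, where \<open>T_mult\<close> splits it in two
  ways.\<close>

lemma rf_Fract:
  assumes "vge F (W G)" "G \<noteq> 0" "s \<noteq> 0" "W (s * G) = nmul n \<gamma>"
  shows "rf (Fract F G) = T n (s * F) / T n (s * G)"
proof -
  have "T n' (s' * F') / T n' (s' * G') = T n (s * F) / T n (s * G)"
    if "Fract F G = Fract F' G'" "G' \<noteq> 0" "s' \<noteq> 0" "W (s' * G') = nmul n' \<gamma>" for F' G' s' n'
  proof -
    have eq: "F * G' = F' * G" using that assms by (simp add: eq_fract)
    have "vge F' (W G')"
      using wf_vge[of G F] wf_vge[of G' F'] that assms by simp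
    then have ge: "vge (s * F) (nmul n \<gamma>)" "vge (s' * F') (nmul n' \<gamma>)"
      using vge_scale(1) that assms by blast+
    have ge': "vge (s * G) (nmul n \<gamma>)" "vge (s' * G') (nmul n' \<gamma>)"
      using assms that by (simp_all add: vge_def)
    have "T n (s * F) * T n' (s' * G') = T (n + n') ((s * F) * (s' * G'))"
      by (rule T_mult[symmetric]) (fact ge ge')+
    also have "(s * F) * (s' * G') = (s * G) * (s' * F')"
      using arg_cong[OF eq, of "\<lambda>x. s * s' * x"] by (simp add: ac_simps)
    also have "T (n + n') \<dots> = T n (s * G) * T n' (s' * F')"
      by (rule T_mult) (fact ge ge')+
    finally have e: "T n (s * F) * T n' (s' * G') = T n (s * G) * T n' (s' * F')" .
    have "T n (s * G) \<noteq> 0" "T n' (s' * G') \<noteq> 0" using assms that T_nz[of "s * G" n] T_nz[of "s' * G'" n'] by simp_all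
    then show ?thesis using e by (simp add: frac_eq_eq mult.commute)
  qed
  then show ?thesis unfolding rf_def using assms by (intro some_equality) blast+
qed

sublocale rf: pvres "\<lambda>q. q = 0" wf rf
proof
  show "rf 1 = 1"
  proof -
    obtain s n where s: "s \<noteq> 0" "W (s * 1) = nmul n \<gamma>" using normalize[of 1] by auto
    then show ?thesis
      using rf_Fract[of 1 1 s n] T_nz[of s n] unfolding One_fract_def by (simp add: vge_def)
  qed
next
  fix p q :: "'k poly fract"
  assume ge: "wf.vge p 0" "wf.vge q 0"
  obtain a b where p: "p = Fract a b" "b \<noteq> 0" by (rule fract_obtain)
  obtain c d where q: "q = Fract c d" "d \<noteq> 0" by (rule fract_obtain)
  have ge': "vge a (W b)" "vge c (W d)" using ge p q by (simp_all add: wf_vge)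
  obtain s m where s: "s \<noteq> 0" "W (s * b) = nmul m \<gamma>" using normalize[OF p(2)] by blast
  obtain t n where t: "t \<noteq> 0" "W (t * d) = nmul n \<gamma>" using normalize[OF q(2)] by blast
  have g: "vge (s * a) (nmul m \<gamma>)" "vge (t * c) (nmul n \<gamma>)" "vge (s * b) (nmul m \<gamma>)" "vge (t * d) (nmul n \<gamma>)"
    using vge_scale(1) ge' s t p q by (blast, blast, simp_all add: vge_def)
  have nz: "T m (s * b) \<noteq> 0" "T n (t * d) \<noteq> 0" using s t p q T_nz[of "s * b" m] T_nz[of "t * d" n] by simp_all
  have st: "s * t \<noteq> 0" "b * d \<noteq> 0" "W (s * t * (b * d)) = nmul (m + n) \<gamma>"
  proof -
    have e: "s * t * (b * d) = (s * b) * (t * d)" by (simp add: ac_simps)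
    show "W (s * t * (b * d)) = nmul (m + n) \<gamma>"
      unfolding e using s t p q V_mult[of "s * b" "t * d"] by (simp add: nmul_add)
  qed (use s t p q in auto)
  have rp: "rf p = T m (s * a) / T m (s * b)" unfolding p by (rule rf_Fract[OF ge'(1) p(2) s])
  have rq: "rf q = T n (t * c) / T n (t * d)" unfolding q by (rule rf_Fract[OF ge'(2) q(2) t])
  have eqs: "s * t * (a * c) = (s * a) * (t * c)" "s * t * (b * d) = (s * b) * (t * d)"
    "s * t * (a * d + c * b) = (s * a) * (t * d) + (s * b) * (t * c)"
    by (simp_all add: algebra_simps)
  have "rf (p * q) = T (m + n) (s * t * (a * c)) / T (m + n) (s * t * (b * d))"
    unfolding p q mult_fract using ge' p q
    by (intro rf_Fract st) (simp add: V_mult vge_mult)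
  then show "rf (p * q) = rf p * rf q"
    unfolding eqs using g by (simp add: T_mult rp rq)
  have g2: "vge ((s * a) * (t * d)) (nmul (m + n) \<gamma>)" "vge ((s * b) * (t * c)) (nmul (m + n) \<gamma>)"
    using g vge_mult by (simp_all add: nmul_add)
  have "vge (a * d + c * b) (W (b * d))"
    using vge_scale(1)[OF st(1,2,3)] vge_add[OF g2] eqs(3) st(3) by metis
  then have "rf (p + q) = T (m + n) (s * t * (a * d + c * b)) / T (m + n) (s * t * (b * d))"
    using p q by (simp add: rf_Fract[OF _ st(2,1,3)])
  also have "\<dots> = rf p + rf q"
    unfolding eqs T_add[OF g2] T_mult[OF g(1,4)] T_mult[OF g(3,2)] T_mult[OF g(3,4)] rp rq
    by (simp only: add_frac_eq[OF nz] mult.commute[of "T m (s * b)" "T n (t * c)"])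
  finally show "rf (p + q) = rf p + rf q" .
next
  fix p :: "'k poly fract"
  assume ge: "wf.vge p 0"
  obtain a b where p: "p = Fract a b" "b \<noteq> 0" by (rule fract_obtain)
  then have ge': "vge a (W b)" using ge by (simp add: wf_vge)
  obtain s m where s: "s \<noteq> 0" "W (s * b) = nmul m \<gamma>" using normalize[OF p(2)] by blast
  have "rf p = 0 \<longleftrightarrow> T m (s * a) = 0"
    using rf_Fract[OF ge' p(2) s] T_nz[of "s * b" m] s p by simp
  also have "\<dots> \<longleftrightarrow> vgt a (W b)"
    using T_eq_0_iff[of "s * a" m] vge_scale[OF s(1) p(2) s(2)] ge' by simp
  finally show "rf p = 0 \<longleftrightarrow> wf.vgt p 0" using p by (simp add: wf_vgt)
qed

lemma T_0_1: "T 0 1 = 1"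
  using T_mult[of 1 0 1 0] T_nz[of 1 0] by (simp add: vge_def)

lemma rf_poly: "vge F 0 \<Longrightarrow> rf (Fract F 1) = T 0 F"
  using rf_Fract[of F 1 1 0] by (simp add: T_0_1)

end

lemma ratfun_const_hom: "ratfun_const \<in> ring_hom ring_of_type_algebra (ring_of_type_algebra :: 'k::field poly fract ring)"
  by (rule ring_hom_memI) (auto simp: ratfun_const_def type_ring_simps One_fract_def one_pCons mult.commute)

text \<open>The common last step of all constructions. A residue is asked for as a quotient of two
  polynomial residues because a rational function field is not covered by residues of polynomials
  alone.\<close>

lemma extension_from_fract_val:
  fixes W :: "'k::field poly \<Rightarrow> 'd::linordered_ab_group_add" and T :: "nat \<Rightarrow> 'k poly \<Rightarrow> 'e::field"
    and v :: "'k \<Rightarrow> 'g::linordered_ab_group_add"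
  assumes "fract_val W T \<gamma>" and v: "valuation v"
    and const: "\<And>a. a \<noteq> 0 \<Longrightarrow> W [:a:] = j (v a)" and j: "\<And>g. 0 \<le> g \<Longrightarrow> 0 \<le> j g"
    and res: "\<And>a. a = 0 \<or> 0 \<le> v a \<Longrightarrow> T 0 [:a:] = \<chi> (residue v a)"
    and val: "\<And>g. \<exists>F G. F \<noteq> 0 \<and> G \<noteq> 0 \<and> g = W F - W G"
    and surj: "\<And>y. \<exists>F G. (F = 0 \<or> 0 \<le> W F) \<and> G \<noteq> 0 \<and> W G = 0 \<and> T 0 F = y * T 0 G"
  shows "\<exists>w :: 'k poly fract \<Rightarrow> 'd. valuation_extends ratfun_const j v w \<and> value_group w = UNIV \<and>
    residue_field_iso_over ratfun_const v w \<chi>"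
proof (intro exI conjI)
  interpret fract_val W T \<gamma> by fact
  have V1: "W 1 = 0" by simp
  show "valuation_extends ratfun_const j v wf"
    unfolding valuation_extends_def
  proof (intro conjI allI impI)
    show "valuation wf" by (rule pval_valuation) (rule wf.pval_axioms)
    show "wf (ratfun_const a) = j (v a)" if "a \<noteq> 0" for a
      using that const[OF that] by (simp add: ratfun_const_def wf_Fract)
  qed (rule ratfun_const_hom)
  show "value_group wf = UNIV"
  proof -
    have "g \<in> value_group wf" for g
    proof -
      obtain F G where "F \<noteq> 0" "G \<noteq> 0" "g = W F - W G" using val by blast
      then show ?thesis unfolding value_group_def
        by (intro image_eqI[of _ _ "Fract F G"]) (auto simp: wf_Fract Fract_eq_0_iff)
    qed
    then show ?thesis by blast
  qed
  have ex: "\<exists>a. (a = 0 \<or> 0 \<le> wf a) \<and> rf a = y" for y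
  proof -
    obtain F G where FG: "F = 0 \<or> 0 \<le> W F" "G \<noteq> 0" "W G = 0" "T 0 F = y * T 0 G" using surj by blast
    have "rf (Fract F G) = T 0 (1 * F) / T 0 (1 * G)"
      using FG by (intro rf_Fract) (auto simp: vge_def)
    then have "rf (Fract F G) = y" using FG T_nz[of G 0] by simp
    moreover have "Fract F G = 0 \<or> 0 \<le> wf (Fract F G)"
      using FG by (cases "F = 0") (auto simp: wf_Fract Fract_eq_0_iff)
    ultimately show ?thesis by blast
  qed
  obtain h where h: "h \<in> ring_iso (residue_field wf) ring_of_type_algebra"
    "\<And>a. a = 0 \<or> 0 \<le> wf a \<Longrightarrow> h (residue wf a) = rf a"
    using residue_field_iso[OF rf.pvres_axioms ex] by blast
  show "residue_field_iso_over ratfun_const v wf \<chi>"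
    unfolding residue_field_iso_over_def
  proof (intro bexI[OF _ h(1)] ballI)
    fix a assume "a \<in> carrier (valuation_ring v)"
    then have a: "a = 0 \<or> 0 \<le> v a" by (simp add: valuation_ring_def)
    have "vge [:a:] 0" using a const[of a] j by (cases "a = 0") (auto simp: vge_def)
    then have r: "rf (ratfun_const a) = T 0 [:a:]" by (simp add: ratfun_const_def rf_poly)
    have "ratfun_const a = 0 \<or> 0 \<le> wf (ratfun_const a)"
      using a const[of a] j by (cases "a = 0") (auto simp: ratfun_const_def wf_Fract Fract_eq_0_iff)
    from h(2)[OF this] show "h (residue wf (ratfun_const a)) = \<chi> (residue v a)"
      using r res[OF a] by simp
  qed
qed

section \<open>Quotients of value groups and field extensions\<close>

definition add_closed :: "'g::ab_group_add set \<Rightarrow> bool" where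
  "add_closed E \<longleftrightarrow> 0 \<in> E \<and> (\<forall>x\<in>E. \<forall>y\<in>E. x + y \<in> E) \<and> (\<forall>x\<in>E. - x \<in> E)"

lemma group_additive_group: "group (additive_group :: 'g::ab_group_add monoid)"
proof (rule groupI)
  fix x :: 'g assume "x \<in> carrier additive_group"
  show "\<exists>y\<in>carrier additive_group. y \<otimes>\<^bsub>additive_group\<^esub> x = \<one>\<^bsub>additive_group\<^esub>"
    by (rule bexI[of _ "- x"]) (simp_all add: additive_group_def)
qed (simp_all add: additive_group_def add.assoc)

lemma additive_group_inv [simp]: "inv\<^bsub>additive_group\<^esub> x = - (x :: 'g::ab_group_add)"
  by (rule group.inv_equality[OF group_additive_group]) (simp_all add: additive_group_def)

lemma additive_group_pow: "x [^]\<^bsub>additive_group\<^esub> (n::nat) = nmul n (x :: 'g::ab_group_add)"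
  by (induction n) (simp_all add: additive_group_def nat_pow_def add.commute)

lemma additive_coset: "H #>\<^bsub>additive_group\<^esub> x = {h + x | h. h \<in> H}"
  by (auto simp: r_coset_def additive_group_def)

context
  fixes v :: "'k::field \<Rightarrow> 'g::linordered_ab_group_add"
  assumes v: "valuation v"
begin

interpretation pval "\<lambda>a. a = 0" v
  by (rule valuation_pval[OF v])

lemma value_group_closed: "add_closed (value_group v)"
  unfolding add_closed_def
proof (intro conjI ballI)
  show "0 \<in> value_group v" unfolding value_group_def by (rule image_eqI[of _ _ 1]) simp_all
  fix x y assume "x \<in> value_group v" "y \<in> value_group v"
  then obtain a b where a: "a \<noteq> 0" "x = v a" and b: "b \<noteq> 0" "y = v b" by (auto simp: value_group_def)
  show "x + y \<in> value_group v"
    unfolding value_group_def by (rule image_eqI[of _ _ "a * b"]) (simp_all add: a b V_mult)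
  have "v a + v (1 / a) = 0" using V_mult[of a "1 / a"] a by simp
  then have "- x = v (1 / a)" using a by (simp add: neg_eq_iff_add_eq_0)
  then show "- x \<in> value_group v"
    unfolding value_group_def by (intro image_eqI[of _ _ "1 / a"]) (simp_all add: a)
qed

lemma value_group_normal: "normal (value_group v) additive_group"
proof -
  interpret G: group "additive_group :: 'g monoid" by (rule group_additive_group)
  interpret comm_group "additive_group :: 'g monoid"
    by (rule G.group_comm_groupI) (simp add: additive_group_def add.commute)
  have "subgroup (value_group v) additive_group"
    using value_group_closed unfolding add_closed_def
    by (intro G.subgroupI) (auto simp: additive_group_def additive_group_inv[unfolded additive_group_def])
  then show ?thesis by (rule subgroup_imp_normal)
qed

lemma value_quotient_carrier:
  "carrier (value_quotient v) = range (\<lambda>x. value_group v #>\<^bsub>additive_group\<^esub> x)"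
  by (simp add: value_quotient_def carrier_FactGroup additive_group_def)

lemma torsion_value_quotient:
  assumes "torsion_group (value_quotient v)"
  shows "\<exists>n>0. \<exists>c\<noteq>0. nmul n g = v c"
proof -
  interpret N: normal "value_group v" additive_group by (rule value_group_normal)
  let ?x = "value_group v #>\<^bsub>additive_group\<^esub> g"
  obtain n :: nat where n: "0 < n" "?x [^]\<^bsub>value_quotient v\<^esub> n = value_group v"
    using assms unfolding torsion_group_def value_quotient_carrier
    by (auto simp: value_quotient_def)
  have "?x [^]\<^bsub>value_quotient v\<^esub> n = value_group v #>\<^bsub>additive_group\<^esub> (g [^]\<^bsub>additive_group\<^esub> n)"
    unfolding value_quotient_def by (rule N.FactGroup_pow) (simp add: additive_group_def)
  then have eq: "{h + nmul n g | h. h \<in> value_group v} = value_group v"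
    using n by (simp add: additive_group_pow additive_coset)
  have "0 + nmul n g \<in> value_group v"
    using value_group_closed by (subst eq[symmetric]) (auto simp: add_closed_def)
  then obtain c where "c \<noteq> 0" "nmul n g = v c" by (auto simp: value_group_def)
  then show ?thesis using n by blast
qed

lemma coset_eqD:
  assumes "value_group v #>\<^bsub>additive_group\<^esub> x = value_group v #>\<^bsub>additive_group\<^esub> y"
  shows "\<exists>c\<noteq>0. x = v c + y"
proof -
  have "0 \<in> value_group v" using value_group_closed by (simp add: add_closed_def)
  then have "x \<in> value_group v #>\<^bsub>additive_group\<^esub> x" by (force simp: additive_coset)
  then show ?thesis unfolding assms by (auto simp: additive_coset value_group_def)
qed

text \<open>Coset representatives translate the quotient group into a statement about values, which
  stages can control.\<close>

lemma finite_value_quotient: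
  "finite (carrier (value_quotient v)) \<longleftrightarrow> (\<exists>A. finite A \<and> (\<forall>g. \<exists>c a. c \<noteq> 0 \<and> a \<in> A \<and> g = v c + a))"
proof
  let ?C = "\<lambda>x. value_group v #>\<^bsub>additive_group\<^esub> x"
  assume fin: "finite (carrier (value_quotient v))"
  define rep where "rep Z = (SOME x. ?C x = Z)" for Z
  have rep: "?C (rep (?C x)) = ?C x" for x unfolding rep_def by (rule someI[of _ x]) simp
  show "\<exists>A. finite A \<and> (\<forall>g. \<exists>c a. c \<noteq> 0 \<and> a \<in> A \<and> g = v c + a)"
  proof (intro exI[of _ "rep ` carrier (value_quotient v)"] conjI allI)
    fix g
    obtain c where "c \<noteq> 0" "g = v c + rep (?C g)" using coset_eqD[OF rep[symmetric, of g]] by blast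
    then show "\<exists>c a. c \<noteq> 0 \<and> a \<in> rep ` carrier (value_quotient v) \<and> g = v c + a"
      unfolding value_quotient_carrier by (intro exI[of _ c] exI[of _ "rep (?C g)"]) simp
  qed (use fin in simp)
next
  let ?C = "\<lambda>x. value_group v #>\<^bsub>additive_group\<^esub> x"
  assume "\<exists>A. finite A \<and> (\<forall>g. \<exists>c a. c \<noteq> 0 \<and> a \<in> A \<and> g = v c + a)"
  then obtain A where A: "finite A" "\<forall>g. \<exists>c a. c \<noteq> 0 \<and> a \<in> A \<and> g = v c + a" by (elim exE conjE)
  have "?C g \<in> ?C ` A" for g
  proof -
    obtain c a where c: "c \<noteq> 0" "a \<in> A" "g = v c + a" using A(2) by blast
    then have vc: "v c \<in> value_group v" by (auto simp: value_group_def)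
    have "?C g = ?C a"
      unfolding additive_coset c(3)
    proof (intro equalityI subsetI; clarify)
      fix h assume "h \<in> value_group v"
      then have "h + v c \<in> value_group v" "h - v c \<in> value_group v"
        using vc value_group_closed unfolding add_closed_def diff_conv_add_uminus by blast+
      moreover have "h + (v c + a) = (h + v c) + a" "h + a = (h - v c) + (v c + a)" by (simp_all add: add.assoc)
      ultimately show "\<exists>h'. h + (v c + a) = h' + a \<and> h' \<in> value_group v"
        "\<exists>h'. h + a = h' + (v c + a) \<and> h' \<in> value_group v" by blast+
    qed
    then show ?thesis using c by blast
  qed
  then have "carrier (value_quotient v) \<subseteq> ?C ` A" unfolding value_quotient_carrier by blast
  then show "finite (carrier (value_quotient v))" using A(1) finite_surj by blast
qed

text \<open>\<open>B\<close> picks a representative of each coset in a countable generating set. A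
  subgroup containing \<open>value_group v\<close> and \<open>B\<close> is a union of cosets, and
  these include all generated ones.\<close>

lemma countable_value_quotient:
  assumes "countably_generated_group (value_quotient v)"
  obtains B where "countable B" "\<And>E. add_closed E \<Longrightarrow> value_group v \<subseteq> E \<Longrightarrow> B \<subseteq> E \<Longrightarrow> E = UNIV"
proof -
  interpret N: normal "value_group v" additive_group by (rule value_group_normal)
  let ?C = "\<lambda>x. value_group v #>\<^bsub>additive_group\<^esub> x"
  obtain S where S: "S \<subseteq> carrier (value_quotient v)" "countable S"
    "generate (value_quotient v) S = carrier (value_quotient v)"
    using assms by (auto simp: countably_generated_group_def)
  define rep where "rep Z = (SOME x. ?C x = Z)" for Z
  have rep: "?C (rep Z) = Z" if "Z \<in> S" for Z
    using that S(1) unfolding rep_def value_quotient_carrier by (intro someI_ex[of "\<lambda>x. ?C x = Z"]) blast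
  show ?thesis
  proof (rule that[of "rep ` S"])
    show "countable (rep ` S)" using S by simp
    fix E assume E: "add_closed E" "value_group v \<subseteq> E" "rep ` S \<subseteq> E"
    have coset: "?C x \<subseteq> E" if "x \<in> E" for x
      using that E unfolding additive_coset add_closed_def by blast
    have "Z \<subseteq> E" if "Z \<in> generate (value_quotient v) S" for Z
      using that
    proof (induction rule: generate.induct)
      case one
      then show ?case using E by (simp add: value_quotient_def)
    next
      case (incl Z)
      then show ?case using coset[of "rep Z"] rep E by auto
    next
      case (inv Z)
      have "Z \<in> carrier (additive_group Mod value_group v)"
        using inv S by (auto simp: value_quotient_def)
      then have "inv\<^bsub>value_quotient v\<^esub> Z = set_inv\<^bsub>additive_group\<^esub> Z"
        unfolding value_quotient_def by (rule N.inv_FactGroup)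
      also have "\<dots> \<subseteq> E"
      proof -
        have "Z \<subseteq> E" using coset[of "rep Z"] rep inv E by auto
        then show ?thesis using E(1) by (auto simp: SET_INV_def add_closed_def)
      qed
      finally show ?case .
    next
      case (eng Z Z2)
      have "Z <#>\<^bsub>additive_group\<^esub> Z2 \<subseteq> E"
      proof
        fix x assume "x \<in> Z <#>\<^bsub>additive_group\<^esub> Z2"
        then obtain a b where "a \<in> Z" "b \<in> Z2" "x = a + b" by (auto simp: set_mult_def additive_group_def)
        then show "x \<in> E" using eng.IH E(1) unfolding add_closed_def by blast
      qed
      then show ?case by (simp add: value_quotient_def)
    qed
    then have sub: "?C x \<subseteq> E" for x using S(3) unfolding value_quotient_carrier by blast
    have "x \<in> E" for x
    proof -
      have "0 \<in> value_group v" using value_group_closed by (simp add: add_closed_def)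
      then have "x \<in> ?C x" by (force simp: additive_coset)
      then show ?thesis using sub by blast
    qed
    then show "E = UNIV" by blast
  qed
qed

end

section \<open>Algebraic, finite and generated field extensions, in terms of polynomials and closed
  sets\<close>

lemma eval_type_algebra:
  "ring.eval ring_of_type_algebra xs x = poly (Poly (rev xs)) (x :: 'f::field)"
proof -
  interpret R: ring "ring_of_type_algebra :: 'f ring" by (rule ring_from_type_algebra)
  have pow: "x [^]\<^bsub>ring_of_type_algebra\<^esub> (n::nat) = x ^ n" for n
    by (induction n) (simp_all add: type_ring_simps mult.commute)
  show ?thesis
    by (induction xs) (auto simp: pow Poly_append poly_monom add.commute,
        auto simp: type_ring_simps add.commute)
qed

definition subfield_set :: "'f::field set \<Rightarrow> bool" where
  "subfield_set K \<longleftrightarrow> 0 \<in> K \<and> 1 \<in> K \<and> ring_closed K \<and> (\<forall>x\<in>K. - x \<in> K \<and> inverse x \<in> K)"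

lemma subfield_set_subfield:
  assumes "subfield_set (K :: 'f::field set)"
  shows "subfield K ring_of_type_algebra"
proof -
  interpret R: field "ring_of_type_algebra :: 'f ring" by (rule field_from_type_algebra)
  have um: "\<ominus>\<^bsub>ring_of_type_algebra\<^esub> h = - h" for h :: 'f
    by (rule R.minus_equality) (simp_all add: type_ring_simps)
  have inv: "inv\<^bsub>ring_of_type_algebra\<^esub> h = inverse h" if "h \<noteq> 0" for h :: 'f
    by (rule R.inv_unique'[symmetric]) (use that in \<open>simp_all add: type_ring_simps\<close>)
  show ?thesis
  proof (rule R.subfieldI')
    show "subring K ring_of_type_algebra"
    proof (rule R.subringI)
      show "\<ominus>\<^bsub>ring_of_type_algebra\<^esub> h \<in> K" if "h \<in> K" for h
        using that assms unfolding um subfield_set_def by blast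
    qed (use assms in \<open>auto simp: type_ring_simps subfield_set_def ring_closed_def\<close>)
    fix k assume "k \<in> K - {\<zero>\<^bsub>ring_of_type_algebra\<^esub>}"
    then have "k \<noteq> 0" "k \<in> K" by (auto simp: type_ring_simps)
    then show "inv\<^bsub>ring_of_type_algebra\<^esub> k \<in> K"
      using assms by (simp add: inv subfield_set_def)
  qed
qed

lemma algebraic_polyD:
  assumes "subfield_set (K :: 'f::field set)" "\<not> ring.transcendental ring_of_type_algebra K y"
  shows "\<exists>p. p \<noteq> 0 \<and> (\<forall>k. coeff p k \<in> K) \<and> poly p y = 0"
proof -
  interpret R: field "ring_of_type_algebra :: 'f ring" by (rule field_from_type_algebra)
  have z: "\<zero>\<^bsub>ring_of_type_algebra\<^esub> = (0::'f)" by (simp add: type_ring_simps)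
  have sf: "subring K ring_of_type_algebra" using subfield_set_subfield[OF assms(1)] subfieldE(1) by blast
  have "(R.algebraic over K) y" using assms(2) by (simp add: over_def)
  from R.algebraicE[OF sf _ this] obtain xs where xs: "xs \<in> carrier (univ_poly ring_of_type_algebra K)"
    "xs \<noteq> []" "R.eval xs y = \<zero>\<^bsub>ring_of_type_algebra\<^esub>"
    by (auto simp: type_ring_simps)
  then have *: "set xs \<subseteq> K" "hd xs \<noteq> 0"
    unfolding univ_poly_carrier[symmetric] polynomial_def by (auto simp: type_ring_simps)
  \<comment> \<open>The list \<open>xs\<close> has its leading coefficient first,
    \<open>Poly\<close> expects the constant coefficient first.\<close>
  let ?p = "Poly (rev xs)"
  have "coeff ?p (length xs - 1) = hd xs"
    using xs(2) by (simp add: nth_default_def rev_nth hd_conv_nth)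
  then have "?p \<noteq> 0" using *(2) by (metis coeff_0)
  moreover have "coeff ?p k \<in> K" for k
    using * assms(1) by (auto simp: nth_default_def rev_nth subfield_set_def)
  moreover have "poly ?p y = 0" using xs(3) by (simp add: eval_type_algebra z)
  ultimately show ?thesis by blast
qed

lemma transcendental_polyD:
  assumes "ring.transcendental ring_of_type_algebra K (y :: 'f::field)" "p \<noteq> 0" "\<And>k. coeff p k \<in> K"
  shows "poly p y \<noteq> 0"
proof
  assume 0: "poly p y = 0"
  interpret R: field "ring_of_type_algebra :: 'f ring" by (rule field_from_type_algebra)
  have z: "\<zero>\<^bsub>ring_of_type_algebra\<^esub> = (0::'f)" by (simp add: type_ring_simps)
  let ?xs = "rev (coeffs p)"
  have hd: "hd ?xs = lead_coeff p" using assms(2) by (simp add: hd_rev last_coeffs_eq_coeff_degree)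
  have "set ?xs \<subseteq> K" using assms(3) by (auto simp: coeffs_def)
  then have "?xs \<in> carrier (univ_poly ring_of_type_algebra K)"
    unfolding univ_poly_carrier[symmetric] polynomial_def using hd assms(2) by (simp add: type_ring_simps)
  moreover have "R.eval ?xs y = \<zero>\<^bsub>ring_of_type_algebra\<^esub>"
    using 0 by (simp add: eval_type_algebra z)
  moreover have "(R.transcendental over K) y" using assms(1) by (simp add: over_def)
  ultimately have "?xs = []" using R.eval_transcendental by blast
  then show False using assms(2) by simp
qed

lemma generate_field_subfield_set:
  assumes "subfield_set (E :: 'f::field set)" "H \<subseteq> E"
  shows "generate_field ring_of_type_algebra H \<subseteq> E"
proof -
  interpret R: field "ring_of_type_algebra :: 'f ring" by (rule field_from_type_algebra)
  show ?thesis
    by (rule R.generate_field_min_subfield1[OF _ subfield_set_subfield[OF assms(1)] assms(2)])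
      (simp add: type_ring_simps)
qed

text \<open>\<open>B\<close> consists of a spanning list; linear combinations stay inside any set
  that contains the coefficients and is closed under sums and products.\<close>

lemma finite_field_extD:
  assumes "subfield_set (K :: 'f::field set)" "finite_field_ext K"
  obtains B where "finite B" "\<And>E. ring_closed E \<Longrightarrow> 0 \<in> E \<Longrightarrow> K \<subseteq> E \<Longrightarrow> B \<subseteq> E \<Longrightarrow> E = UNIV"
proof -
  interpret R: field "ring_of_type_algebra :: 'f ring" by (rule field_from_type_algebra)
  have z: "\<zero>\<^bsub>ring_of_type_algebra\<^esub> = (0::'f)" by (simp add: type_ring_simps)
  obtain n where "R.dimension n K UNIV"
    using assms(2) unfolding finite_field_ext_def R.finite_dimension_def by blast
  then obtain Us where Us: "R.Span K Us = UNIV"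
    using R.exists_base[OF subfield_set_subfield[OF assms(1)]] by blast
  show ?thesis
  proof (rule that[of "set Us"])
    fix E assume E: "ring_closed E" "0 \<in> E" "K \<subseteq> E" "set Us \<subseteq> E"
    have "R.Span K us \<subseteq> E" if "set us \<subseteq> E" for us
      using that
    proof (induction us)
      case Nil
      then show ?case using E by (simp add: z)
    next
      case (Cons a us)
      show ?case
      proof
        fix x assume "x \<in> R.Span K (a # us)"
        moreover have "R.Span K (a # us) = R.line_extension K a (R.Span K us)" by simp
        ultimately obtain k b where kb: "k \<in> K" "b \<in> R.Span K us"
          "x = k \<otimes>\<^bsub>ring_of_type_algebra\<^esub> a \<oplus>\<^bsub>ring_of_type_algebra\<^esub> b"
          using R.line_extension_mem_iff by blast
        then have "x = k * a + b" by (simp add: type_ring_simps)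
        moreover have "b \<in> E" using kb(2) Cons by auto
        ultimately show "x \<in> E" using kb(1) Cons.prems E by (auto simp: ring_closed_def)
      qed
    qed
    then show "E = UNIV" using Us E by blast
  qed simp
qed

text \<open>The extension generated by finitely many algebraic elements has finite dimension, and it
  is one of the sets \<open>E\<close> that the hypothesis on \<open>B\<close> declares to be
  everything.\<close>

lemma finite_field_extI:
  assumes K: "subfield_set (K :: 'f::field set)" and alg: "algebraic_field_ext K"
    and B: "finite B" "\<And>E. K \<subseteq> E \<Longrightarrow> B \<subseteq> E \<Longrightarrow> ring_closed E \<Longrightarrow> E = UNIV"
  shows "finite_field_ext K"
proof -
  interpret R: field "ring_of_type_algebra :: 'f ring" by (rule field_from_type_algebra)
  have sf: "subfield K ring_of_type_algebra" by (rule subfield_set_subfield[OF K])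
  then have sr: "subring K ring_of_type_algebra" by (rule subfieldE(1))
  obtain xs where xs: "set xs = B" using B(1) finite_list by blast
  have car: "carrier (ring_of_type_algebra :: 'f ring) = UNIV" by (simp add: type_ring_simps)
  then have xc: "set xs \<subseteq> carrier ring_of_type_algebra" "K \<subseteq> carrier ring_of_type_algebra" by simp_all
  let ?E = "R.finite_extension K xs"
  have fd: "R.finite_dimension K ?E"
    by (rule R.finite_extension_finite_dimension(1)[OF sf xc(1)])
      (use alg in \<open>simp add: algebraic_field_ext_def over_def\<close>)
  have "subring ?E ring_of_type_algebra" by (rule R.finite_extension_is_subring[OF sr xc(1)])
  then have "ring_closed ?E"
    using subringE(6,7)[of ?E ring_of_type_algebra] by (simp add: ring_closed_def type_ring_simps)
  then have "?E = UNIV"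
    using B(2)[of ?E] R.finite_extension_incl[OF xc(2,1)] R.finite_extension_mem[OF sr xc(1)] xs by blast
  then show ?thesis using fd by (simp add: finite_field_ext_def)
qed

section \<open>Extensions from stages and limits of stages\<close>

context aug
begin

text \<open>No positive multiple of \<gamma> is a value of \<open>V\<close>, so a term of value
  \<open>nmul n \<gamma>\<close> can only stand at exponent \<open>n\<close>. The residue of
  \<open>F\<close> divided by \<open>\<phi> ^ n\<close> is thus that of the digit at
  \<open>n\<close>, and the residue field does not change.\<close>

lemma fract_val_transcendental:
  assumes distinct: "\<And>k a. 0 < k \<Longrightarrow> degree a < degree \<phi> \<Longrightarrow> a \<noteq> 0 \<Longrightarrow> V a \<noteq> nmul k \<gamma>"
  shows "fract_val W (\<lambda>n F. R (cf F n)) \<gamma>"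
proof -
  have crit: "k = n" if k: "k \<in> crit F (nmul n \<gamma>)" for F n k
  proof (rule ccontr)
    assume "k \<noteq> n"
    have nz: "cf F k \<noteq> 0" and V: "V (cf F k) = nmul n \<gamma> - nmul k \<gamma>"
      using k by (auto simp: crit_def algebra_simps)
    show False
    proof (cases "k < n")
      case True
      then show False using distinct[of "n - k" "cf F k"] nz V by (simp add: nmul_diff)
    next
      case False
      \<comment> \<open>Here the value of the digit is a negative multiple of \<gamma>; passing to
        an inverse makes \<open>distinct\<close> applicable.\<close>
      obtain b where "degree b < degree \<phi>" "b \<noteq> 0" "V b = - V (cf F k)"
        using inverse_small[of "cf F k"] nz by auto
      then show False using distinct[of "k - n" b] V False \<open>k \<noteq> n\<close> by (simp add: nmul_diff)
    qed
  qed
  have ge: "vge (cf F n) 0" if "wge F (nmul n \<gamma>)" for F n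
    using that by (auto simp: wge_def dest: spec[of _ n])
  have zero: "R (cf F n) = 0" if "wge F (nmul n \<gamma>)" "n \<notin> crit F (nmul n \<gamma>)" for F n
    using R_eq_0_iff[OF ge[OF that(1)]] not_crit[OF that] by simp
  have nonzero: "R (cf F n) \<noteq> 0" if "wge F (nmul n \<gamma>)" "n \<in> crit F (nmul n \<gamma>)" for F n
    using R_eq_0_iff[OF ge[OF that(1)]] that(2) by (auto simp: crit_def vgt_def)
  show ?thesis
  proof (unfold_locales, goal_cases)
    case (1 F n G)
    then show ?case by (simp add: W_vge cf_add R_add ge)
  next
    case (2 F m G n)
    then have g: "wge F (nmul m \<gamma>)" "wge G (nmul n \<gamma>)" by (simp_all add: W_vge)
    then have g2: "wge (F * G) (nmul (m + n) \<gamma>)" using wge_mult by (simp add: nmul_add)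
    show ?case
    proof (cases "m \<in> crit F (nmul m \<gamma>) \<and> n \<in> crit G (nmul n \<gamma>)")
      case True
      have "vgt (cf (F * G) (m + n) - cf F m * cf G n) (nmul m \<gamma> + nmul n \<gamma> - nmul (m + n) \<gamma>)"
        using True crit by (intro crit_mult_unique(1)[OF g]) blast+
      then have "vgt (cf (F * G) (m + n) - cf F m * cf G n) 0" by (simp add: nmul_add)
      then have "R (cf (F * G) (m + n)) = R (cf F m * cf G n)" by (rule R_eqI[OF ge[OF g2]])
      then show ?thesis using R_mult[OF ge[OF g(1)] ge[OF g(2)]] by simp
    next
      case False
      have "m + n \<notin> crit (F * G) (nmul m \<gamma> + nmul n \<gamma>)"
        using False crit[of _ F m] crit[of _ G n] by (intro crit_mult_none[OF g]) blast
      then have "R (cf (F * G) (m + n)) = 0" by (intro zero[OF g2]) (simp add: nmul_add)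
      then show ?thesis using False zero[OF g(1)] zero[OF g(2)] by auto
    qed
  next
    case (3 F n)
    then have g: "wge F (nmul n \<gamma>)" by (simp add: W_vge)
    have "wgt F (nmul n \<gamma>) \<longleftrightarrow> n \<notin> crit F (nmul n \<gamma>)"
    proof
      assume "n \<notin> crit F (nmul n \<gamma>)"
      then have "k \<notin> crit F (nmul n \<gamma>)" for k using crit by blast
      then show "wgt F (nmul n \<gamma>)" unfolding wgt_def using not_crit[OF g] by blast
    qed (auto simp: wgt_def crit_def vgt_def dest: spec[of _ n])
    then show ?case using zero[OF g] nonzero[OF g] by (auto simp: W_vgt)
  next
    case (4 G)
    obtain k where "k \<in> crit G (W G)" using crit_nonempty[OF 4] by blast
    then have k: "cf G k \<noteq> 0" "V (cf G k) + nmul k \<gamma> = W G" by (auto simp: crit_def)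
    obtain s where s: "degree s < degree \<phi>" "s \<noteq> 0" "V s = - V (cf G k)"
      using inverse_small[of "cf G k"] k(1) by auto
    have "W (s * G) = nmul k \<gamma>"
      unfolding k(2)[symmetric] using s 4 k(2)[symmetric] by (simp add: W.V_mult W_small)
    then show ?case using s(2) by blast
  qed
qed

text \<open>With \<gamma> a value of \<open>V\<close>, small polynomials normalise everything to
  value 0, so one level is enough. The Gauss residue map is composed with the embedding of
  polynomials into rational functions, as a field is required.\<close>

lemma fract_val_residual:
  assumes d: "degree d < degree \<phi>" "d \<noteq> 0" "V d = \<gamma>"
  shows "fract_val W (\<lambda>n F. Fract (T d F) 1) 0"
proof -
  interpret T: pvres "\<lambda>F. F = 0" W "T d" by (rule pvres_T[OF d])
  show ?thesis
  proof (unfold_locales, goal_cases)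
    case (4 G)
    obtain s where "degree s < degree \<phi>" "s \<noteq> 0" "W (s * G) = 0" by (rule ex_normalizer[OF d 4])
    then show ?case by auto
  qed (simp_all add: T.R_add T.R_mult T.R_eq_0_iff Zero_fract_def eq_fract)
qed

text \<open>Horner's scheme: coefficients lift because \<open>R\<close> is onto, and
  \<open>d' * \<phi>\<close> lifts the indeterminate.\<close>

lemma T_surj:
  assumes d: "degree d < degree \<phi>" "d \<noteq> 0" "V d = \<gamma>" and R: "ress \<phi> V R = UNIV"
  shows "\<exists>F. wge F 0 \<and> T d F = p"
proof (induction p)
  case 0
  show ?case by (intro exI[of _ 0]) (simp add: T_def[OF d])
next
  case (pCons a p)
  interpret T: pvres "\<lambda>F. F = 0" W "T d" by (rule pvres_T[OF d])
  obtain F where F: "wge F 0" "T d F = p" using pCons.IH by blast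
  have "a \<in> ress \<phi> V R" using R by simp
  then obtain b where b: "degree b < degree \<phi>" "b = 0 \<or> 0 \<le> V b" "R b = a"
    unfolding ress_def by auto
  then have gb: "wge b 0" by (simp add: wge_small vge_def)
  obtain d' where d': "degree d' < degree \<phi>" "d' \<noteq> 0" "\<phi> dvd d * d' - 1" "V d' = - \<gamma>"
    using inverse_small[of d] d by auto
  have dd: "vge (d * d') 0" using d d' by (simp add: vge_def V_mult)
  have R1: "R (d * d') = 1" using R_cong[OF dd d'(3)] by simp
  have Tx: "T d (d' * \<phi>) = Polynomial.monom 1 1"
  proof (rule poly_eqI)
    show "coeff (T d (d' * \<phi>)) k = coeff (Polynomial.monom 1 1) k" for k
      using cf_monom[OF d'(1), of 1 k] R1 by (cases "k = 1") (auto simp: coeff_T[OF d] mult.commute[of d'])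
  qed
  have gx: "wge (d' * \<phi>) 0" using wge_monom[OF d'(1), of 0 1] d' by (simp add: vge_def)
  have gm: "wge (d' * \<phi> * F) 0" using wge_mult[OF gx F(1)] by simp
  have "T d (b + d' * \<phi> * F) = [:a:] + Polynomial.monom 1 1 * p"
    using T_add[OF d gb gm] T_mult[OF d gx F(1)] T_small[OF d b(1)] F b Tx by simp
  also have "\<dots> = pCons a p" by (simp add: monom_altdef)
  finally show ?case using wge_add[OF gb gm] by (intro exI[of _ "b + d' * \<phi> * F"] conjI)
qed

end

section \<open>The limit of a chain of stages\<close>

locale stage_chain =
  fixes \<phi> :: "nat \<Rightarrow> 'm::field poly" and V :: "nat \<Rightarrow> 'm poly \<Rightarrow> 'g::linordered_ab_group_add"
    and R :: "nat \<Rightarrow> 'm poly \<Rightarrow> 'e::field" and \<beta> :: "nat \<Rightarrow> 'g"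
  assumes stage: "stage (\<phi> n) (V n) (R n) (\<beta> n)"
    and le_Suc: "stage_le (\<phi> n) (V n) (R n) (\<phi> (Suc n)) (V (Suc n)) (R (Suc n))"
    and unbounded: "\<exists>n. k < degree (\<phi> n)"
begin

lemma le: "m \<le> n \<Longrightarrow> stage_le (\<phi> m) (V m) (R m) (\<phi> n) (V n) (R n)"
  by (induction rule: dec_induct) (auto intro: stage_le_refl stage_le_trans le_Suc)

text \<open>Any stage of degree above that of \<open>F\<close> would do: by \<open>stage_le\<close>
  all later ones give the same value and residue.\<close>

definition lev :: "'m poly \<Rightarrow> nat" where "lev F = (LEAST n. degree F < degree (\<phi> n))"

lemma lev: "degree F < degree (\<phi> (lev F))"
  unfolding lev_def by (rule LeastI_ex) (rule unbounded)

lemma lev_le: "degree F < degree (\<phi> n) \<Longrightarrow> lev F \<le> n"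
  unfolding lev_def by (rule Least_le)

definition W :: "'m poly \<Rightarrow> 'g" where "W F = V (lev F) F"
definition T :: "'m poly \<Rightarrow> 'e" where "T F = R (lev F) F"

lemma
  assumes "degree F < degree (\<phi> n)"
  shows W_eq: "F \<noteq> 0 \<Longrightarrow> W F = V n F" and T_eq: "T F = R n F"
proof -
  have "stage_le (\<phi> (lev F)) (V (lev F)) (R (lev F)) (\<phi> n) (V n) (R n)"
    by (rule le[OF lev_le[OF assms]])
  then have "R n F = R (lev F) F" "F \<noteq> 0 \<Longrightarrow> V n F = V (lev F) F"
    using lev[of F] unfolding stage_le_def by blast+
  then show "F \<noteq> 0 \<Longrightarrow> W F = V n F" "T F = R n F" by (simp_all add: W_def T_def)
qed

text \<open>Each law involves finitely many polynomials, and some stage has degree above all of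
  them. At that stage they are reduced, so a nonzero one is not divisible by the key polynomial;
  this is why only 0 is left with value infinity.\<close>

lemma pvres_limit: "pvres (\<lambda>F. F = 0) W T"
proof -
  have big: "\<exists>n. degree a < degree (\<phi> n) \<and> degree b < degree (\<phi> n) \<and>
      degree (a * b) < degree (\<phi> n) \<and> degree (a + b) < degree (\<phi> n)" for a b :: "'m poly"
  proof -
    obtain n where "degree a + degree b < degree (\<phi> n)" using unbounded by blast
    then show ?thesis
      using degree_mult_le[of a b] degree_add_le_max[of a b] by (intro exI[of _ n]) linarith
  qed
  interpret pval "\<lambda>F. F = 0" W
  proof
    fix a b :: "'m poly" assume nz: "a \<noteq> 0" "b \<noteq> 0"
    obtain n where n: "degree a < degree (\<phi> n)" "degree b < degree (\<phi> n)"
      "degree (a * b) < degree (\<phi> n)" "degree (a + b) < degree (\<phi> n)" using big by blast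
    interpret st: stage "\<phi> n" "V n" "R n" "\<beta> n" by (rule stage)
    show "W (a * b) = W a + W b"
      using st.V_mult[of a b] n nz by (simp add: W_eq[of _ n])
    assume "a + b \<noteq> 0"
    then show "min (W a) (W b) \<le> W (a + b)"
      using st.V_add[of a b] n nz by (simp add: W_eq[of _ n])
  qed auto
  have ge: "vge a 0 \<longleftrightarrow> pval.vge (\<lambda>F. \<phi> n dvd F) (V n) a 0"
    and gt: "vgt a 0 \<longleftrightarrow> pval.vgt (\<lambda>F. \<phi> n dvd F) (V n) a 0" if "degree a < degree (\<phi> n)" for a n
  proof -
    interpret st: stage "\<phi> n" "V n" "R n" "\<beta> n" by (rule stage)
    show "vge a 0 \<longleftrightarrow> st.vge a 0" "vgt a 0 \<longleftrightarrow> st.vgt a 0"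
      using that W_eq[OF that] unfolding vge_def st.vge_def vgt_def st.vgt_def
      by (cases "a = 0", simp_all)+
  qed
  show ?thesis
  proof
    obtain n where n: "degree (1::'m poly) < degree (\<phi> n)" using unbounded by auto
    interpret st: stage "\<phi> n" "V n" "R n" "\<beta> n" by (rule stage)
    show "T 1 = 1" using T_eq[OF n] by simp
  next
    fix a b :: "'m poly" assume v: "vge a 0" "vge b 0"
    obtain n where n: "degree a < degree (\<phi> n)" "degree b < degree (\<phi> n)"
      "degree (a * b) < degree (\<phi> n)" "degree (a + b) < degree (\<phi> n)" using big by blast
    interpret st: stage "\<phi> n" "V n" "R n" "\<beta> n" by (rule stage)
    have "st.vge a 0" "st.vge b 0" using v ge n by blast+
    then show "T (a + b) = T a + T b" "T (a * b) = T a * T b"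
      using st.R_add st.R_mult n by (simp_all add: T_eq[of _ n])
  next
    fix a :: "'m poly" assume v: "vge a 0"
    obtain n where n: "degree a < degree (\<phi> n)" using unbounded by blast
    interpret st: stage "\<phi> n" "V n" "R n" "\<beta> n" by (rule stage)
    have "st.vge a 0" using v ge n by blast
    then show "T a = 0 \<longleftrightarrow> vgt a 0"
      using st.R_eq_0_iff gt[OF n] by (simp add: T_eq[OF n])
  qed
qed

lemma fract_val_limit: "fract_val W (\<lambda>_. T) 0"
proof -
  interpret pvres "\<lambda>F. F = 0" W T by (rule pvres_limit)
  show ?thesis
  proof (unfold_locales, goal_cases)
    case (4 G)
    obtain n where n: "degree G < degree (\<phi> n)" using unbounded by blast
    interpret st: stage "\<phi> n" "V n" "R n" "\<beta> n" by (rule stage)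
    obtain s where s: "degree s < degree (\<phi> n)" "s \<noteq> 0" "V n s = - V n G"
      using st.inverse_small[of G] n 4 by auto
    have "W (s * G) = 0" using s n 4 by (simp add: V_mult W_eq[of _ n])
    then show ?case using s(2) by auto
  qed (simp_all add: R_add R_mult R_eq_0_iff)
qed

end

section \<open>Polynomials under a field embedding\<close>

locale field_hom_to = 
  fixes i :: "'k::field \<Rightarrow> 'm::field"
  assumes i_hom: "i \<in> ring_hom ring_of_type_algebra ring_of_type_algebra"
begin

lemma i_add: "i (a + b) = i a + i b" and i_mult: "i (a * b) = i a * i b" and i_1: "i 1 = 1"
  using ring_hom_add[OF i_hom, of a b] ring_hom_mult[OF i_hom, of a b] ring_hom_one[OF i_hom]
  by (simp_all add: type_ring_simps)

lemma i_0 [simp]: "i 0 = 0"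
  using i_add[of 0 0] by (simp only: add_0_left add_cancel_right_right)

lemma i_uminus: "i (- a) = - i a"
  using i_add[of a "- a"] by (simp add: eq_neg_iff_add_eq_0 add.commute)

lemma i_diff: "i (a - b) = i a - i b"
  using i_add[of a "- b"] by (simp add: i_uminus)

lemma i_eq_0_iff [simp]: "i a = 0 \<longleftrightarrow> a = 0"
proof
  show "i a = 0 \<Longrightarrow> a = 0"
    using i_mult[of a "1 / a"] i_1 by (cases "a = 0") auto
qed simp

lemma i_sum: "i (sum f A) = (\<Sum>x\<in>A. i (f x))"
  by (induction A rule: infinite_finite_induct) (simp_all add: i_add)

abbreviation mp :: "'k poly \<Rightarrow> 'm poly" where "mp \<equiv> map_poly i"

lemma coeff_mp [simp]: "coeff (mp p) k = i (coeff p k)"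
  by (simp add: coeff_map_poly)

lemma degree_mp [simp]: "degree (mp p) = degree p"
  by (rule degree_map_poly) simp

lemma mp_add: "mp (p + q) = mp p + mp q" and mp_diff: "mp (p - q) = mp p - mp q"
  by (rule poly_eqI; simp add: i_add i_diff)+

lemma mp_mult: "mp (p * q) = mp p * mp q"
  by (rule poly_eqI) (simp add: coeff_mult i_sum i_mult)

lemma mp_1 [simp]: "mp 1 = 1"
  by (simp add: i_1)

lemma mp_const [simp]: "mp [:a:] = [:i a:]"
  by (rule poly_eqI) (auto simp: coeff_pCons split: nat.splits)

lemma mp_eq_0_iff [simp]: "mp p = 0 \<longleftrightarrow> p = 0"
  by (simp add: poly_eq_iff)

lemma mp_mod: "mp (p mod q) = mp p mod mp q"
proof (cases "q = 0")
  case False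
  have "mp p = mp (p div q * q + p mod q)" by simp
  then have "mp p mod mp q = (mp (p div q) * mp q + mp (p mod q)) mod mp q"
    by (simp only: mp_add mp_mult)
  also have "\<dots> = mp (p mod q) mod mp q" by simp
  also have "\<dots> = mp (p mod q)"
    using degree_mod_less[OF False, of p] by (auto simp: mod_poly_less)
  finally show ?thesis by simp
qed simp

lemma mod_closed_mp: "mod_closed (range mp)"
  unfolding mod_closed_def
proof (intro conjI ballI)
  show "0 \<in> range mp" by (rule range_eqI[of _ _ 0]) simp
  show "1 \<in> range mp" by (rule range_eqI[of _ _ 1]) simp
  fix a b assume "a \<in> range mp" "b \<in> range mp"
  then obtain p q where "a = mp p" "b = mp q" by auto
  then show "a + b \<in> range mp" "a - b \<in> range mp" "a * b \<in> range mp" "a mod b \<in> range mp"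
    by (simp_all flip: mp_add mp_diff mp_mult mp_mod)
qed

end

section \<open>Perturbing the last key polynomial by a transcendental constant\<close>

locale immediate_stage = stage \<phi> V R \<beta> + field_hom_to i
  for \<phi> :: "'m::field poly" and V :: "'m poly \<Rightarrow> 'g::linordered_ab_group_add"
    and R :: "'m poly \<Rightarrow> 'e::field" and \<beta> and i :: "'k::field \<Rightarrow> 'm" +
  fixes \<phi>0 :: "'k poly" and z :: 'm
  assumes phi0: "\<phi> = map_poly i \<phi>0"
    and transc: "\<And>p. p \<noteq> 0 \<Longrightarrow> poly (map_poly i p) z \<noteq> 0"
    and z_large: "\<beta> < V [:z:]"
begin

definition \<psi> :: "'m poly" where "\<psi> = \<phi> - [:z:]"

text \<open>The reduced representative of \<open>F\<close> modulo \<psi>. Modulo \<psi> the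
  polynomial \<phi> becomes the constant \<open>z\<close>, so the class of the indeterminate is
  transcendental over \<open>K\<close> while reduced representatives keep their old values.\<close>

definition E :: "'k poly \<Rightarrow> 'm poly" where "E F = mp F mod \<psi>"

lemma z_nz: "z \<noteq> 0"
  using transc[of "[:0, 1:]"] by (auto simp: map_poly_pCons i_1)

lemma degree_psi [simp]: "degree \<psi> = degree \<phi>"
  unfolding \<psi>_def diff_conv_add_uminus using deg_pos by (intro degree_add_eq_left) simp

lemma psi_nz [simp]: "\<psi> \<noteq> 0"
  using degree_psi deg_pos by (metis degree_0 less_irrefl)

lemma degree_E [simp]: "degree (E F) < degree \<phi>"
  using degree_mod_less[OF psi_nz, of "mp F"] deg_pos by (auto simp: E_def)

lemma mod_psi:
  assumes "degree a < degree \<phi>" "degree b < degree \<phi>"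
  shows "a * b mod \<psi> = a * b mod \<phi> + [:z:] * (a * b div \<phi>)"
proof -
  define q where "q = a * b div \<phi>"
  define r where "r = a * b mod \<phi>"
  have "a * b = q * \<phi> + r" unfolding q_def r_def by (rule div_mult_mod_eq[symmetric])
  also have "\<dots> = q * \<psi> + (r + [:z:] * q)" by (simp add: \<psi>_def algebra_simps)
  finally have "a * b mod \<psi> = (q * \<psi> + (r + [:z:] * q)) mod \<psi>" by (rule arg_cong)
  also have "\<dots> = (r + [:z:] * q) mod \<psi>" by (rule mod_mult_self3)
  also have "\<dots> = r + [:z:] * q"
  proof (rule mod_poly_less)
    have "degree ([:z:] * q) < degree \<phi>"
      using degree_quot_small[OF assms] by (simp add: q_def z_nz)
    moreover have "degree r < degree \<phi>" by (simp add: r_def)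
    ultimately show "degree (r + [:z:] * q) < degree \<psi>" unfolding degree_psi by (intro degree_add_less)
  qed
  finally show ?thesis by (simp only: q_def r_def)
qed

text \<open>Modulo \<psi>, the term \<open>q * \<phi>\<close> of a product turns into
  \<open>[:z:] * q\<close> instead of 0. Since the value of \<open>z\<close> exceeds \<beta>, this
  is negligible, so reduction modulo \<psi> and reduction modulo \<phi> give the same initial
  form.\<close>

lemma psi_prod:
  assumes "degree a < degree \<phi>" "degree b < degree \<phi>" "vge a g" "vge b h"
  shows "vgt (a * b - a * b mod \<psi>) (g + h)"
proof -
  define q where "q = a * b div \<phi>"
  define r where "r = a * b mod \<phi>"
  have ab: "a * b = q * \<phi> + r" unfolding q_def r_def by (rule div_mult_mod_eq[symmetric])
  have m: "a * b mod \<psi> = r + [:z:] * q" unfolding q_def r_def by (rule mod_psi[OF assms(1,2)])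
  have "vgt ([:z:] * q) (V [:z:] + (g + h - V [:z:]))"
    unfolding q_def by (rule vgt_mult[OF vge_self small_prod[OF assms z_large]])
  then have "vgt (- ([:z:] * q)) (g + h)" by simp
  moreover have "\<phi> dvd (a * b - a * b mod \<psi>) - (- ([:z:] * q))"
  proof -
    have "(a * b - a * b mod \<psi>) - (- ([:z:] * q)) = a * b - r" unfolding m by simp
    also have "\<dots> = q * \<phi>" unfolding ab by simp
    finally show ?thesis by simp
  qed
  ultimately show ?thesis using vgt_cong by blast
qed

lemma E_add: "E (F + G) = E F + E G"
  by (simp add: E_def mp_add poly_mod_add_left)

lemma E_mult: "E (F * G) = E F * E G mod \<psi>"
  by (simp add: E_def mp_mult mod_mult_eq)

lemma E_small: "degree F < degree \<phi> \<Longrightarrow> E F = mp F"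
  by (simp add: E_def mod_poly_less)

text \<open>Expand \<open>F\<close> in powers of \<open>\<phi>0\<close> over \<open>K\<close> and
  put \<open>z\<close> for \<open>\<phi>0\<close>. The polynomial \<open>A j\<close> collects the
  \<open>j\<close>-th coefficients of all the digits, so some \<open>A j\<close> is nonzero when
  \<open>F\<close> is.\<close>

lemma E_coeffs:
  "\<exists>A. (\<forall>j. coeff (E F) j = poly (mp (A j)) z) \<and> (F \<noteq> 0 \<longrightarrow> (\<exists>j. A j \<noteq> 0))"
proof (induction "degree F" arbitrary: F rule: less_induct)
  case less
  show ?case
  proof (cases "F = 0")
    case True
    then show ?thesis by (intro exI[of _ "\<lambda>_. 0"]) (simp add: E_def)
  next
    case False
    let ?q = "F div \<phi>0" and ?r = "F mod \<phi>0"
    have d0: "degree \<phi>0 = degree \<phi>" by (simp add: phi0)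
    have p0: "\<phi>0 \<noteq> 0" using d0 deg_pos by auto
    have qA: "\<exists>A. (\<forall>j. coeff (E ?q) j = poly (mp (A j)) z) \<and> (?q \<noteq> 0 \<longrightarrow> (\<exists>j. A j \<noteq> 0))"
    proof (cases "?q = 0")
      case True
      then show ?thesis by (intro exI[of _ "\<lambda>_. 0"]) (simp add: E_def)
    next
      case nz: False
      have "\<not> degree F < degree \<phi>0" using nz div_poly_less by blast
      have "degree ?q + degree \<phi>0 = degree (F - ?r)"
        using nz p0 by (simp add: minus_mod_eq_div_mult degree_mult_eq)
      also have "\<dots> \<le> max (degree F) (degree ?r)" by (rule degree_diff_le_max)
      also have "\<dots> \<le> degree F"
        using \<open>\<not> degree F < degree \<phi>0\<close> degree_mod_less[OF p0, of F] by auto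
      finally show ?thesis using less[of ?q] d0 deg_pos by simp
    qed
    then obtain A where A: "\<And>j. coeff (E ?q) j = poly (mp (A j)) z" "?q \<noteq> 0 \<Longrightarrow> \<exists>j. A j \<noteq> 0"
      by (elim exE conjE) blast
    have dr: "degree ?r < degree \<phi>" using degree_mod_less[OF p0, of F] d0 deg_pos by auto
    have Ephi: "E \<phi>0 = [:z:]"
    proof -
      have "\<phi> mod \<psi> = (\<psi> + [:z:]) mod \<psi>" by (simp add: \<psi>_def)
      also have "\<dots> = [:z:] mod \<psi>" by simp
      also have "\<dots> = [:z:]" using deg_pos by (simp add: mod_poly_less)
      finally show ?thesis by (simp only: E_def phi0[symmetric])
    qed
    have "E F = E (?q * \<phi>0 + ?r)" by simp
    also have "\<dots> = E ?q * [:z:] mod \<psi> + mp ?r" by (simp only: E_add E_mult Ephi E_small[OF dr])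
    also have "E ?q * [:z:] mod \<psi> = E ?q * [:z:]"
      using degree_E[of ?q] deg_pos by (intro mod_poly_less) (simp add: z_nz)
    finally have EF: "E F = E ?q * [:z:] + mp ?r" .
    \<comment> \<open>One more digit, the remainder \<open>?r\<close>, becomes the constant
      coefficient of each \<open>A j\<close>; multiplication by \<open>z\<close> shifts the
      others.\<close>
    show ?thesis
    proof (intro exI[of _ "\<lambda>j. pCons (coeff ?r j) (A j)"] conjI allI impI)
      show "coeff (E F) j = poly (mp (pCons (coeff ?r j) (A j))) z" for j
        unfolding EF by (simp add: A(1) map_poly_pCons)
      show "\<exists>j. pCons (coeff ?r j) (A j) \<noteq> 0"
      proof (cases "?r = 0")
        case True
        then have "?q \<noteq> 0" using False div_mult_mod_eq[of F \<phi>0] by auto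
        then show ?thesis using A(2) by auto
      next
        case False
        then obtain j where "coeff ?r j \<noteq> 0" by (auto simp: poly_eq_iff)
        then show ?thesis by (intro exI[of _ j]) simp
      qed
    qed
  qed
qed

lemma E_eq_0_iff [simp]: "E F = 0 \<longleftrightarrow> F = 0"
proof
  assume 0: "E F = 0"
  obtain A where A: "\<And>j. coeff (E F) j = poly (mp (A j)) z" "F \<noteq> 0 \<Longrightarrow> \<exists>j. A j \<noteq> 0"
    using E_coeffs[of F] by (elim exE conjE) blast
  have "A j = 0" for j using A(1)[of j] 0 transc[of "A j"] by auto
  then show "F = 0" using A(2) by blast
qed (simp add: E_def)

lemma pvres_immediate: "pvres (\<lambda>F. F = 0) (\<lambda>F. V (E F)) (\<lambda>F. R (E F))"
proof -
  have gt: "vgt (E F * E G - E (F * G)) (V (E F) + V (E G))" for F G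
    unfolding E_mult by (rule psi_prod) (simp_all add: vge_self)
  interpret W: pval "\<lambda>F. F = 0" "\<lambda>F. V (E F)"
  proof
    fix F G :: "'k poly" assume nz: "F \<noteq> 0" "G \<noteq> 0"
    then have n: "\<not> \<phi> dvd E F" "\<not> \<phi> dvd E G" by simp_all
    then have "\<not> \<phi> dvd E F * E G" "V (E F * E G) = V (E F) + V (E G)" by (simp_all add: N_mult V_mult)
    then show "V (E (F * G)) = V (E F) + V (E G)"
      using V_eq_of_vgt_diff[of "E F * E G" "E (F * G)"] gt by simp
    assume "F + G \<noteq> 0"
    then have "\<not> \<phi> dvd E (F + G)" by simp
    then show "min (V (E F)) (V (E G)) \<le> V (E (F + G))"
      using V_add[of "E F" "E G"] n by (simp add: E_add)
  qed auto
  have ge: "W.vge F 0 \<longleftrightarrow> vge (E F) 0" and gt': "W.vgt F 0 \<longleftrightarrow> vgt (E F) 0" for F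
    by (simp_all add: W.vge_def vge_def W.vgt_def vgt_def)
  show ?thesis
  proof
    have "E 1 = 1" using E_small[of 1] deg_pos by simp
    then show "R (E 1) = 1" by simp
  next
    fix F G assume "W.vge F 0" "W.vge G 0"
    then have g: "vge (E F) 0" "vge (E G) 0" by (simp_all add: ge)
    then show "R (E (F + G)) = R (E F) + R (E G)" by (simp add: E_add R_add)
    have "vgt (E F * E G - E (F * G)) (0 + 0)"
      unfolding E_mult by (rule psi_prod) (simp_all add: g)
    then have "R (E F * E G) = R (E (F * G))" by (intro R_eqI[OF vge_0_mult[OF g]]) simp
    then show "R (E (F * G)) = R (E F) * R (E G)" using R_mult[OF g] by simp
  next
    fix F assume "W.vge F 0"
    then show "R (E F) = 0 \<longleftrightarrow> W.vgt F 0" by (simp add: ge gt' R_eq_0_iff)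
  qed
qed

end

section \<open>The extensions of the theorem\<close>

lemma (in stage) ress_add:
  assumes "x \<in> ress \<phi> V R" "y \<in> ress \<phi> V R"
  shows "x + y \<in> ress \<phi> V R"
proof -
  obtain F G where "vge F 0" "R F = x" "vge G 0" "R G = y" using assms ress_iff by blast
  then show ?thesis unfolding ress_iff by (intro exI[of _ "F + G"]) (simp add: R_add vge_add)
qed

lemma (in stage) ress_uminus:
  assumes "x \<in> ress \<phi> V R"
  shows "- x \<in> ress \<phi> V R"
proof -
  obtain F where "vge F 0" "R F = x" using assms ress_iff by blast
  then show ?thesis unfolding ress_iff by (intro exI[of _ "- F"]) (simp add: R_uminus)
qed

lemma (in stage) subfield_ress: "subfield_set (ress \<phi> V R)"
  unfolding subfield_set_def ring_closed_def
proof (intro conjI ballI)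
  have "vge 1 0" by (simp add: vge_def)
  with ress_iff R_1 show "1 \<in> ress \<phi> V R" by blast
  show "inverse x \<in> ress \<phi> V R" if "x \<in> ress \<phi> V R" for x
    using that ress_inverse[of x] ress_0 by (cases "x = 0") simp_all
qed (simp_all add: ress_0 ress_add ress_mult ress_uminus)

lemma (in stage) vals_closed: "add_closed (vals \<phi> V)"
  unfolding add_closed_def by (simp add: vals_0 vals_add vals_uminus)

definition order_embedding :: "('g::linordered_ab_group_add \<Rightarrow> 'd::linordered_ab_group_add) \<Rightarrow> bool" where
  "order_embedding j \<longleftrightarrow> (\<forall>x y. j (x + y) = j x + j y) \<and> (\<forall>x y. j x \<le> j y \<longleftrightarrow> x \<le> y)"

lemma order_embeddingD:
  assumes "order_embedding j"
  shows "j (x + y) = j x + j y" "j x \<le> j y \<longleftrightarrow> x \<le> y" "j x < j y \<longleftrightarrow> x < y" "j 0 = 0"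
    "j (nmul n x) = nmul n (j x)" "0 \<le> j x \<longleftrightarrow> 0 \<le> x" "0 < j x \<longleftrightarrow> 0 < x" "j (- x) = - j x"
proof -
  show add: "j (x + y) = j x + j y" for x y using assms by (simp add: order_embedding_def)
  show le: "j x \<le> j y \<longleftrightarrow> x \<le> y" for x y using assms by (simp add: order_embedding_def)
  show less: "j x < j y \<longleftrightarrow> x < y" for x y using le[of y x] by (simp flip: not_le)
  show zero: "j 0 = 0" using add[of 0 0] by simp
  show "j (nmul n x) = nmul n (j x)" by (induction n) (simp_all add: zero add)
  show "0 \<le> j x \<longleftrightarrow> 0 \<le> x" using le[of 0 x] zero by simp
  show "0 < j x \<longleftrightarrow> 0 < x" using less[of 0 x] zero by simp
  show "j (- x) = - j x" using add[of x "- x"] zero by (simp add: eq_neg_iff_add_eq_0 add.commute)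
qed

locale setting =
  fixes v :: "'k::field \<Rightarrow> 'g::linordered_ab_group_add" and \<phi> :: "'k set \<Rightarrow> 'f::field"
  assumes v: "valuation v"
    and torsion: "torsion_group (value_quotient v)"
    and phi: "\<phi> \<in> ring_hom (residue_field v) ring_of_type_algebra"
    and alg: "algebraic_field_ext (\<phi> ` carrier (residue_field v))"
begin

definition r :: "'k \<Rightarrow> 'f" where "r a = \<phi> (residue v a)"

sublocale v: pvres "\<lambda>a. a = 0" v r
  unfolding r_def[abs_def] by (rule pvres_residue[OF v phi])

lemma kv_eq: "\<phi> ` carrier (residue_field v) = r ` {a. v.vge a 0}"
  unfolding carrier_residue_field[OF v] carrier_valuation_ring[OF v] by (simp add: image_image r_def)

lemma tors: "\<exists>n>0. \<exists>c\<noteq>0. nmul n g = v c"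
  by (rule torsion_value_quotient[OF v torsion])

lemma subfield_kv: "subfield_set (r ` {a. v.vge a 0})"
  unfolding subfield_set_def ring_closed_def
proof (intro conjI ballI)
  show "0 \<in> r ` {a. v.vge a 0}" by (rule image_eqI[of _ _ 0]) simp_all
  show "1 \<in> r ` {a. v.vge a 0}" by (rule image_eqI[of _ _ 1]) (simp_all add: v.vge_def)
  fix x assume "x \<in> r ` {a. v.vge a 0}"
  then obtain a where a: "v.vge a 0" "x = r a" by blast
  show "- x \<in> r ` {a. v.vge a 0}"
    by (rule image_eqI[of _ _ "- a"]) (simp_all add: a v.R_uminus)
  show "inverse x \<in> r ` {a. v.vge a 0}"
  proof (cases "x = 0")
    case True
    then show ?thesis by (intro image_eqI[of _ _ 0]) simp_all
  next
    case False
    then have va: "a \<noteq> 0" "v a = 0" using a v.R_eq_0_iff[of a] by (auto simp: v.vge_def v.vgt_def)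
    then have "v (1 / a) = 0" using v.V_mult[of a "1 / a"] by simp
    then have g: "v.vge (1 / a) 0" by (simp add: v.vge_def)
    have "x * r (1 / a) = 1" using v.R_mult[OF a(1) g] va a(2) by simp
    then have "inverse x = r (1 / a)" using False by (simp add: field_simps)
    then show ?thesis using g by blast
  qed
  fix y assume "y \<in> r ` {a. v.vge a 0}"
  then obtain b where b: "v.vge b 0" "y = r b" by blast
  show "x + y \<in> r ` {a. v.vge a 0}"
    by (rule image_eqI[of _ _ "a + b"]) (simp_all add: a b v.R_add v.vge_add)
  show "x * y \<in> r ` {a. v.vge a 0}"
    by (rule image_eqI[of _ _ "a * b"]) (simp_all add: a b v.R_mult v.vge_0_mult)
qed

lemma alg_poly: "\<exists>p. p \<noteq> 0 \<and> (\<forall>k. coeff p k \<in> r ` {a. v.vge a 0}) \<and> poly p y = 0"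
  using algebraic_polyD[OF subfield_kv, of y] alg unfolding algebraic_field_ext_def kv_eq by blast

lemma mod_closed_UNIV: "mod_closed UNIV"
  by (simp add: mod_closed_def)

text \<open>Applied to the identity for the extensions with values in
  \<open>\<Gamma>\<^sub>0\<close>, and to the inclusion of \<open>\<Gamma>\<^sub>0\<close> into its
  sum with the integers for the remaining one.\<close>

lemma tower_embedding:
  assumes j: "order_embedding j"
  shows "tower (\<lambda>a. j (v a)) r UNIV (range j)"
proof -
  note J = order_embeddingD[OF j]
  interpret u: pval "\<lambda>a. a = 0" "\<lambda>a. j (v a)"
  proof
    fix a b :: 'k assume nz: "a \<noteq> 0" "b \<noteq> 0"
    then show "j (v (a * b)) = j (v a) + j (v b)" by (simp add: v.V_mult J)
    assume "a + b \<noteq> 0"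
    then have "min (v a) (v b) \<le> v (a + b)" using nz by (intro v.V_add) simp_all
    then show "min (j (v a)) (j (v b)) \<le> j (v (a + b))" by (auto simp: min_def J split: if_splits)
  qed auto
  have ge: "u.vge a 0 \<longleftrightarrow> v.vge a 0" "u.vgt a 0 \<longleftrightarrow> v.vgt a 0" for a
    by (simp_all add: u.vge_def v.vge_def u.vgt_def v.vgt_def J)
  interpret u: pvres "\<lambda>a. a = 0" "\<lambda>a. j (v a)" r
    by unfold_locales (simp_all add: ge v.R_add v.R_mult v.R_eq_0_iff)
  show ?thesis
  proof
    show "mod_closed UNIV" by (rule mod_closed_UNIV)
    show "\<exists>a'. [:a':] \<in> UNIV \<and> (a = a' \<or> j (v a) < j (v (a - a')))" for a :: 'k by auto
    show "g + h \<in> range j" if gh: "g \<in> range j" "h \<in> range j" for g h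
    proof -
      obtain x y where "g = j x" "h = j y" using gh by blast
      then show ?thesis by (intro range_eqI[of _ _ "x + y"]) (simp add: J)
    qed
    show "\<exists>n>0. \<exists>c. c \<noteq> 0 \<and> nmul n g = j (v c)" if g: "g \<in> range j" for g
    proof -
      obtain x where x: "g = j x" using g by blast
      obtain n c where "0 < n" "c \<noteq> 0" "nmul n x = v c" using tors[of x] by blast
      then show ?thesis by (intro exI[of _ n] conjI exI[of _ c]) (simp_all add: x J(5)[symmetric])
    qed
    show "\<exists>p. p \<noteq> 0 \<and> (\<forall>k. coeff p k \<in> r ` {a. u.vge a 0}) \<and> poly p y = 0" for y
      using alg_poly[of y] by (simp only: ge)
  qed simp_all
qed

text \<open>A positive \<open>g\<close> is bounded by a multiple of itself that lies in
  \<open>vK\<close>; an element of positive value, which exists as \<open>v\<close> is non-trivial,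
  makes the inequality strict.\<close>

lemma cofinal_v:
  assumes "\<not> trivial_valuation v"
  shows "\<exists>c. c \<noteq> 0 \<and> g < v c"
proof -
  obtain c where c: "c \<noteq> 0" "v c \<noteq> 0"
  proof -
    have "0 \<in> value_group v" unfolding value_group_def by (rule image_eqI[of _ _ 1]) simp_all
    then have "\<exists>x\<in>value_group v. x \<noteq> 0" using assms unfolding trivial_valuation_def by blast
    then show ?thesis using that by (auto simp: value_group_def)
  qed
  obtain d where d: "d \<noteq> 0" "0 < v d"
  proof (cases "0 < v c")
    case True
    then show ?thesis using that c by blast
  next
    case False
    have "v (1 / c) = - v c" using v.V_mult[of c "1 / c"] c by (simp add: eq_neg_iff_add_eq_0 add.commute)
    then show ?thesis using that[of "1 / c"] c False by simp
  qed
  show ?thesis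
  proof (cases "0 < g")
    case True
    obtain n b where n: "0 < n" "b \<noteq> 0" "nmul n g = v b" using tors[of g] by blast
    have "g \<le> v b" using nmul_pos[OF True n(1)] n(3) by simp
    also have "v b < v b + v d" using d by simp
    also have "\<dots> = v (b * d)" using n d by (simp add: v.V_mult)
    finally show ?thesis using n d by (intro exI[of _ "b * d"]) simp
  next
    case False
    then show ?thesis using d by (intro exI[of _ d]) auto
  qed
qed

lemma nontrivial_tower_embedding:
  assumes j: "order_embedding j" and nt: "\<not> trivial_valuation v"
  shows "nontrivial_tower (\<lambda>a. j (v a)) r UNIV (range j)"
proof -
  interpret tower "\<lambda>a. j (v a)" r UNIV "range j" by (rule tower_embedding[OF j])
  show ?thesis
  proof
    fix g assume "g \<in> range j"
    then obtain x where "g = j x" by blast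
    then show "\<exists>c. c \<noteq> 0 \<and> g < j (v c)" using cofinal_v[OF nt, of x] by (simp add: order_embeddingD[OF j])
  qed
qed

lemma finite_generation:
  assumes "finite (carrier (value_quotient v))" "finite_field_ext (\<phi> ` carrier (residue_field v))"
  obtains A B where "finite A" "\<And>g. \<exists>c a. c \<noteq> 0 \<and> a \<in> A \<and> g = v c + a" "finite B"
    "\<And>E. ring_closed E \<Longrightarrow> 0 \<in> E \<Longrightarrow> r ` {a. v.vge a 0} \<subseteq> E \<Longrightarrow> B \<subseteq> E \<Longrightarrow> E = UNIV"
proof -
  obtain A where A: "finite A" "\<forall>g. \<exists>c a. c \<noteq> 0 \<and> a \<in> A \<and> g = v c + a"
    using assms(1) unfolding finite_value_quotient[OF v] by (elim exE conjE)
  show ?thesis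
  proof (rule finite_field_extD[OF subfield_kv assms(2)[unfolded kv_eq]])
    fix B :: "'f set"
    assume B: "finite B"
      "\<And>E. ring_closed E \<Longrightarrow> 0 \<in> E \<Longrightarrow> r ` {a. v.vge a 0} \<subseteq> E \<Longrightarrow> B \<subseteq> E \<Longrightarrow> E = UNIV"
    show ?thesis by (rule that[OF A(1) A(2)[rule_format] B])
  qed
qed

lemma ex_full_stage:
  fixes j :: "'g \<Rightarrow> 'd::linordered_ab_group_add"
  assumes fin: "finite (carrier (value_quotient v))" "finite_field_ext (\<phi> ` carrier (residue_field v))"
    and j: "order_embedding j" and nt: "\<not> trivial_valuation v"
  obtains \<phi>' V R \<beta> where "stage \<phi>' V R \<beta>" "\<And>a. a \<noteq> 0 \<Longrightarrow> V [:a:] = j (v a)" "\<And>a. R [:a:] = r a"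
    "vals \<phi>' V = range j" "ress \<phi>' V R = UNIV" "\<beta> \<in> range j"
proof -
  note J = order_embeddingD[OF j]
  interpret t: nontrivial_tower "\<lambda>a. j (v a)" r UNIV "range j"
    by (rule nontrivial_tower_embedding[OF j nt])
  show ?thesis
  proof (rule finite_generation[OF fin])
  fix A :: "'g set" and B :: "'f set"
  assume AB: "finite A" "\<And>g. \<exists>c a. c \<noteq> 0 \<and> a \<in> A \<and> g = v c + a" "finite B"
    "\<And>E. ring_closed E \<Longrightarrow> 0 \<in> E \<Longrightarrow> r ` {a. v.vge a 0} \<subseteq> E \<Longrightarrow> B \<subseteq> E \<Longrightarrow> E = UNIV"
  have "\<exists>\<phi>' V R \<beta>. t.gd \<phi>' V R \<beta> \<and> j ` A \<subseteq> vals \<phi>' V \<and> B \<subseteq> ress \<phi>' V R"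
    using AB by (intro t.gd_finite) auto
  then obtain \<phi>' V R \<beta> where gd: "t.gd \<phi>' V R \<beta>" "j ` A \<subseteq> vals \<phi>' V" "B \<subseteq> ress \<phi>' V R"
    by (elim exE conjE)
  then have good: "t.good \<phi>' V R \<beta>" and beta: "\<beta> \<in> range j" by (simp_all add: t.gd_def)
  interpret st: stage \<phi>' V R \<beta> by (rule t.good_base(1)[OF good])
  have sub: "vals \<phi>' V \<subseteq> range j" using good by (simp add: t.good_def)
  have "j x \<in> vals \<phi>' V" for x
  proof -
    obtain c a where c: "c \<noteq> 0" "a \<in> A" "x = v c + a" using AB(2) by blast
    then have "j (v c) + j a \<in> vals \<phi>' V" using t.good_base(4)[OF good] gd(2) by (intro st.vals_add) auto
    then show ?thesis using c by (simp add: J)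
  qed
  then have vals: "vals \<phi>' V = range j" using sub by blast
  have kv: "t.kv = r ` {a. v.vge a 0}"
    by (simp add: t.kv_def t.base.vge_def v.vge_def J)
  have sf: "subfield_set (ress \<phi>' V R)" by (rule st.subfield_ress)
  have "ress \<phi>' V R = UNIV"
    using sf t.good_base(5)[OF good] gd(3) unfolding kv subfield_set_def by (intro AB(4)) blast+
  from that[OF st.stage_axioms t.good_base(2,3)[OF good] vals this beta] show ?thesis .
  qed
qed

end

section \<open>Extensions built from a stage with full value group and residue field, or from a
  limit of stages\<close>

context setting
begin

lemma transcendental_extension:
  fixes \<theta> :: "'g \<times> int \<Rightarrow> 'd::linordered_ab_group_add"
  assumes st: "stage \<phi>' V R \<beta>" and const: "\<And>a. a \<noteq> 0 \<Longrightarrow> V [:a:] = \<theta> (v a, 0)" "\<And>a. R [:a:] = r a"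
    and vals: "vals \<phi>' V = range (\<lambda>x. \<theta> (x, 0))" and ress: "ress \<phi>' V R = UNIV" and beta: "\<beta> \<in> range (\<lambda>x. \<theta> (x, 0))"
    and add: "\<And>x m y n. \<theta> (x + y, m + n) = \<theta> (x, m) + \<theta> (y, n)" and bij: "bij \<theta>"
    and j: "order_embedding (\<lambda>x. \<theta> (x, 0))"
  shows "\<exists>w :: 'k poly fract \<Rightarrow> 'd. valuation_extends ratfun_const (\<lambda>a. \<theta> (a, 0)) v w \<and>
    value_group w = UNIV \<and> residue_field_iso_over ratfun_const v w \<phi>"
proof -
  note J = order_embeddingD[OF j]
  obtain b where b: "\<beta> = \<theta> (b, 0)" using beta by blast
  have inj: "\<theta> p = \<theta> q \<longleftrightarrow> p = q" for p q using bij by (auto dest: bij_is_inj injD)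
  have "\<exists>s. (s = 1 \<or> s = -1) \<and> 0 < \<theta> (0, s)"
  proof (cases "0 < \<theta> (0, 1)")
    case False
    have "\<theta> (0, 1) + \<theta> (0, -1) = 0" using add[of 0 0 1 "-1"] J(4) by simp
    then have "\<theta> (0, -1) = - \<theta> (0, 1)" by (simp add: eq_neg_iff_add_eq_0 add.commute)
    moreover have "\<theta> (0, 1) \<noteq> 0" using inj[of "(0, 1)" "(0, 0)"] J(4) by auto
    ultimately show ?thesis using False by (intro exI[of _ "-1"]) simp
  qed blast
  then obtain s where s: "s = 1 \<or> s = -1" "0 < \<theta> (0, s)" by blast
  \<comment> \<open>The sign \<open>s\<close> is chosen so that \<open>\<theta> (0, s)\<close> is
    positive in whatever ordering is given. Adding it to \<beta> exceeds \<beta> and leaves the old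
    value group, as the second component is not 0.\<close>
  define \<gamma> where "\<gamma> = \<theta> (b, s)"
  have "\<gamma> = \<beta> + \<theta> (0, s)" unfolding \<gamma>_def b using add[of b 0 0 s] by simp
  then have "\<beta> < \<gamma>" using s by simp
  then interpret aug \<phi>' V R \<beta> \<gamma> using st by (simp add: aug_def aug_axioms_def)
  have nmul_g: "nmul k \<gamma> = \<theta> (nmul k b, s * int k)" for k
  proof (induction k)
    case 0
    show ?case using J(4) by simp
  next
    case (Suc k)
    have "nmul (Suc k) \<gamma> = \<gamma> + \<theta> (nmul k b, s * int k)" by (simp add: Suc)
    also have "\<dots> = \<theta> (b, s) + \<theta> (nmul k b, s * int k)" by (simp only: \<gamma>_def)
    also have "\<dots> = \<theta> (b + nmul k b, s + s * int k)" by (rule add[symmetric])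
    finally show ?case by (simp add: algebra_simps)
  qed
  have fv: "fract_val W (\<lambda>n F. R (cf F n)) \<gamma>"
  proof (rule fract_val_transcendental)
    fix k :: nat and a :: "'k poly"
    assume k: "0 < k" "degree a < degree \<phi>'" "a \<noteq> 0"
    then have "V a \<in> range (\<lambda>x. \<theta> (x, 0))" using vals by (auto simp: vals_def)
    then show "V a \<noteq> nmul k \<gamma>" using k s(1) by (auto simp: nmul_g inj)
  qed
  have small: "degree [:a:] < degree \<phi>'" for a :: 'k using deg_pos by simp
  have attained: "\<exists>a. degree a < degree \<phi>' \<and> a \<noteq> 0 \<and> V a = \<theta> (x, 0)" for x
  proof -
    have "\<theta> (x, 0) \<in> vals \<phi>' V" unfolding vals by blast
    then show ?thesis unfolding vals_def by auto
  qed
  show ?thesis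
  proof (rule extension_from_fract_val[OF fv v])
    show "W [:a:] = \<theta> (v a, 0)" if "a \<noteq> 0" for a
      using that W_small[OF small, of a] const(1) by simp
    show "0 \<le> \<theta> (g, 0)" if "0 \<le> g" for g using that J(6) by simp
    show "R (cf [:a:] 0) = \<phi> (residue v a)" for a
      using const(2) by (simp add: cf_small[OF small] r_def)
    show "\<exists>F G. F \<noteq> 0 \<and> G \<noteq> 0 \<and> g = W F - W G" for g
    proof -
      obtain p where "\<theta> p = g" using bij by (metis bij_pointE)
      then obtain x n where g: "g = \<theta> (x, n)" by (cases p) auto
      \<comment> \<open>The power \<open>\<phi>' ^ k\<close> has second component
        \<open>s * int k\<close>; according to the sign of \<open>n\<close> it goes into the
        numerator or the denominator, and \<open>a\<close> corrects the first component by
        \<open>nmul k b\<close>.\<close>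
      define k where "k = nat \<bar>n\<bar>"
      have phi_k: "\<phi>' ^ k \<noteq> 0" by simp
      have Wk: "W (\<phi>' ^ k) = nmul k \<gamma>"
        using W_monom[of 1 k] deg_pos by simp
      show ?thesis
      proof (cases "n = s * int k")
        case True
        obtain a where a: "degree a < degree \<phi>'" "a \<noteq> 0" "V a = \<theta> (x - nmul k b, 0)"
          using attained by blast
        have "W (a * \<phi>' ^ k) = \<theta> (x - nmul k b, 0) + \<theta> (nmul k b, s * int k)"
          using W_monom[OF a(1,2)] a(3) by (simp add: nmul_g)
        also have "\<dots> = g" unfolding g True using add[of "x - nmul k b" "nmul k b" 0 "s * int k"] by simp
        finally have "g = W (a * \<phi>' ^ k) - W 1" by simp
        then show ?thesis using a(2) phi_k by (rule_tac exI[of _ "a * \<phi>' ^ k"], rule_tac exI[of _ 1]) simp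
      next
        case False
        then have n: "n + s * int k = 0" using s(1) by (auto simp: k_def)
        obtain a where a: "degree a < degree \<phi>'" "a \<noteq> 0" "V a = \<theta> (x + nmul k b, 0)"
          using attained by blast
        have "g + W (\<phi>' ^ k) = \<theta> (x + nmul k b, 0)"
          unfolding Wk nmul_g g using add[of x "nmul k b" n "s * int k"] n by simp
        also have "\<dots> = W a" using a W_small by simp
        finally have "g = W a - W (\<phi>' ^ k)" by (simp add: eq_diff_eq)
        then show ?thesis using a(2) phi_k by (rule_tac exI[of _ a], rule_tac exI[of _ "\<phi>' ^ k"]) simp
      qed
    qed
    show "\<exists>F G. (F = 0 \<or> 0 \<le> W F) \<and> G \<noteq> 0 \<and> W G = 0 \<and> R (cf F 0) = y * R (cf G 0)" for y
    proof -
      have "y \<in> ress \<phi>' V R" using ress by simp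
      then obtain a where a: "degree a < degree \<phi>'" "a = 0 \<or> 0 \<le> V a" "R a = y"
        unfolding ress_def by auto
      have d1: "degree (1 :: 'k poly) < degree \<phi>'" using deg_pos by simp
      have "a = 0 \<or> 0 \<le> W a" using a W_small[OF a(1)] by (cases "a = 0") simp_all
      then show ?thesis using a d1 by (rule_tac exI[of _ a], rule_tac exI[of _ 1]) (simp add: cf_small)
    qed
  qed
qed

text \<open>Since \<gamma> is a value of the stage, the value group stays the same and the residue
  of \<open>\<phi>'\<close> over \<open>d\<close> is an indeterminate over the old residue
  field.\<close>

lemma rational_residue_extension:
  assumes st: "stage \<phi>' V R \<beta>" and const: "\<And>a. a \<noteq> 0 \<Longrightarrow> V [:a:] = v a" "\<And>a. R [:a:] = r a"
    and vals: "vals \<phi>' V = UNIV" and ress: "ress \<phi>' V R = UNIV" and g: "\<beta> < \<gamma>"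
  shows "\<exists>w :: 'k poly fract \<Rightarrow> 'g. valuation_extends ratfun_const id v w \<and>
    value_group w = UNIV \<and> residue_field_iso_over ratfun_const v w (ratfun_const \<circ> \<phi>)"
proof -
  interpret aug \<phi>' V R \<beta> \<gamma> using st g by (simp add: aug_def aug_axioms_def)
  have attained: "\<exists>a. degree a < degree \<phi>' \<and> a \<noteq> 0 \<and> V a = x" for x
  proof -
    have "x \<in> vals \<phi>' V" unfolding vals by blast
    then show ?thesis unfolding vals_def by auto
  qed
  obtain d where d: "degree d < degree \<phi>'" "d \<noteq> 0" "V d = \<gamma>" using attained by blast
  have small: "degree [:a:] < degree \<phi>'" for a :: 'k using deg_pos by simp
  show ?thesis
  proof (rule extension_from_fract_val[OF fract_val_residual[OF d] v])
    show "W [:a:] = id (v a)" if "a \<noteq> 0" for a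
      using that W_small[OF small, of a] const(1) by simp
    show "Fract (T d [:a:]) 1 = (ratfun_const \<circ> \<phi>) (residue v a)" for a
      using const(2) by (simp add: T_small[OF d small] r_def ratfun_const_def)
    show "\<exists>F G. F \<noteq> 0 \<and> G \<noteq> 0 \<and> g = W F - W G" for g
    proof -
      obtain a where a: "degree a < degree \<phi>'" "a \<noteq> 0" "V a = g" using attained by blast
      then show ?thesis by (rule_tac exI[of _ a], rule_tac exI[of _ 1]) (simp add: W_small)
    qed
    show "\<exists>F G. (F = 0 \<or> 0 \<le> W F) \<and> G \<noteq> 0 \<and> W G = 0 \<and> Fract (T d F) 1 = y * Fract (T d G) 1" for y
    proof -
      obtain p q where y: "y = Fract p q" "q \<noteq> 0" by (cases y) auto
      obtain F where F: "wge F 0" "T d F = p" using T_surj[OF d ress] by blast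
      obtain G where G: "wge G 0" "T d G = q" using T_surj[OF d ress] by blast
      have nG: "G \<noteq> 0" using G y by (auto simp: T_def[OF d])
      have "\<not> wgt G 0" using T_eq_0_iff[OF d G(1)] G(2) y by simp
      then have "W G = 0" using G(1) nG by (simp add: wge_iff wgt_iff)
      moreover have "F = 0 \<or> 0 \<le> W F" using F(1) by (cases "F = 0") (simp_all add: wge_iff)
      moreover have "Fract p 1 = y * Fract q 1" using y by (simp add: eq_fract)
      ultimately show ?thesis using F(2) G(2) nG by (rule_tac exI[of _ F], rule_tac exI[of _ G]) simp
    qed
  qed simp
qed

text \<open>All values are 0, so the only step available is from the base stage with the negative
  constant \<open>t\<close> in place of \<beta> and with \<open>\<gamma> = 0\<close>. It adjoins a
  primitive element \<open>y\<close>, and leaves the constant 0, which a transcendental value can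
  still exceed.\<close>

lemma trivial_extension_stage:
  fixes j :: "'g \<Rightarrow> 'd::linordered_ab_group_add"
  assumes triv: "trivial_valuation v" and simple: "simple_field_ext (\<phi> ` carrier (residue_field v))"
    and j: "order_embedding j" and neg: "(t :: 'd) < 0"
  obtains \<phi>' V R where "stage \<phi>' V R 0" "\<And>a. a \<noteq> 0 \<Longrightarrow> V [:a:] = j (v a)" "\<And>a. R [:a:] = r a"
    "vals \<phi>' V = range j" "ress \<phi>' V R = UNIV"
proof -
  note J = order_embeddingD[OF j]
  interpret tw: tower "\<lambda>a. j (v a)" r UNIV "range j" by (rule tower_embedding[OF j])
  have v0: "v a = 0" if "a \<noteq> 0" for a
  proof -
    have "v a \<in> value_group v" unfolding value_group_def using that by (intro imageI) simp
    then show ?thesis using triv by (simp add: trivial_valuation_def)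
  qed
  \<comment> \<open>Torsion over the zero group in a torsion-free group.\<close>
  have g0: "g = 0" for g :: 'g
  proof -
    obtain n c where "0 < n" "c \<noteq> 0" "nmul n g = v c" using tors[of g] by blast
    then show ?thesis using v0[of c] nmul_eq_0_iff[of n g] by simp
  qed
  obtain y where y: "generate_field ring_of_type_algebra (insert y (r ` {a. v.vge a 0})) = UNIV"
    using simple unfolding simple_field_ext_def kv_eq by blast
  have in0: "0 \<in> vals [:0, 1:] tw.V0" unfolding tw.vals_0 by (rule image_eqI[of _ _ 1]) (simp_all add: J)
  show ?thesis
  proof (rule tw.good_residual[OF tw.good_0 in0 neg, of y])
    fix \<phi>' V R \<beta>'
    assume a: "tw.good \<phi>' V R \<beta>'" "y \<in> ress \<phi>' V R" "\<beta>' = nmul (degree \<phi>' div degree [:0, 1::'k:]) 0"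
    interpret st: stage \<phi>' V R \<beta>' by (rule tw.good_base(1)[OF a(1)])
    have kv: "tw.kv = r ` {a. v.vge a 0}"
      by (simp add: tw.kv_def tw.base.vge_def v.vge_def J)
    have "insert y (r ` {a. v.vge a 0}) \<subseteq> ress \<phi>' V R"
      using a(2) tw.good_base(5)[OF a(1)] by (simp only: kv insert_subset simp_thms)
    from generate_field_subfield_set[OF st.subfield_ress this]
    have "UNIV \<subseteq> ress \<phi>' V R" by (simp only: y)
    then have ress: "ress \<phi>' V R = UNIV" by blast
    have sub: "vals \<phi>' V \<subseteq> range j" using a(1) by (simp only: tw.good_def)
    have rj: "range j = {0}"
    proof -
      have "j x = 0" for x using g0[of x] J(4) by simp
      then show ?thesis by auto
    qed
    have vals: "vals \<phi>' V = range j"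
    proof (rule equalityI[OF sub])
      show "range j \<subseteq> vals \<phi>' V" unfolding rj using st.vals_0 by simp
    qed
    have "stage \<phi>' V R 0" using st.stage_axioms a(3) by simp
    from that[OF this tw.good_base(2,3)[OF a(1)] vals ress] show ?thesis .
  qed
qed

text \<open>Step \<open>n\<close> adjoins the \<open>n\<close>-th generator of the value group and
  the \<open>n\<close>-th generator of the residue field; the limit then has exactly the prescribed
  groups of values and residues.\<close>

lemma limit_extension:
  assumes nt: "\<not> trivial_valuation v"
    and cg: "countably_generated_group (value_quotient v)"
    and cf: "countably_generated_field_ext (\<phi> ` carrier (residue_field v))"
    and inf: "infinite (carrier (value_quotient v)) \<or> \<not> finite_field_ext (\<phi> ` carrier (residue_field v))"
  shows "\<exists>w :: 'k poly fract \<Rightarrow> 'g. valuation_extends ratfun_const id v w \<and>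
    value_group w = UNIV \<and> residue_field_iso_over ratfun_const v w \<phi>"
proof -
  have id_emb: "order_embedding (\<lambda>x :: 'g. x)" by (simp add: order_embedding_def)
  interpret t: nontrivial_tower v r UNIV "UNIV :: 'g set"
    using nontrivial_tower_embedding[OF id_emb nt] by simp
  have kv: "t.kv = r ` {a. v.vge a 0}" by (simp add: t.kv_def)
  have "\<exists>B. countable B \<and> (\<forall>E. add_closed E \<longrightarrow> value_group v \<subseteq> E \<longrightarrow> B \<subseteq> E \<longrightarrow> E = UNIV)"
  proof (rule countable_value_quotient[OF v cg])
    fix B :: "'g set"
    assume B: "countable B" "\<And>E. add_closed E \<Longrightarrow> value_group v \<subseteq> E \<Longrightarrow> B \<subseteq> E \<Longrightarrow> E = UNIV"
    show ?thesis by (intro exI[of _ B] conjI allI impI B)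
  qed
  then obtain B where B': "countable B"
    "\<forall>E. add_closed E \<longrightarrow> value_group v \<subseteq> E \<longrightarrow> B \<subseteq> E \<longrightarrow> E = UNIV"
    by (elim exE conjE)
  note B = B'(1) B'(2)[rule_format]
  obtain S where S: "countable S" "generate_field ring_of_type_algebra (t.kv \<union> S) = UNIV"
    using cf unfolding countably_generated_field_ext_def kv_eq kv by blast
  \<comment> \<open>Inserting 0 makes the sets non-empty, so that they can be enumerated.\<close>
  define gs where "gs = from_nat_into (insert 0 B)"
  define ys where "ys = from_nat_into (insert 0 S)"
  have gs: "range gs = insert 0 B" unfolding gs_def using B(1) by (intro range_from_nat_into) simp_all
  have ys: "range ys = insert 0 S" unfolding ys_def using S(1) by (intro range_from_nat_into) simp_all
  let ?P = "\<lambda>(n::nat) (p, V, R, b). t.gd p V R b"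
  let ?Q = "\<lambda>n (p, V, R, b) (p', V', R', b'). stage_le p V R p' V' R' \<and> gs n \<in> vals p' V' \<and> ys n \<in> ress p' V' R'"
  have "\<exists>f. \<forall>n. ?P n (f n) \<and> ?Q n (f n) (f (Suc n))"
  proof (rule dependent_nat_choice)
    show "\<exists>x. ?P 0 x" using t.gd_0 by (intro exI[of _ "([:0, 1:], t.V0, t.R0, 0)"]) simp
    fix x n assume x: "?P n x"
    obtain p V R b where xp: "x = (p, V, R, b)" by (cases x) auto
    have gd: "t.gd p V R b" using x by (simp add: xp)
    show "\<exists>y. ?P (Suc n) y \<and> ?Q n x y"
    proof (rule t.gd_step[OF gd UNIV_I, of "gs n" "ys n"])
      fix p' V' R' b'
      assume "t.gd p' V' R' b'" "stage_le p V R p' V' R'" "gs n \<in> vals p' V'" "ys n \<in> ress p' V' R'"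
      then show ?thesis by (intro exI[of _ "(p', V', R', b')"]) (simp add: xp)
    qed
  qed
  then obtain f where f': "\<forall>n. ?P n (f n) \<and> ?Q n (f n) (f (Suc n))" by (elim exE)
  have f: "?P n (f n)" "?Q n (f n) (f (Suc n))" for n
    by (rule conjunct1[OF spec[OF f']], rule conjunct2[OF spec[OF f']])
  define p where "p n = fst (f n)" for n
  define V where "V n = fst (snd (f n))" for n
  define R where "R n = fst (snd (snd (f n)))" for n
  define b where "b n = snd (snd (snd (f n)))" for n
  have good: "t.good (p n) (V n) (R n) (b n)" for n
    using f(1)[of n] by (simp add: p_def V_def R_def b_def case_prod_beta t.gd_def)
  have step: "stage_le (p n) (V n) (R n) (p (Suc n)) (V (Suc n)) (R (Suc n))"
    "gs n \<in> vals (p (Suc n)) (V (Suc n))" "ys n \<in> ress (p (Suc n)) (V (Suc n)) (R (Suc n))" for n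
    using f(2)[of n] by (simp_all add: p_def V_def R_def case_prod_beta)
  have st: "stage (p n) (V n) (R n) (b n)" for n by (rule t.good_base(1)[OF good])
  have le: "stage_le (p m) (V m) (R m) (p n) (V n) (R n)" if "m \<le> n" for m n
    using that by (induction rule: dec_induct) (auto intro: stage_le_refl stage_le_trans step(1))
  have in_vals: "value_group v \<subseteq> vals (p n) (V n)" for n
    using t.good_base(4)[OF good[of n]] by (auto simp: value_group_def)
  \<comment> \<open>If degrees were bounded, they would be constant from some \<open>N\<close> on,
    and stages of equal degree related by \<open>stage_le\<close> have the same values and residues.
    Then stage \<open>N\<close> would contain all generators, hence everything, and its finiteness
    over the base would contradict \<open>inf\<close>.\<close>
  have unbounded: "\<exists>n. k < degree (p n)" for k
  proof (rule ccontr)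
    assume "\<not> (\<exists>n. k < degree (p n))"
    then have bd: "\<forall>n. degree (p n) \<le> k" by (simp add: not_less)
    obtain N where N: "\<And>n. degree (p n) \<le> degree (p N)"
      using ex_has_greatest_nat[of "\<lambda>_. True" 0 "\<lambda>n. degree (p n)" "Suc k"] bd
      by (auto simp: le_imp_less_Suc)
    have const: "vals (p n) (V n) \<subseteq> vals (p N) (V N) \<and> ress (p n) (V n) (R n) \<subseteq> ress (p N) (V N) (R N)" for n
    proof (cases "n \<le> N")
      case True
      show ?thesis using stage_le_vals[OF le[OF True]] stage_le_ress[OF le[OF True]] by blast
    next
      case False
      then have l: "stage_le (p N) (V N) (R N) (p n) (V n) (R n)" by (intro le) simp
      then have d: "degree (p n) = degree (p N)" using N[of n] by (simp add: stage_le_def)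
      have "V n a = V N a" if "degree a < degree (p N)" "a \<noteq> 0" for a
        using l that unfolding stage_le_def by blast
      moreover have "R n a = R N a" if "degree a < degree (p N)" for a
        using l that unfolding stage_le_def by blast
      ultimately show ?thesis unfolding vals_def ress_def d
        by (intro conjI image_subsetI) (force intro!: image_eqI)+
    qed
    interpret s: stage "p N" "V N" "R N" "b N" by (rule st)
    have "B \<subseteq> vals (p N) (V N)"
    proof
      fix g assume "g \<in> B"
      then obtain n where "g = gs n" using gs by blast
      then show "g \<in> vals (p N) (V N)" using step(2)[of n] const[of "Suc n"] by blast
    qed
    from B(2)[OF s.vals_closed in_vals this] have vals: "vals (p N) (V N) = UNIV" .
    have "t.kv \<union> S \<subseteq> ress (p N) (V N) (R N)"
    proof (intro Un_least subsetI)
      fix y assume "y \<in> S"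
      then obtain n where "y = ys n" using ys by blast
      then show "y \<in> ress (p N) (V N) (R N)" using step(3)[of n] const[of "Suc n"] by blast
    next
      fix y assume "y \<in> t.kv"
      then show "y \<in> ress (p N) (V N) (R N)" using t.good_base(5)[OF good[of N]] by blast
    qed
    from generate_field_subfield_set[OF s.subfield_ress this]
    have ress: "ress (p N) (V N) (R N) = UNIV" unfolding S(2) by blast
    obtain A where A: "finite A" "\<forall>g\<in>vals (p N) (V N). \<exists>c a. c \<noteq> 0 \<and> a \<in> A \<and> g = v c + a"
      by (rule t.good_vals[OF good])
    then have "finite (carrier (value_quotient v))"
      unfolding finite_value_quotient[OF v] vals by (intro exI[of _ A]) simp
    moreover have "finite_field_ext (\<phi> ` carrier (residue_field v))"
    proof (rule t.good_ress[OF good[of N]])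
      fix C :: "'f set"
      assume C: "finite C" "\<And>E. t.kv \<subseteq> E \<Longrightarrow> C \<subseteq> E \<Longrightarrow> ring_closed E \<Longrightarrow> ress (p N) (V N) (R N) \<subseteq> E"
      show ?thesis
      proof (rule finite_field_extI[OF _ alg C(1)])
        show "subfield_set (\<phi> ` carrier (residue_field v))" unfolding kv_eq by (rule subfield_kv)
        fix E assume "\<phi> ` carrier (residue_field v) \<subseteq> E" "C \<subseteq> E" "ring_closed E"
        then have "UNIV \<subseteq> E" using C(2)[of E] unfolding kv_eq kv ress by simp
        then show "E = UNIV" by blast
      qed
    qed
    ultimately show False using inf by blast
  qed
  interpret ch: stage_chain p V R b by (rule stage_chain.intro) (rule st step(1) unbounded)+
  have const: "ch.W [:a:] = v a" if "a \<noteq> 0" for a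
  proof -
    have "degree [:a:] < degree (p (ch.lev [:a:]))" by (rule ch.lev)
    then show ?thesis using t.good_base(2)[OF good that] ch.W_eq that by simp
  qed
  have constR: "ch.T [:a:] = r a" for a
    using t.good_base(3)[OF good] ch.T_eq[OF ch.lev] by simp
  show ?thesis
  proof (rule extension_from_fract_val[OF ch.fract_val_limit v])
    show "ch.W [:a:] = id (v a)" if "a \<noteq> 0" for a using const[OF that] by simp
    show "ch.T [:a:] = \<phi> (residue v a)" for a using constR by (simp add: r_def)
    show "\<exists>F G. F \<noteq> 0 \<and> G \<noteq> 0 \<and> g = ch.W F - ch.W G" for g
    proof -
      \<comment> \<open>The value groups form a chain, so their union is a subgroup; it contains the
        generators.\<close>
      let ?E = "\<Union>n. vals (p n) (V n)"
      have two: "\<exists>n. x \<in> vals (p n) (V n) \<and> y \<in> vals (p n) (V n)" if xy: "x \<in> ?E" "y \<in> ?E" for x y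
      proof -
        obtain m n where mn: "x \<in> vals (p m) (V m)" "y \<in> vals (p n) (V n)" using xy by blast
        have "vals (p m) (V m) \<subseteq> vals (p (max m n)) (V (max m n))" by (rule stage_le_vals[OF le]) simp
        moreover have "vals (p n) (V n) \<subseteq> vals (p (max m n)) (V (max m n))" by (rule stage_le_vals[OF le]) simp
        ultimately show ?thesis using mn by blast
      qed
      have "add_closed ?E"
        unfolding add_closed_def
      proof (intro conjI ballI)
        show "0 \<in> ?E" using stage.vals_0[OF st[of 0]] by blast
        fix x assume x: "x \<in> ?E"
        then show "- x \<in> ?E" using stage.vals_uminus[OF st] by blast
        fix y assume "y \<in> ?E"
        then obtain n where "x \<in> vals (p n) (V n)" "y \<in> vals (p n) (V n)" using two x by blast
        then show "x + y \<in> ?E" using stage.vals_add[OF st] by blast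
      qed
      moreover have "value_group v \<subseteq> ?E" using in_vals[of 0] by blast
      moreover have "B \<subseteq> ?E"
      proof
        fix g assume "g \<in> B"
        then obtain n where "g = gs n" using gs by blast
        then show "g \<in> ?E" using step(2)[of n] by blast
      qed
      ultimately have "?E = UNIV" by (rule B(2))
      then obtain n where "g \<in> vals (p n) (V n)" by blast
      then obtain a where a: "degree a < degree (p n)" "a \<noteq> 0" "V n a = g" unfolding vals_def by auto
      have "ch.W 1 = 0" using pvres.axioms(1)[OF ch.pvres_limit] pval.V_1 by blast
      then show ?thesis using a ch.W_eq[OF a(1,2)] by (rule_tac exI[of _ a], rule_tac exI[of _ 1]) simp
    qed
    show "\<exists>F G. (F = 0 \<or> 0 \<le> ch.W F) \<and> G \<noteq> 0 \<and> ch.W G = 0 \<and> ch.T F = y * ch.T G" for y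
    proof -
      let ?E = "\<Union>n. ress (p n) (V n) (R n)"
      have two: "\<exists>n. x \<in> ress (p n) (V n) (R n) \<and> y \<in> ress (p n) (V n) (R n)" if xy: "x \<in> ?E" "y \<in> ?E" for x y
      proof -
        obtain m n where mn: "x \<in> ress (p m) (V m) (R m)" "y \<in> ress (p n) (V n) (R n)" using xy by blast
        have "ress (p m) (V m) (R m) \<subseteq> ress (p (max m n)) (V (max m n)) (R (max m n))"
          by (rule stage_le_ress[OF le]) simp
        moreover have "ress (p n) (V n) (R n) \<subseteq> ress (p (max m n)) (V (max m n)) (R (max m n))"
          by (rule stage_le_ress[OF le]) simp
        ultimately show ?thesis using mn by blast
      qed
      have sf: "subfield_set (ress (p n) (V n) (R n))" for n by (rule stage.subfield_ress[OF st])
      have "subfield_set ?E"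
        unfolding subfield_set_def ring_closed_def
      proof (intro conjI ballI)
        show "0 \<in> ?E" "1 \<in> ?E" using sf[of 0] unfolding subfield_set_def by blast+
        fix x assume x: "x \<in> ?E"
        then show "- x \<in> ?E" "inverse x \<in> ?E" using sf unfolding subfield_set_def by blast+
        fix y assume "y \<in> ?E"
        then obtain n where n: "x \<in> ress (p n) (V n) (R n)" "y \<in> ress (p n) (V n) (R n)" using two x by blast
        then show "x + y \<in> ?E" "x * y \<in> ?E"
          using stage.ress_add[OF st n] stage.ress_mult[OF st n] by blast+
      qed
      moreover have "t.kv \<union> S \<subseteq> ?E"
      proof (intro Un_least subsetI)
        fix y assume "y \<in> S"
        then obtain n where "y = ys n" using ys by blast
        then show "y \<in> ?E" using step(3)[of n] by blast
      next
        fix y assume "y \<in> t.kv"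
        then show "y \<in> ?E" using t.good_base(5)[OF good[of 0]] by blast
      qed
      ultimately have "UNIV \<subseteq> ?E" unfolding S(2)[symmetric] by (rule generate_field_subfield_set)
      then obtain n where "y \<in> ress (p n) (V n) (R n)" by blast
      then obtain a where a: "degree a < degree (p n)" "a = 0 \<or> 0 \<le> V n a" "R n a = y"
        unfolding ress_def by auto
      have "ch.W 1 = 0" using pvres.axioms(1)[OF ch.pvres_limit] pval.V_1 by blast
      moreover have "ch.T 1 = 1" using pvres.R_1[OF ch.pvres_limit] .
      moreover have "a = 0 \<or> 0 \<le> ch.W a" using a ch.W_eq[OF a(1)] by (cases "a = 0") simp_all
      ultimately show ?thesis using a ch.T_eq[OF a(1)] by (rule_tac exI[of _ a], rule_tac exI[of _ 1]) simp
    qed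
  qed simp
qed

end

section \<open>The extension obtained from an immediate transcendental extension\<close>

context setting
begin

lemma immediate_extension:
  fixes i :: "'k \<Rightarrow> 'l::field" and u :: "'l \<Rightarrow> 'g"
  assumes nt: "\<not> trivial_valuation v"
    and fin: "finite (carrier (value_quotient v))" "finite_field_ext (\<phi> ` carrier (residue_field v))"
    and imm: "immediate_transcendental_ext i v u"
  shows "\<exists>w :: 'k poly fract \<Rightarrow> 'g. valuation_extends ratfun_const id v w \<and>
    value_group w = UNIV \<and> residue_field_iso_over ratfun_const v w \<phi>"
proof -
  have hom: "i \<in> ring_hom ring_of_type_algebra ring_of_type_algebra" and u: "valuation u"
    and ui: "\<And>a. a \<noteq> 0 \<Longrightarrow> u (i a) = v a" and ntr: "\<not> algebraic_field_ext (range i)"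
    and vg: "value_group u = value_group v"
    and rf: "carrier (residue_field u) = (\<lambda>a. residue u (i a)) ` carrier (valuation_ring v)"
    using imm by (simp_all add: immediate_transcendental_ext_def valuation_extends_def)
  interpret field_hom_to i by unfold_locales (rule hom)
  interpret u: pval "\<lambda>a. a = 0" u by (rule valuation_pval[OF u])
  have ge_i: "u.vge (i b) g \<longleftrightarrow> v.vge b g" "u.vgt (i b) g \<longleftrightarrow> v.vgt b g" for b g
    using ui[of b] by (cases "b = 0"; simp add: u.vge_def v.vge_def u.vgt_def v.vgt_def)+
  \<comment> \<open>Equality of residue fields: every element of value at least 0 is congruent to
    one from \<open>K\<close>. This both defines the residue map \<open>rl\<close> on the larger
    field and shows that it has the same image.\<close>
  have lift: "\<exists>b. v.vge b 0 \<and> u.vgt (a - i b) 0" if a: "u.vge a 0" for a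
  proof -
    have "residue u a \<in> carrier (residue_field u)"
      using a unfolding carrier_residue_field[OF u] carrier_valuation_ring[OF u] by blast
    then obtain b where b: "b \<in> carrier (valuation_ring v)" "residue u a = residue u (i b)"
      unfolding rf by blast
    have "a \<in> residue u a" unfolding residue_eq[OF u] by simp
    then have "a \<in> residue u (i b)" by (simp only: b(2))
    then have "u.vgt (a - i b) 0" by (simp only: residue_eq[OF u] mem_Collect_eq)
    then show ?thesis using b(1) unfolding carrier_valuation_ring[OF v] by blast
  qed
  define l where "l a = (SOME b. v.vge b 0 \<and> u.vgt (a - i b) 0)" for a
  have l: "v.vge (l a) 0" "u.vgt (a - i (l a)) 0" if "u.vge a 0" for a
    using someI_ex[OF lift[OF that]] unfolding l_def by blast+
  define rl where "rl a = r (l a)" for a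
  have rl_eq: "rl a = r b" if a: "u.vge a 0" "v.vge b 0" "u.vgt (a - i b) 0" for a b
  proof -
    have "u.vgt ((a - i b) - (a - i (l a))) 0" by (rule u.vgt_diff[OF a(3) l(2)[OF a(1)]])
    then have "u.vgt (i (l a - b)) 0" by (simp add: i_diff)
    then have "v.vgt (l a - b) 0" by (simp only: ge_i)
    then show ?thesis unfolding rl_def by (rule v.R_eqI[OF l(1)[OF a(1)]])
  qed
  interpret u: pvres "\<lambda>a. a = 0" u rl
  proof
    show "rl 1 = 1"
      using rl_eq[of 1 1] by (simp add: u.vge_def v.vge_def i_1)
  next
    fix a b assume ab: "u.vge a 0" "u.vge b 0"
    have "u.vgt ((a - i (l a)) + (b - i (l b))) 0" by (rule u.vgt_add[OF l(2)[OF ab(1)] l(2)[OF ab(2)]])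
    then have "u.vgt (a + b - i (l a + l b)) 0" by (simp add: i_add algebra_simps)
    then have "rl (a + b) = r (l a + l b)"
      by (intro rl_eq u.vge_add v.vge_add l(1) ab)
    then show "rl (a + b) = rl a + rl b" using l(1) ab by (simp add: rl_def v.R_add)
    have gib: "u.vge (i (l b)) 0" using l(1)[OF ab(2)] by (simp only: ge_i)
    have 1: "u.vgt (a * (b - i (l b))) (0 + 0)" by (rule u.vgt_mult[OF ab(1) l(2)[OF ab(2)]])
    have 2: "u.vgt ((a - i (l a)) * i (l b)) (0 + 0)" by (rule u.vgt_mult2[OF l(2)[OF ab(1)] gib])
    have "a * b - i (l a * l b) = a * (b - i (l b)) + (a - i (l a)) * i (l b)"
      by (simp add: i_mult algebra_simps)
    then have 3: "u.vgt (a * b - i (l a * l b)) 0" using u.vgt_add[OF 1 2] by simp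
    have "u.vge (a * b) 0" using u.vge_mult[OF ab] by simp
    moreover have "v.vge (l a * l b) 0" by (rule v.vge_0_mult[OF l(1)[OF ab(1)] l(1)[OF ab(2)]])
    ultimately have "rl (a * b) = r (l a * l b)" using 3 by (rule rl_eq)
    then show "rl (a * b) = rl a * rl b" using l(1) ab by (simp add: rl_def v.R_mult)
  next
    fix a assume a: "u.vge a 0"
    have "rl a = 0 \<longleftrightarrow> v.vgt (l a) 0" unfolding rl_def by (rule v.R_eq_0_iff[OF l(1)[OF a]])
    also have "\<dots> \<longleftrightarrow> u.vgt (i (l a)) 0" by (simp only: ge_i)
    also have "\<dots> \<longleftrightarrow> u.vgt a 0"
      using u.vgt_add[OF l(2)[OF a], of "i (l a)"] u.vgt_diff[OF _ l(2)[OF a], of a] by auto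
    finally show "rl a = 0 \<longleftrightarrow> u.vgt a 0" .
  qed
  have rl_i: "rl (i a) = r a" if "v.vge a 0" for a
    using that by (intro rl_eq) (simp_all add: ge_i)
  have kv: "rl ` {a. u.vge a 0} = r ` {a. v.vge a 0}"
  proof (intro equalityI image_subsetI)
    show "rl a \<in> r ` {a. v.vge a 0}" if "a \<in> {a. u.vge a 0}" for a
      using that l(1)[of a] unfolding rl_def by blast
    show "r a \<in> rl ` {a. u.vge a 0}" if "a \<in> {a. v.vge a 0}" for a
      using that rl_i[of a] ge_i(1)[of a 0] by (intro image_eqI[of _ _ "i a"]) simp_all
  qed
  \<comment> \<open>Both halves of immediacy: divide by an element \<open>c\<close> of
    \<open>K\<close> with the same value, then approximate the quotient, of value 0, by the lift of
    its residue.\<close>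
  have approx: "\<exists>b. a = i b \<or> u a < u (a - i b)" if a: "a \<noteq> 0" for a
  proof -
    have "u a \<in> value_group u" unfolding value_group_def using a by (intro imageI) simp
    then have "u a \<in> value_group v" by (simp only: vg)
    then obtain c where c: "c \<noteq> 0" "u a = v c" unfolding value_group_def by blast
    have nz: "i c \<noteq> 0" using c by simp
    have "u (i c * (a / i c)) = u (i c) + u (a / i c)" using a nz by (intro u.V_mult) simp_all
    then have "u (a / i c) = 0" using c nz ui[OF c(1)] by simp
    then have "u.vge (a / i c) 0" by (simp add: u.vge_def)
    then obtain b where b: "u.vgt (a / i c - i b) 0" using lift by blast
    have "u.vgt (i c * (a / i c - i b)) (u (i c) + 0)" by (rule u.vgt_mult[OF u.vge_self b])
    moreover have "i c * (a / i c - i b) = a - i (c * b)" using nz by (simp add: i_mult right_diff_distrib)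
    ultimately have "u.vgt (a - i (c * b)) (u a)" using c ui[OF c(1)] by simp
    then show ?thesis by (intro exI[of _ "c * b"]) (simp add: u.vgt_def)
  qed
  interpret t: nontrivial_tower u rl "range mp" "UNIV :: 'g set"
  proof
    show "mod_closed (range mp)" by (rule mod_closed_mp)
    show "[:0, 1:] \<in> range mp" by (rule range_eqI[of _ _ "[:0, 1:]"]) (simp add: map_poly_pCons i_1)
    show "\<exists>a'. [:a':] \<in> range mp \<and> (a = a' \<or> u a < u (a - a'))" if a: "a \<noteq> 0" for a
    proof -
      obtain b where "a = i b \<or> u a < u (a - i b)" using approx[OF a] by blast
      moreover have "[:i b:] \<in> range mp" by (rule range_eqI[of _ _ "[:b:]"]) simp
      ultimately show ?thesis by blast
    qed
    show "\<exists>n>0. \<exists>c. c \<noteq> 0 \<and> nmul n g = u c" for g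
    proof -
      obtain n c where "0 < n" "c \<noteq> 0" "nmul n g = v c" using tors[of g] by blast
      then show ?thesis using ui[of c] by (intro exI[of _ n] conjI exI[of _ "i c"]) simp_all
    qed
    show "\<exists>p. p \<noteq> 0 \<and> (\<forall>k. coeff p k \<in> rl ` {a. u.vge a 0}) \<and> poly p y = 0" for y
      using alg_poly[of y] by (simp only: kv)
    show "\<exists>c. c \<noteq> 0 \<and> g < u c" for g
    proof -
      obtain c where "c \<noteq> 0" "g < v c" using cofinal_v[OF nt, of g] by blast
      then show ?thesis using ui[of c] by (intro exI[of _ "i c"]) simp
    qed
  qed simp_all
  show ?thesis
  proof (rule finite_generation[OF fin])
    fix A :: "'g set" and B :: "'f set"
    assume AB: "finite A" "\<And>g. \<exists>c a. c \<noteq> 0 \<and> a \<in> A \<and> g = v c + a" "finite B"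
      "\<And>E. ring_closed E \<Longrightarrow> 0 \<in> E \<Longrightarrow> r ` {a. v.vge a 0} \<subseteq> E \<Longrightarrow> B \<subseteq> E \<Longrightarrow> E = UNIV"
    have "\<exists>\<phi>' V R \<beta>. t.gd \<phi>' V R \<beta> \<and> A \<subseteq> vals \<phi>' V \<and> B \<subseteq> ress \<phi>' V R"
      using AB(1,3) by (intro t.gd_finite) auto
    then obtain \<phi>' V R \<beta> where gd: "t.gd \<phi>' V R \<beta>" "A \<subseteq> vals \<phi>' V" "B \<subseteq> ress \<phi>' V R"
      by (elim exE conjE)
    then have good: "t.good \<phi>' V R \<beta>" by (simp add: t.gd_def)
    interpret st: stage \<phi>' V R \<beta> by (rule t.good_base(1)[OF good])
    have rat: "rational (range mp) \<phi>' V" using good by (simp add: t.good_def)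
    have "g \<in> vals \<phi>' V" for g
    proof -
      obtain c a where c: "c \<noteq> 0" "a \<in> A" "g = v c + a" using AB(2) by blast
      have "u (i c) \<in> vals \<phi>' V" using c(1) by (intro t.good_base(4)[OF good]) simp
      then have "v c + a \<in> vals \<phi>' V" using ui[OF c(1)] c(2) gd(2) by (intro st.vals_add) auto
      then show ?thesis using c by simp
    qed
    then have vals: "vals \<phi>' V = UNIV" by blast
    have kv': "t.kv = r ` {a. v.vge a 0}" by (simp only: t.kv_def kv)
    have ress: "ress \<phi>' V R = UNIV"
    proof (rule AB(4))
      show "ring_closed (ress \<phi>' V R)" using st.subfield_ress by (simp add: subfield_set_def)
      show "r ` {a. v.vge a 0} \<subseteq> ress \<phi>' V R" using t.good_base(5)[OF good] by (simp only: kv')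
    qed (rule st.ress_0 gd(3))+
    obtain \<phi>0 where phi0: "\<phi>' = mp \<phi>0" using rat by (auto simp: rational_def)
    obtain y where y: "ring.transcendental ring_of_type_algebra (range i) y"
      using ntr unfolding algebraic_field_ext_def by blast
    \<comment> \<open>Scaling the transcendental \<open>y\<close> by \<open>c\<close> pushes its
      value above \<beta>.\<close>
    obtain c where c: "c \<noteq> 0" "\<beta> - u y < v c" using cofinal_v[OF nt] by blast
    define z where "z = i c * y"
    have mp_smult: "mp (smult a p) = smult (i a) (mp p)" for a p
      by (rule poly_eqI) (simp add: i_mult)
    \<comment> \<open>A polynomial at \<open>z\<close> is a polynomial at \<open>y\<close> after the
      substitution \<open>[:0, c:]\<close>, so \<open>z\<close> inherits transcendence.\<close>
    have poly_mp: "poly (mp p) z = poly (mp (pcompose p [:0, c:])) y" for p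
      by (induction p) (simp_all add: map_poly_pCons pcompose_pCons mp_add mp_mult mp_smult z_def algebra_simps)
    have y0: "y \<noteq> 0"
    proof
      assume "y = 0"
      have "poly (mp [:0, 1:]) y \<noteq> 0"
        by (rule transcendental_polyD[OF y]) (simp_all only: mp_eq_0_iff coeff_mp rangeI, simp_all)
      then show False using \<open>y = 0\<close> by (simp add: map_poly_pCons)
    qed
    have transc: "poly (mp p) z \<noteq> 0" if "p \<noteq> 0" for p
      unfolding poly_mp
    proof (rule transcendental_polyD[OF y])
      show "mp (pcompose p [:0, c:]) \<noteq> 0" using that c(1) by (simp add: pcompose_eq_0_iff)
    qed simp
    have z0: "z \<noteq> 0" using y0 c(1) by (simp add: z_def)
    have "\<beta> < u y + v c" using c(2) by (simp add: algebra_simps)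
    also have "\<dots> = u z" using y0 c(1) ui[OF c(1)] by (simp add: z_def u.V_mult add.commute)
    also have "\<dots> = V [:z:]" using t.good_base(2)[OF good z0] by simp
    finally have z: "\<beta> < V [:z:]" .
    interpret im: immediate_stage \<phi>' V R \<beta> i \<phi>0 z
      by unfold_locales (rule phi0, erule transc, rule z)
    interpret W: pvres "\<lambda>F. F = 0" "\<lambda>F. V (im.E F)" "\<lambda>F. R (im.E F)" by (rule im.pvres_immediate)
    \<comment> \<open>Each value is that of a reduced element of \<open>range mp\<close>, because
      the stage is \<open>rational\<close>; \<open>im.E\<close> fixes such elements, so the value is
      attained on \<open>K[x]\<close>.\<close>
    have attained: "\<exists>F. F \<noteq> 0 \<and> V (im.E F) = g" for g
    proof -
      have "g \<in> vals \<phi>' V" unfolding vals by blast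
      then obtain d where d: "d \<in> range mp" "degree d < degree \<phi>'" "d \<noteq> 0" "V d = g"
        by (rule st.rational_vals[OF rat])
      then obtain F where "d = mp F" by blast
      then show ?thesis using d im.E_small[of F] by (intro exI[of _ F]) auto
    qed
    have fv: "fract_val (\<lambda>F. V (im.E F)) (\<lambda>_ F. R (im.E F)) 0"
    proof (unfold_locales, goal_cases)
      case (4 G)
      obtain s where "s \<noteq> 0" "V (im.E s) = - V (im.E G)" using attained by blast
      then show ?case using W.V_mult[of s G] 4 by (intro exI[of _ s]) simp
    qed (simp_all add: W.R_add W.R_mult W.R_eq_0_iff)
    have const: "im.E [:a:] = [:i a:]" for a
      using im.E_small[of "[:a:]"] st.deg_pos by simp
    have E1: "V (im.E 1) = 0" "R (im.E 1) = 1" by simp_all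
    show ?thesis
    proof (rule extension_from_fract_val[OF fv v])
      show "V (im.E [:a:]) = id (v a)" if "a \<noteq> 0" for a
        using that t.good_base(2)[OF good, of "i a"] ui[of a] by (simp add: const)
      show "R (im.E [:a:]) = \<phi> (residue v a)" if "a = 0 \<or> 0 \<le> v a" for a
        using that rl_i[of a] t.good_base(3)[OF good, of "i a"] by (simp add: const r_def v.vge_def)
      show "\<exists>F G. F \<noteq> 0 \<and> G \<noteq> 0 \<and> g = V (im.E F) - V (im.E G)" for g
      proof -
        obtain F where "F \<noteq> 0" "V (im.E F) = g" using attained by blast
        then show ?thesis using E1 by (rule_tac exI[of _ F], rule_tac exI[of _ 1]) simp
      qed
      show "\<exists>F G. (F = 0 \<or> 0 \<le> V (im.E F)) \<and> G \<noteq> 0 \<and> V (im.E G) = 0 \<and> R (im.E F) = x * R (im.E G)" for x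
      proof (cases "x = 0")
        case True
        then show ?thesis using E1 W.R_0 by (rule_tac exI[of _ 0], rule_tac exI[of _ 1]) simp
      next
        case False
        have "x \<in> ress \<phi>' V R" using ress by simp
        then obtain a where a: "degree a < degree \<phi>'" "a = 0 \<or> 0 \<le> V a" "R a = x"
          unfolding ress_def by auto
        then have ga: "st.vge a 0" by (auto simp: st.vge_def)
        then have Va: "a \<noteq> 0" "V a = 0"
          using st.R_eq_0_iff[OF ga] a(1,3) False by (auto simp: st.vge_def st.vgt_def)
        \<comment> \<open>The representative of the residue \<open>x\<close> lies over the larger
          field. An element over \<open>K\<close> with the same initial form has the same
          residue.\<close>
        obtain a' where a': "a' \<in> range mp" "degree a' < degree \<phi>'" "a = a' \<or> V a < V (a - a')"
          using rat a(1) Va(1) unfolding rational_def by blast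
        have gt: "st.vgt (a - a') 0" using a'(3) Va by (auto simp: st.vgt_def)
        then have "R a = R a'" by (rule st.R_eqI[OF ga])
        moreover have "\<not> \<phi>' dvd a" using Va a(1) by simp
        then have "V a' = V a" using st.V_eq_of_vgt_diff(2)[of a a'] gt Va by simp
        moreover obtain F where F: "a' = mp F" using a'(1) by blast
        moreover have "im.E F = a'" using im.E_small[of F] a'(2) F by simp
        ultimately show ?thesis using a(3) Va E1 by (rule_tac exI[of _ F], rule_tac exI[of _ 1]) simp
      qed
    qed simp
  qed
qed

end

lemma sum_with_int_orderD:
  fixes \<theta> :: "'g::linordered_ab_group_add \<times> int \<Rightarrow> 'd::linordered_ab_group_add"
  assumes "sum_with_int_order \<theta>"
  shows "\<theta> (x + y, m + n) = \<theta> (x, m) + \<theta> (y, n)" "bij \<theta>" "order_embedding (\<lambda>x. \<theta> (x, 0))"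
proof -
  have iso: "\<theta> \<in> iso (additive_group \<times>\<times> additive_group) additive_group"
    and ord: "\<And>a b. a \<le> b \<longleftrightarrow> \<theta> (a, 0) \<le> \<theta> (b, 0)"
    using assms by (auto simp: sum_with_int_order_def)
  show add: "\<theta> (x + y, m + n) = \<theta> (x, m) + \<theta> (y, n)" for x y m n
    using iso by (auto simp: iso_def hom_def DirProd_def additive_group_def)
  show "bij \<theta>" using iso by (simp add: iso_def DirProd_def additive_group_def)
  show "order_embedding (\<lambda>x. \<theta> (x, 0))"
    using add[of _ _ 0 0] ord by (simp add: order_embedding_def)
qed

theorem theorem1p4:
  fixes v :: "'k::field \<Rightarrow> 'g::linordered_ab_group_add"
    and \<phi> :: "'k set \<Rightarrow> 'f::field"
    and \<theta> :: "'g \<times> int \<Rightarrow> 'd::linordered_ab_group_add"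
  defines "kv \<equiv> \<phi> ` carrier (residue_field v)"
  assumes "valuation v"
    and "torsion_group (value_quotient v)"
    and "\<phi> \<in> ring_hom (residue_field v) ring_of_type_algebra"
    and "algebraic_field_ext kv"
    and "sum_with_int_order \<theta>"
  shows
    "(finite (carrier (value_quotient v)) \<and> finite_field_ext kv \<longrightarrow>
        ((trivial_valuation v \<longrightarrow> simple_field_ext kv) \<longrightarrow>
           (\<exists>w :: 'k poly fract \<Rightarrow> 'd.
              valuation_extends ratfun_const (\<lambda>a. \<theta> (a, 0)) v w \<and>
              value_group w = UNIV \<and>
              residue_field_iso_over ratfun_const v w \<phi>)) \<and>
        (\<not> trivial_valuation v \<longrightarrow>
           (\<exists>w :: 'k poly fract \<Rightarrow> 'g.
              valuation_extends ratfun_const id v w \<and>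
              value_group w = UNIV \<and>
              residue_field_iso_over ratfun_const v w (ratfun_const \<circ> \<phi>)))) \<and>
     (\<not> trivial_valuation v \<and>
      countably_generated_group (value_quotient v) \<and> countably_generated_field_ext kv \<and>
      (infinite (carrier (value_quotient v)) \<or> \<not> finite_field_ext kv \<or>
       (\<exists>(i :: 'k \<Rightarrow> 'l::field) (u :: 'l \<Rightarrow> 'g). immediate_transcendental_ext i v u)) \<longrightarrow>
        (\<exists>w :: 'k poly fract \<Rightarrow> 'g.
           valuation_extends ratfun_const id v w \<and>
           value_group w = UNIV \<and>
           residue_field_iso_over ratfun_const v w \<phi>))"
  proof -
  interpret setting v \<phi>
    by unfold_locales (use assms in \<open>simp_all add: kv_def\<close>)
  have kv: "kv = \<phi> ` carrier (residue_field v)" by (simp add: kv_def)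
  note \<theta> = sum_with_int_orderD[OF \<open>sum_with_int_order \<theta>\<close>]
  have id_emb: "order_embedding (\<lambda>x :: 'g. x)" by (simp add: order_embedding_def)
  have part1: "\<exists>w :: 'k poly fract \<Rightarrow> 'd. valuation_extends ratfun_const (\<lambda>a. \<theta> (a, 0)) v w \<and>
      value_group w = UNIV \<and> residue_field_iso_over ratfun_const v w \<phi>"
    if fin: "finite (carrier (value_quotient v))" "finite_field_ext kv"
      and simple: "trivial_valuation v \<longrightarrow> simple_field_ext kv"
  proof (cases "trivial_valuation v")
      case True
      have ne: "\<theta> (0, 1) \<noteq> 0"
        using \<theta>(2) order_embeddingD(4)[OF \<theta>(3)] bij_is_inj[THEN injD, of \<theta> "(0, 1)" "(0, 0)"] by auto
      \<comment> \<open>The old value group is zero here, so a negative element has to come from the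
        summand of integers.\<close>
      obtain t :: 'd where t: "t < 0"
      proof (cases "\<theta> (0, 1) < 0")
        case False
        then have "- \<theta> (0, 1) < 0" using ne by simp
        then show ?thesis using that by blast
      qed (use that in blast)
      have zero: "(0 :: 'd) \<in> range (\<lambda>x. \<theta> (x, 0))"
        by (rule range_eqI[of _ _ 0]) (simp add: order_embeddingD(4)[OF \<theta>(3)])
      show ?thesis
      proof (rule trivial_extension_stage[OF True _ \<theta>(3) t])
        show "simple_field_ext (\<phi> ` carrier (residue_field v))" using simple True kv by simp
        fix \<phi>' V R
        assume "stage \<phi>' V R (0 :: 'd)" "\<And>a. a \<noteq> 0 \<Longrightarrow> V [:a:] = \<theta> (v a, 0)" "\<And>a. R [:a:] = r a"
          "vals \<phi>' V = range (\<lambda>x. \<theta> (x, 0))" "ress \<phi>' V R = UNIV"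
        from transcendental_extension[OF this zero \<theta>] show ?thesis .
      qed
    next
      case False
      show ?thesis
      proof (rule ex_full_stage[OF fin[unfolded kv] \<theta>(3) False])
        fix \<phi>' V R and \<beta> :: 'd
        assume "stage \<phi>' V R \<beta>" "\<And>a. a \<noteq> 0 \<Longrightarrow> V [:a:] = \<theta> (v a, 0)" "\<And>a. R [:a:] = r a"
          "vals \<phi>' V = range (\<lambda>x. \<theta> (x, 0))" "ress \<phi>' V R = UNIV" "\<beta> \<in> range (\<lambda>x. \<theta> (x, 0))"
        from transcendental_extension[OF this \<theta>] show ?thesis .
      qed
    qed
  have part2: "\<exists>w :: 'k poly fract \<Rightarrow> 'g. valuation_extends ratfun_const id v w \<and>
      value_group w = UNIV \<and> residue_field_iso_over ratfun_const v w (ratfun_const \<circ> \<phi>)"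
    if fin: "finite (carrier (value_quotient v))" "finite_field_ext kv"
      and nt: "\<not> trivial_valuation v"
  proof (rule ex_full_stage[OF fin[unfolded kv] id_emb nt])
      fix \<phi>' V R and \<beta> :: 'g
      assume st: "stage \<phi>' V R \<beta>" "\<And>a. a \<noteq> 0 \<Longrightarrow> V [:a:] = v a" "\<And>a. R [:a:] = r a"
        "vals \<phi>' V = range (\<lambda>x. x)" "ress \<phi>' V R = UNIV"
      obtain c where "\<beta> < v c" using cofinal_v[OF nt, of \<beta>] by blast
      from rational_residue_extension[OF st(1-3) st(4)[unfolded image_ident] st(5) this]
      show ?thesis .
    qed
  have part3: "\<exists>w :: 'k poly fract \<Rightarrow> 'g. valuation_extends ratfun_const id v w \<and>
      value_group w = UNIV \<and> residue_field_iso_over ratfun_const v w \<phi>"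
    if nt: "\<not> trivial_valuation v" and cg: "countably_generated_group (value_quotient v)"
      and cf: "countably_generated_field_ext kv"
      and or: "infinite (carrier (value_quotient v)) \<or> \<not> finite_field_ext kv \<or>
        (\<exists>(i :: 'k \<Rightarrow> 'l) (u :: 'l \<Rightarrow> 'g). immediate_transcendental_ext i v u)"
  proof (cases "infinite (carrier (value_quotient v)) \<or> \<not> finite_field_ext kv")
      case True
      show ?thesis by (rule limit_extension[OF nt cg cf[unfolded kv] True[unfolded kv]])
    next
      case False
      then have "\<exists>(i :: 'k \<Rightarrow> 'l) (u :: 'l \<Rightarrow> 'g). immediate_transcendental_ext i v u"
        using or by simp
      then obtain i :: "'k \<Rightarrow> 'l" and u :: "'l \<Rightarrow> 'g" where imm: "immediate_transcendental_ext i v u"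
        by (elim exE)
      have fin: "finite (carrier (value_quotient v))" "finite_field_ext (\<phi> ` carrier (residue_field v))"
        using False by (simp_all add: kv)
      show ?thesis by (rule immediate_extension[OF nt fin imm])
  qed
  show ?thesis
  proof (rule conjI; intro impI)
    assume fin: "finite (carrier (value_quotient v)) \<and> finite_field_ext kv"
    show "((trivial_valuation v \<longrightarrow> simple_field_ext kv) \<longrightarrow>
           (\<exists>w :: 'k poly fract \<Rightarrow> 'd.
              valuation_extends ratfun_const (\<lambda>a. \<theta> (a, 0)) v w \<and>
              value_group w = UNIV \<and>
              residue_field_iso_over ratfun_const v w \<phi>)) \<and>
        (\<not> trivial_valuation v \<longrightarrow>
           (\<exists>w :: 'k poly fract \<Rightarrow> 'g.
              valuation_extends ratfun_const id v w \<and>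
              value_group w = UNIV \<and>
              residue_field_iso_over ratfun_const v w (ratfun_const \<circ> \<phi>)))"
      by (rule conjI; rule impI)
        (rule part1[OF conjunct1[OF fin] conjunct2[OF fin]], assumption,
         rule part2[OF conjunct1[OF fin] conjunct2[OF fin]], assumption)
  qed (elim conjE, rule part3)
qed

end
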